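(* Let $M\ge1$ and let $a_1,\dots,a_{M+3},b_1,\dots,b_{M+3}$ be variables subject to $a_1\cdots a_{M+3}=q^2b_1\cdots b_{M+3}$. For $1\le i,j\le M+3$ the Jackson integral of Riemann--Papperitz type $$\varphi_{i,j}=\int_{q/a_i}^{q/a_j}\prod_{k=1}^{M+3}\frac{(a_kt)_\infty}{(b_kt)_\infty}d_qt$$ is a solution $y=\varphi_{i,j}$ of the following system of $q$-difference equations, called $q$-$RP^M$: $$\hat E_M\,y=0,$$ $$[(a_1-a_kq)T_{a_k}T_{a_l}^{-1}-(a_l-a_kq)T_{a_k}T_{a_1}^{-1}+(a_l-a_1)]y=0,$$ $$[(b_1-a_1)T_{a_1}T_{a_k}^{-1}-(q^{-1}a_k-a_1)T_{a_1}T_{b_1}+(q^{-1}a_k-b_1)]y=0,$$ $$[(b_1-q^{-1}b_l)T_{b_k}T_{b_l}^{-1}-(b_k-q^{-1}b_l)T_{b_1}T_{b_l}^{-1}+(b_k-b_1)]y=0,$$ $$[(a_1-b_1)T_{b_k}T_{b_1}^{-1}-(b_kq-b_1)(T_{a_1}T_{b_1})^{-1}+(b_kq-a_1)]y=0,$$ $$[(b_1-a_k)T_{a_k}T_{b_l}-(b_l-a_k)T_{a_k}T_{b_1}+(b_l-b_1)]y=0,$$ $$[(b_l-a_1)T_{a_k}^{-1}T_{b_l}^{-1}-(b_l-a_k)T_{a_1}^{-1}T_{b_l}^{-1}+(a_1-a_k)]y=0,$$ $$\left(q\prod_{k=1}^{M+3}T_{a_k}T_{b_k}-1\right)y=0,$$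 where $2\le k\ne l\le M+3$, and where, with $T=T_{a_1}T_{b_1}$, $\hat a=(a_2,\dots,a_{M+3})$, $\hat b=(b_2,\dots,b_{M+3})$, $$\hat E_M=b_1^{M+2}T^{-1}\prod_{i=0}^M\bigl(1-(a_1q^i/b_1)T\bigr)$$ $$+\sum_{k=1}^{M+1}(-1)^kb_1^{M+2-k}\bigl[e_k(\hat a)T^{-1}-q\,e_k(\hat b)\bigr]\prod_{i=0}^{M-k}\bigl(1-(a_1q^i/b_1)T\bigr)\prod_{i=0}^{k-2}(1-q^{-i}T)$$ $$+(-1)^Ma_2\cdots a_{M+3}T^{-1}\prod_{i=0}^M(1-q^{-i}T).$$ Moreover, the rank of the system $q$-$RP^M$ is $M+1$.
   Context: Fix $q\in\mathbb C$ with $0<|q|<1$. $(a)_\infty=\prod_{i\ge0}(1-aq^i)$. It is always assumed that none of the denominators vanishes. Jackson integral: $\int_0^\tau f(t)d_qt=(1-q)\sum_{n\ge0}f(\tau q^n)\tau q^n$, $\int_{\tau_1}^{\tau_2}=\int_0^{\tau_2}-\int_0^{\tau_1}$. $T_x$ denotes the $q$-shift $T_xf(x)=f(qx)$ in the variable $x$, leaving the other variables fixed; operator coefficients (functions of $a_i,b_i$) are written to the left and act by multiplication. All shift operators occurring preserve the relation $a_1\cdots a_{M+3}=q^2b_1\cdots b_{M+3}$. $e_k$ is the elementary symmetric polynomial of degree $k$; empty products equal $1$. Rank: for a homogeneous linear $q$-difference system $E=E(T_1,\dots,T_n)$ in variables $\{x_i\}$, where each $T_j$ is a product of integer powers of the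 $T_{x_i}$, put $F=\mathbb C(\{x_i\})$ (the field of rational functions in the variables). The rank of $E$ is $$\dim_F\bigl(\mathrm{span}_F\{T_j^iy\mid 1\le j\le n,\ i\in\mathbb Z\}/\!\sim\bigr),$$ where $A(y)\sim B(y)$ means that $A(y)-B(y)=0$ for every solution $y$ of $E$. For $q$-$RP^M$ the variables are $a_i,b_i$ ($1\le i\le M+3$) subject to the relation $a_1\cdots a_{M+3}=q^2b_1\cdots b_{M+3}$, and the operators are the shifts $T_{a_k}T_{a_l}^{-1}$, $T_{b_k}T_{b_l}^{-1}$, $T_{a_k}T_{b_l}$ preserving this relation. *)

theory Defs
  imports "HOL-Analysis.Analysis"
begin

section \<open>Rank of a linear q-difference system\<close>

text \<open>
  The variables range over a set \<open>D\<close> of points, and \<open>X\<close> is the set of the coordinate functions.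
  The field \<open>F\<close> of rational functions in the variables consists of the fractions of polynomial
  functions whose denominator is not identically zero on \<open>D\<close>, two fractions being equal in \<open>F\<close> if
  they agree on the part of \<open>D\<close> where some polynomial that is not identically zero on \<open>D\<close> does
  not vanish.  This treats algebraic relations between the variables correctly: for \<open>D\<close> Zariski
  dense in an irreducible variety, \<open>F\<close> is the function field of that variety.
\<close>

inductive_set polyfuns :: "('p \<Rightarrow> complex) set \<Rightarrow> ('p \<Rightarrow> complex) set"
  for X :: "('p \<Rightarrow> complex) set" where
  const: "(\<lambda>_. c) \<in> polyfuns X"
| coord: "x \<in> X \<Longrightarrow> x \<in> polyfuns X"
| add: "f \<in> polyfuns X \<Longrightarrow> g \<in> polyfuns X \<Longrightarrow> (\<lambda>p. f p + g p) \<in> polyfuns X"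
| mult: "f \<in> polyfuns X \<Longrightarrow> g \<in> polyfuns X \<Longrightarrow> (\<lambda>p. f p * g p) \<in> polyfuns X"

definition ratfuns :: "'p set \<Rightarrow> ('p \<Rightarrow> complex) set \<Rightarrow> ('p \<Rightarrow> complex) set" where
  "ratfuns D X = {\<lambda>p. f p / g p | f g. f \<in> polyfuns X \<and> g \<in> polyfuns X \<and> (\<exists>p\<in>D. g p \<noteq> 0)}"

definition generically_zero :: "'p set \<Rightarrow> ('p \<Rightarrow> complex) set \<Rightarrow> ('p \<Rightarrow> complex) \<Rightarrow> bool" where
  "generically_zero D X f \<longleftrightarrow>
     (\<exists>h\<in>polyfuns X. (\<exists>p\<in>D. h p \<noteq> 0) \<and> (\<forall>p\<in>D. h p \<noteq> 0 \<longrightarrow> f p = 0))"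

type_synonym 'p operator = "('p \<Rightarrow> complex) \<Rightarrow> 'p \<Rightarrow> complex"

definition lin_comb :: "('p operator \<Rightarrow> 'p \<Rightarrow> complex) \<Rightarrow> 'p operator set \<Rightarrow> 'p operator" where
  "lin_comb c S = (\<lambda>y p. \<Sum>A\<in>S. c A p * A y p)"

definition op_span :: "'p set \<Rightarrow> ('p \<Rightarrow> complex) set \<Rightarrow> 'p operator set \<Rightarrow> 'p operator set" where
  "op_span D X G = {lin_comb c S | c S. finite S \<and> S \<subseteq> G \<and> (\<forall>A\<in>S. c A \<in> ratfuns D X)}"

text \<open>The relation \<open>A(y) \<sim> B(y)\<close>, where \<open>Sol\<close> is the set of solutions of the system.\<close>

definition op_equiv ::
    "'p set \<Rightarrow> ('p \<Rightarrow> complex) set \<Rightarrow> ('p \<Rightarrow> complex) set \<Rightarrow> 'p operator \<Rightarrow> 'p operator \<Rightarrow> bool" where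
  "op_equiv D X Sol A B \<longleftrightarrow> (\<forall>y\<in>Sol. generically_zero D X (\<lambda>p. A y p - B y p))"

text \<open>
  The quotient of the \<open>F\<close>-span of \<open>G\<close> by this relation has dimension \<open>r\<close> over \<open>F\<close>: there is a
  set \<open>B\<close> of \<open>r\<close> elements of the span whose classes form a basis of the quotient.  For the rank,
  \<open>G\<close> is the set of all powers \<open>T\<^sub>j\<^sup>i\<close> with \<open>i\<close> an integer.
\<close>

definition has_rank ::
    "'p set \<Rightarrow> ('p \<Rightarrow> complex) set \<Rightarrow> 'p operator set \<Rightarrow> ('p \<Rightarrow> complex) set \<Rightarrow> nat \<Rightarrow> bool" where
  "has_rank D X G Sol r \<longleftrightarrow>
     (\<exists>B. finite B \<and> card B = r \<and> B \<subseteq> op_span D X G \<and>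
        (\<forall>c. (\<forall>A\<in>B. c A \<in> ratfuns D X) \<and> op_equiv D X Sol (lin_comb c B) (\<lambda>_ _. 0)
              \<longrightarrow> (\<forall>A\<in>B. generically_zero D X (c A))) \<and>
        (\<forall>A\<in>op_span D X G. \<exists>c. (\<forall>C\<in>B. c C \<in> ratfuns D X) \<and> op_equiv D X Sol A (lin_comb c B)))"


section \<open>Jackson integrals\<close>

definition qpoch_inf :: "complex \<Rightarrow> complex \<Rightarrow> complex" where
  "qpoch_inf q x = (\<Prod>i. 1 - x * q ^ i)"

definition jackson0 :: "complex \<Rightarrow> (complex \<Rightarrow> complex) \<Rightarrow> complex \<Rightarrow> complex" where
  "jackson0 q f \<tau> = (1 - q) * (\<Sum>n. f (\<tau> * q ^ n) * \<tau> * q ^ n)"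

definition jackson :: "complex \<Rightarrow> (complex \<Rightarrow> complex) \<Rightarrow> complex \<Rightarrow> complex \<Rightarrow> complex" where
  "jackson q f \<tau>1 \<tau>2 = jackson0 q f \<tau>2 - jackson0 q f \<tau>1"


section \<open>The variables and their shifts\<close>

type_synonym params = "(nat \<Rightarrow> complex) \<times> (nat \<Rightarrow> complex)"

text \<open>
  The domain of the unknown functions.  The last condition keeps the denominators
  \<open>(b\<^sub>k t)\<^sub>\<infinity>\<close> at the points \<open>t = q\<^sup>n\<^sup>+\<^sup>1 / a\<^sub>i\<close> away from zero, at a given point and at all its
  shifts, so the domain is invariant under all shifts that preserve the relation.
\<close>

definition rp_domain :: "complex \<Rightarrow> nat \<Rightarrow> params set" where
  "rp_domain q M = {(a, b).
     a \<in> {1..M+3} \<rightarrow>\<^sub>E - {0} \<and> b \<in> {1..M+3} \<rightarrow>\<^sub>E - {0} \<and>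
     (\<Prod>k=1..M+3. a k) = q^2 * (\<Prod>k=1..M+3. b k) \<and>
     (\<forall>i\<in>{1..M+3}. \<forall>k\<in>{1..M+3}. \<forall>n::int. a i \<noteq> b k * q powi n)}"

definition rp_coords :: "nat \<Rightarrow> (params \<Rightarrow> complex) set" where
  "rp_coords M = {\<lambda>(a, b). a k | k. k \<in> {1..M+3}} \<union> {\<lambda>(a, b). b k | k. k \<in> {1..M+3}}"

text \<open>\<open>Ta q k n\<close> and \<open>Tb q k n\<close> are the \<open>n\<close>-th powers of the shifts in \<open>a\<^sub>k\<close> and \<open>b\<^sub>k\<close>.\<close>

definition Ta :: "complex \<Rightarrow> nat \<Rightarrow> int \<Rightarrow> params operator" where
  "Ta q k n y = (\<lambda>(a, b). y (a(k := q powi n * a k), b))"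

definition Tb :: "complex \<Rightarrow> nat \<Rightarrow> int \<Rightarrow> params operator" where
  "Tb q k n y = (\<lambda>(a, b). y (a, b(k := q powi n * b k)))"

definition rp_shift_powers :: "complex \<Rightarrow> nat \<Rightarrow> params operator set" where
  "rp_shift_powers q M =
     {Ta q k i \<circ> Ta q l (- i) | k l i. k \<in> {1..M+3} \<and> l \<in> {1..M+3} \<and> k \<noteq> l} \<union>
     {Tb q k i \<circ> Tb q l (- i) | k l i. k \<in> {1..M+3} \<and> l \<in> {1..M+3} \<and> k \<noteq> l} \<union>
     {Ta q k i \<circ> Tb q l i | k l i. k \<in> {1..M+3} \<and> l \<in> {1..M+3}}"


section \<open>The system q-RP\<close>

definition esym :: "nat \<Rightarrow> nat set \<Rightarrow> (nat \<Rightarrow> complex) \<Rightarrow> complex" where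
  "esym k I x = (\<Sum>S | S \<subseteq> I \<and> card S = k. \<Prod>i\<in>S. x i)"

definition op_prod :: "('i \<Rightarrow> 'p operator) \<Rightarrow> 'i list \<Rightarrow> 'p operator" where
  "op_prod f is = foldr (\<lambda>i A. f i \<circ> A) is id"

definition T1 :: "complex \<Rightarrow> params operator" where
  "T1 q = Ta q 1 1 \<circ> Tb q 1 1"

definition T1_inv :: "complex \<Rightarrow> params operator" where
  "T1_inv q = Ta q 1 (-1) \<circ> Tb q 1 (-1)"

text \<open>The products of the first \<open>n\<close> factors \<open>1 - (a\<^sub>1 q\<^sup>i / b\<^sub>1) T\<close> and \<open>1 - q\<^sup>-\<^sup>i T\<close>, \<open>i = 0, 1, \<dots>\<close>\<close>

definition prodA :: "complex \<Rightarrow> nat \<Rightarrow> params operator" where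
  "prodA q n =
     op_prod (\<lambda>i y. \<lambda>(a, b). y (a, b) - (a 1 * q ^ i / b 1) * T1 q y (a, b)) [0..<n]"

definition prodB :: "complex \<Rightarrow> nat \<Rightarrow> params operator" where
  "prodB q n = op_prod (\<lambda>i y p. y p - q powi (- int i) * T1 q y p) [0..<n]"

definition E_hat :: "complex \<Rightarrow> nat \<Rightarrow> params operator" where
  "E_hat q M y = (\<lambda>(a, b).
     b 1 ^ (M+2) * (T1_inv q \<circ> prodA q (M+1)) y (a, b)
     + (\<Sum>k=1..M+1. (-1) ^ k * b 1 ^ (M+2-k) *
          (esym k {2..M+3} a * (T1_inv q \<circ> prodA q (M+1-k) \<circ> prodB q (k-1)) y (a, b)
           - q * esym k {2..M+3} b * (prodA q (M+1-k) \<circ> prodB q (k-1)) y (a, b)))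
     + (-1) ^ M * (\<Prod>k=2..M+3. a k) * (T1_inv q \<circ> prodB q (M+1)) y (a, b))"

text \<open>
  Solutions are arbitrary functions on the domain; no regularity is required.  As the domain is
  shift invariant and every equation relates the values on a single shift orbit, this includes
  functions on any smaller shift-invariant domain (extend them by zero).  Values outside of the
  domain are irrelevant.
\<close>

definition qRP_solution :: "complex \<Rightarrow> nat \<Rightarrow> (params \<Rightarrow> complex) \<Rightarrow> bool" where
  "qRP_solution q M y \<longleftrightarrow> (\<forall>(a, b)\<in>rp_domain q M.
     E_hat q M y (a, b) = 0 \<and>
     (\<forall>k\<in>{2..M+3}. \<forall>l\<in>{2..M+3}. k \<noteq> l \<longrightarrow>
        (a 1 - a k * q) * (Ta q k 1 \<circ> Ta q l (-1)) y (a, b)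
          - (a l - a k * q) * (Ta q k 1 \<circ> Ta q 1 (-1)) y (a, b)
          + (a l - a 1) * y (a, b) = 0) \<and>
     (\<forall>k\<in>{2..M+3}.
        (b 1 - a 1) * (Ta q 1 1 \<circ> Ta q k (-1)) y (a, b)
          - (inverse q * a k - a 1) * (Ta q 1 1 \<circ> Tb q 1 1) y (a, b)
          + (inverse q * a k - b 1) * y (a, b) = 0) \<and>
     (\<forall>k\<in>{2..M+3}. \<forall>l\<in>{2..M+3}. k \<noteq> l \<longrightarrow>
        (b 1 - inverse q * b l) * (Tb q k 1 \<circ> Tb q l (-1)) y (a, b)
          - (b k - inverse q * b l) * (Tb q 1 1 \<circ> Tb q l (-1)) y (a, b)
          + (b k - b 1) * y (a, b) = 0) \<and>
     (\<forall>k\<in>{2..M+3}.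
        (a 1 - b 1) * (Tb q k 1 \<circ> Tb q 1 (-1)) y (a, b)
          - (b k * q - b 1) * (Ta q 1 (-1) \<circ> Tb q 1 (-1)) y (a, b)
          + (b k * q - a 1) * y (a, b) = 0) \<and>
     (\<forall>k\<in>{2..M+3}. \<forall>l\<in>{2..M+3}. k \<noteq> l \<longrightarrow>
        (b 1 - a k) * (Ta q k 1 \<circ> Tb q l 1) y (a, b)
          - (b l - a k) * (Ta q k 1 \<circ> Tb q 1 1) y (a, b)
          + (b l - b 1) * y (a, b) = 0) \<and>
     (\<forall>k\<in>{2..M+3}. \<forall>l\<in>{2..M+3}. k \<noteq> l \<longrightarrow>
        (b l - a 1) * (Ta q k (-1) \<circ> Tb q l (-1)) y (a, b)
          - (b l - a k) * (Ta q 1 (-1) \<circ> Tb q l (-1)) y (a, b)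
          + (a 1 - a k) * y (a, b) = 0) \<and>
     q * op_prod (\<lambda>k. Ta q k 1 \<circ> Tb q k 1) [1..<M+4] y (a, b) - y (a, b) = 0)"

definition phi :: "complex \<Rightarrow> nat \<Rightarrow> nat \<Rightarrow> nat \<Rightarrow> params \<Rightarrow> complex" where
  "phi q M i j = (\<lambda>(a, b).
     jackson q (\<lambda>t. \<Prod>k=1..M+3. qpoch_inf q (a k * t) / qpoch_inf q (b k * t)) (q / a i) (q / a j))"

end

(*
  Every shift preserving the relation multiplies f(t), the product of the (a_k t)_inf/(b_k t)_inf,
  by a rational function of t.  All equations except E_hat y = 0 and the last one are linear
  relations between such multiples that hold pointwise in t.  The remaining two are q-exact:
  E_hat f(t) t = c (G(t) - G(q t)), where G is itself a shift of f.  Any linear functional on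
  functions of t that kills these q-differences yields a solution, and Jackson integrals
  are the case of a difference of two bilateral sums.

  Rank at most M+1: the equations for T_{a_1} T_{a_k}^{-1} and T_{b_k} T_{b_1}^{-1} together with
  E_hat reduce every shift to 1, T, ..., T^M.  The inverse shifts are reduced by evaluating E_hat on
  the formal solution f(t) at the t where the reduction coefficients degenerate.

  Rank at least M+1: over each shift orbit the classes of f, T f, ..., T^M f modulo q-exact functions
  are linearly independent: consider the poles of a primitive.  Dual functionals on the
  orbits are glued to solutions; countably many hypersurfaces do not cover the domain.
*)

theory Submission
  imports Defs "HOL-Complex_Analysis.Complex_Analysis" "HOL-Library.Function_Algebras"
begin

section \<open>q-shifted factorials and shifts of the parameters\<close>

text \<open>The limits \<open>q / a_i\<close> of the integrals move with the parameters. Since the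
  weight vanishes at \<open>q^n / a_i\<close> for \<open>n \<le> 0\<close>, each half of an integral
  is a sum over a whole lattice that no shift moves, so shifts act on the summand alone. The
  primitive for \<open>E_hat\<close> tends to the same nonzero constant along every lattice, which
  is why only differences of two sums are solutions. That primitive is a shift whose a- and
  b-exponents differ in total by -2, and this number decides the lower bound: in lowest form a
  primitive of a combination of \<open>1, T, ..., T^M\<close> is a weight times a polynomial of
  degree at most M + 2, while exactness forces M + 3 linear factors to divide it, so it is 0. In the
  reduction, coefficients are substituted at shifted points and divided by again, so their
  denominators must vanish nowhere on the domain. The values of t at which \<open>E_hat\<close> has
  to be evaluated may be zeros or poles of the weight; quotients of weights, which are polynomials
  in t, take its place there. Solutions carry no regularity, so functionals may be chosen
  independently on the orbits; but equivalence of operators is tested only off a hypersurface, which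
  has to be avoided along an entire orbit.\<close>

lemma summable_norm_geometric:
  fixes q x :: complex
  assumes "norm q < 1"
  shows "summable (\<lambda>n. norm (x * q ^ n))"
  using assms by (simp add: norm_mult norm_power summable_mult summable_geometric)

lemma qpoch_convergent:
  fixes q x :: complex
  assumes "norm q < 1"
  shows "convergent_prod (\<lambda>i. 1 - x * q ^ i)"
  by (intro abs_convergent_prod_imp_convergent_prod summable_imp_abs_convergent_prod)
     (use summable_norm_geometric[OF assms, of x] in simp)

lemma qpoch_inf_split:
  assumes "norm q < 1" "\<And>i. i < n \<Longrightarrow> x * q ^ i \<noteq> 1"
  shows "qpoch_inf q x = (\<Prod>i<n. 1 - x * q ^ i) * qpoch_inf q (x * q ^ n)"
proof -
  have "qpoch_inf q x = (\<Prod>i<n. 1 - x * q ^ i) * (\<Prod>i. 1 - x * q ^ (i + n))"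
    unfolding qpoch_inf_def
    by (subst prodinf_split_initial_segment[OF qpoch_convergent[OF assms(1)], of n]) (use assms in auto)
  also have "(\<lambda>i. 1 - x * q ^ (i + n)) = (\<lambda>i. 1 - (x * q ^ n) * q ^ i)"
    by (simp add: power_add algebra_simps)
  finally show ?thesis by (simp add: qpoch_inf_def)
qed

lemma qpoch_inf_eq_0_iff:
  assumes "norm q < 1"
  shows "qpoch_inf q x = 0 \<longleftrightarrow> (\<exists>n. x * q ^ n = 1)"
proof
  show "\<exists>n. x * q ^ n = 1" if "qpoch_inf q x = 0"
    using that prodinf_nonzero[OF qpoch_convergent[OF assms, of x]]
    unfolding qpoch_inf_def by auto
next
  assume "\<exists>n. x * q ^ n = 1"
  then obtain n where n: "1 - x * q ^ n = 0" by auto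
  have "(\<lambda>i. 1 - x * q ^ i) has_prod qpoch_inf q x"
    unfolding qpoch_inf_def by (rule convergent_prod_has_prod[OF qpoch_convergent[OF assms]])
  then show "qpoch_inf q x = 0"
    using n by (rule has_prod_zeroI)
qed

lemma qpoch_inf_rec:
  assumes "norm q < 1"
  shows "qpoch_inf q x = (1 - x) * qpoch_inf q (q * x)"
proof (cases "x = 1")
  case True
  then show ?thesis using qpoch_inf_eq_0_iff[OF assms, of 1] by (auto intro: exI[of _ 0])
next
  case False
  then show ?thesis using qpoch_inf_split[OF assms, of 1 x] by (simp add: mult.commute)
qed

text \<open>The value at \<open>x * q ^ n\<close> is a tail of the product, hence the total divided
  by a partial product. The first \<open>m\<close> factors are dropped beforehand: one of them may
  vanish, and then the quotient would say nothing.\<close>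

lemma tendsto_qpoch_inf_power:
  assumes "norm q < 1"
  shows "(\<lambda>n. qpoch_inf q (x * q ^ n)) \<longlonglongrightarrow> 1"
proof -
  have "(\<lambda>n. x * q ^ n) \<longlonglongrightarrow> x * 0"
    by (intro tendsto_intros LIMSEQ_power_zero assms)
  then have "eventually (\<lambda>n. dist (x * q ^ n) 0 < 1) sequentially"
    by (intro tendstoD) auto
  then obtain m where m: "\<And>n. n \<ge> m \<Longrightarrow> norm (x * q ^ n) < 1"
    unfolding eventually_sequentially by auto
  define z where "z = x * q ^ m"
  have z: "z * q ^ n \<noteq> 1" for n
    using m[of "m + n"] by (auto simp: z_def power_add mult.assoc)
  have nz: "qpoch_inf q z \<noteq> 0"
    using z qpoch_inf_eq_0_iff[OF assms] by blast
  have "(\<lambda>n. \<Prod>i<n. 1 - z * q ^ i) \<longlonglongrightarrow> qpoch_inf q z"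
    unfolding qpoch_inf_def using convergent_prod_LIMSEQ[OF qpoch_convergent[OF assms, of z]]
    by (simp add: LIMSEQ_lessThan_iff_atMost)
  then have "(\<lambda>n. qpoch_inf q z / (\<Prod>i<n. 1 - z * q ^ i)) \<longlonglongrightarrow> qpoch_inf q z / qpoch_inf q z"
    by (intro tendsto_intros nz)
  moreover have "qpoch_inf q z / (\<Prod>i<n. 1 - z * q ^ i) = qpoch_inf q (x * q ^ (n + m))" for n
  proof -
    have "(\<Prod>i<n. 1 - z * q ^ i) \<noteq> 0" using z by auto
    then show ?thesis
      using qpoch_inf_split[OF assms, of n z] z by (simp add: z_def power_add mult_ac)
  qed
  ultimately have "(\<lambda>n. qpoch_inf q (x * q ^ (n + m))) \<longlonglongrightarrow> 1"
    using nz by simp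
  then show ?thesis by (rule LIMSEQ_offset)
qed

section \<open>Shift exponents and the domain\<close>

locale q_rp =
  fixes q :: complex and M :: nat
  assumes q_pos: "0 < norm q" and q_less: "norm q < 1" and M_pos: "M \<ge> 1"
begin

abbreviation I where "I \<equiv> {1..M+3}"
abbreviation J where "J \<equiv> {0..int M}"
abbreviation J' where "J' \<equiv> {-1..int M}"
abbreviation D where "D \<equiv> rp_domain q M"
abbreviation polys where "polys \<equiv> polyfuns (rp_coords M)"

lemma q0: "q \<noteq> 0" using q_pos by auto

lemma powi_q_eq_iff: "q powi m = q powi n \<longleftrightarrow> m = n"
proof
  assume "q powi m = q powi n"
  then have "norm q powi m = norm q powi n"
    by (metis norm_power_int)
  then show "m = n"
    using q_pos q_less
    by (metis linorder_cases less_irrefl power_int_strict_decreasing)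
qed simp

lemma powi_q_eq_1_iff: "q powi n = 1 \<longleftrightarrow> n = 0"
  using powi_q_eq_iff[of n 0] by simp

text \<open>A shift is a pair of integer exponent vectors, so that composition becomes addition.
  Indices outside \<open>I\<close> stay untouched because points of \<open>D\<close> are extensional
  there. The relation between the variables survives when both vectors have the same sum
  \<open>wt\<close>.\<close>

definition sh :: "(nat \<Rightarrow> int) \<Rightarrow> (nat \<Rightarrow> int) \<Rightarrow> params \<Rightarrow> params" where
  "sh x y p = ((\<lambda>k. if k \<in> I then q powi x k * fst p k else fst p k),
               (\<lambda>k. if k \<in> I then q powi y k * snd p k else snd p k))"

abbreviation Z :: "nat \<Rightarrow> int" where "Z \<equiv> \<lambda>_. 0"

abbreviation wt :: "(nat \<Rightarrow> int) \<Rightarrow> int" where "wt x \<equiv> sum x I"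

lemma sh_sh: "sh x y (sh x' y' p) = sh (\<lambda>k. x k + x' k) (\<lambda>k. y k + y' k) p"
  using q0 by (auto simp: sh_def power_int_add fun_eq_iff)

lemma sh_0 [simp]: "sh Z Z p = p"
  by (auto simp: sh_def fun_eq_iff prod_eq_iff)

lemma fst_sh [simp]: "k \<in> I \<Longrightarrow> fst (sh x y p) k = q powi x k * fst p k"
  and snd_sh [simp]: "k \<in> I \<Longrightarrow> snd (sh x y p) k = q powi y k * snd p k"
  by (auto simp: sh_def)

lemma sh_cong: "(\<And>k. k \<in> I \<Longrightarrow> x k = x' k) \<Longrightarrow> (\<And>k. k \<in> I \<Longrightarrow> y k = y' k) \<Longrightarrow> sh x y p = sh x' y' p"
  by (auto simp: sh_def fun_eq_iff)

lemma D_iff: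
  "p \<in> D \<longleftrightarrow> fst p \<in> I \<rightarrow>\<^sub>E - {0} \<and> snd p \<in> I \<rightarrow>\<^sub>E - {0} \<and>
     prod (fst p) I = q^2 * prod (snd p) I \<and>
     (\<forall>i\<in>I. \<forall>k\<in>I. \<forall>n::int. fst p i \<noteq> snd p k * q powi n)"
  by (auto simp: rp_domain_def split: prod.splits)

lemma D_nz: "p \<in> D \<Longrightarrow> k \<in> I \<Longrightarrow> fst p k \<noteq> 0" "p \<in> D \<Longrightarrow> k \<in> I \<Longrightarrow> snd p k \<noteq> 0"
  by (auto simp: D_iff)

lemma D_ne: "p \<in> D \<Longrightarrow> i \<in> I \<Longrightarrow> k \<in> I \<Longrightarrow> fst p i \<noteq> snd p k * q powi n"
  by (auto simp: D_iff)

lemma D_prod: "p \<in> D \<Longrightarrow> prod (fst p) I = q^2 * prod (snd p) I"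
  by (auto simp: D_iff)

lemma prod_powi: "finite A \<Longrightarrow> (\<Prod>k\<in>A. q powi x k) = q powi (\<Sum>k\<in>A. x k)"
  by (induction A rule: finite_induct) (auto simp: power_int_add q0)

lemma sh_D:
  assumes "p \<in> D" "wt x = wt y"
  shows "sh x y p \<in> D"
proof -
  have 1: "fst (sh x y p) \<in> I \<rightarrow>\<^sub>E - {0}" "snd (sh x y p) \<in> I \<rightarrow>\<^sub>E - {0}"
    using assms(1) q0 by (auto simp: D_iff sh_def PiE_iff extensional_def)
  have "prod (fst (sh x y p)) I = (\<Prod>k\<in>I. q powi x k) * prod (fst p) I"
    by (simp add: prod.distrib)
  also have "\<dots> = (\<Prod>k\<in>I. q powi y k) * prod (fst p) I"
    using assms(2) by (simp add: prod_powi del: sum.cl_ivl_Suc)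
  also have "\<dots> = q^2 * prod (snd (sh x y p)) I"
    using D_prod[OF assms(1)] by (simp add: prod.distrib)
  finally have 2: "prod (fst (sh x y p)) I = q^2 * prod (snd (sh x y p)) I" .
  have 3: "fst (sh x y p) i \<noteq> snd (sh x y p) k * q powi n" if "i \<in> I" "k \<in> I" for i k n
  proof
    assume "fst (sh x y p) i = snd (sh x y p) k * q powi n"
    then have "q powi (x i) * fst p i = snd p k * (q powi y k * q powi n)"
      using that by simp
    then have "q powi (- x i) * (q powi (x i) * fst p i) = snd p k * (q powi (- x i) * (q powi y k * q powi n))"
      by simp
    then have "fst p i = snd p k * q powi (y k + n - x i)"
      using q0 by (simp add: power_int_add power_int_diff power_int_minus field_simps)
    with D_ne[OF assms(1) that] show False by blast
  qed
  show ?thesis using 1 2 3 by (simp add: D_iff)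
qed

lemma Ta_sh: "k \<in> I \<Longrightarrow> Ta q k i y p = y (sh (Z(k := i)) Z p)"
  and Tb_sh: "k \<in> I \<Longrightarrow> Tb q k i y p = y (sh Z (Z(k := i)) p)"
  by (cases p, auto simp: Ta_def Tb_def sh_def fun_eq_iff intro!: arg_cong[of _ _ y])+

lemma Taa_sh: "k \<in> I \<Longrightarrow> l \<in> I \<Longrightarrow> k \<noteq> l \<Longrightarrow> (Ta q k i \<circ> Ta q l j) y p = y (sh (Z(k := i, l := j)) Z p)"
  by (auto simp: Ta_sh sh_sh intro!: arg_cong[of _ _ y] sh_cong)

lemma Tbb_sh: "k \<in> I \<Longrightarrow> l \<in> I \<Longrightarrow> k \<noteq> l \<Longrightarrow> (Tb q k i \<circ> Tb q l j) y p = y (sh Z (Z(k := i, l := j)) p)"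
  by (auto simp: Tb_sh sh_sh intro!: arg_cong[of _ _ y] sh_cong)

lemma Tab_sh: "k \<in> I \<Longrightarrow> l \<in> I \<Longrightarrow> (Ta q k i \<circ> Tb q l j) y p = y (sh (Z(k := i)) (Z(l := j)) p)"
  by (auto simp: Ta_sh Tb_sh sh_sh intro!: arg_cong[of _ _ y] sh_cong)

definition tw :: "int \<Rightarrow> params \<Rightarrow> params" where
  "tw n = sh (Z(1 := n)) (Z(1 := n))"

lemma tw_tw: "tw m (tw n p) = tw (m + n) p"
  unfolding tw_def by (auto simp: sh_sh intro!: sh_cong)

lemma tw_0 [simp]: "tw 0 p = p"
proof -
  have "tw 0 p = sh Z Z p" unfolding tw_def by (rule sh_cong) auto
  then show ?thesis by simp
qed

lemma fst_tw: "fst (tw n p) k = (if k = 1 then q powi n * fst p k else fst p k)"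
  and snd_tw: "snd (tw n p) k = (if k = 1 then q powi n * snd p k else snd p k)"
  by (auto simp: tw_def sh_def)

lemma T1_tw: "T1 q y p = y (tw 1 p)" and T1_inv_tw: "T1_inv q y p = y (tw (-1) p)"
  unfolding T1_def T1_inv_def tw_def by (subst Tab_sh; simp)+

lemma wt_single: "k \<in> I \<Longrightarrow> wt (Z(k := n)) = n"
proof -
  assume "k \<in> I"
  have "wt (Z(k := n)) = (\<Sum>j\<in>I. if j = k then n else 0)" by (intro sum.cong) auto
  then show ?thesis using \<open>k \<in> I\<close> by (subst (asm) sum.delta) auto
qed

lemma wt_double: "k \<in> I \<Longrightarrow> l \<in> I \<Longrightarrow> k \<noteq> l \<Longrightarrow> wt (Z(k := m, l := n)) = m + n"
proof -
  assume "k \<in> I" "l \<in> I" "k \<noteq> l"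
  then have "wt (Z(k := m, l := n)) = wt (\<lambda>j. (Z(k := m)) j + (Z(l := n)) j)"
    by (intro sum.cong) auto
  also have "\<dots> = m + n" using \<open>k \<in> I\<close> \<open>l \<in> I\<close> by (simp only: sum.distrib wt_single)
  finally show ?thesis .
qed

lemma tw_D: "p \<in> D \<Longrightarrow> tw n p \<in> D"
  unfolding tw_def by (rule sh_D) simp_all

section \<open>The weight and the admissible values of t\<close>

definition W :: "params \<Rightarrow> complex \<Rightarrow> complex" where
  "W p t = (\<Prod>k\<in>I. qpoch_inf q (fst p k * t) / qpoch_inf q (snd p k * t))"

text \<open>All integers \<open>n\<close> are excluded, not only those for which a factor of
  \<open>W p t\<close> vanishes. Thus the set is common to all shifts of \<open>p\<close> and stable
  under multiplying \<open>t\<close> by powers of \<open>q\<close>.\<close>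

definition good :: "params \<Rightarrow> complex set" where
  "good p = {t. t \<noteq> 0 \<and> (\<forall>k\<in>I. \<forall>n::int. snd p k * t * q powi n \<noteq> 1)}"

lemma good_sh: "good (sh x y p) = good p"
proof -
  have "good p \<subseteq> good (sh x y p)" for p x y
  proof
    fix t assume t: "t \<in> good p"
    show "t \<in> good (sh x y p)" unfolding good_def
    proof (clarsimp, intro conjI ballI allI)
      show "t \<noteq> 0" using t by (auto simp: good_def)
      fix k n assume k: "k \<in> {Suc 0..M + 3}"
      show "q powi y k * snd p k * t * q powi n \<noteq> 1"
      proof
        assume "q powi y k * snd p k * t * q powi n = 1"
        then have "snd p k * t * q powi (y k + n) = 1" using q0 by (simp add: power_int_add mult_ac)
        with t k show False by (auto simp: good_def)
      qed
    qed
  qed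
  from this[of p x y] this[of "sh x y p" "\<lambda>k. - x k" "\<lambda>k. - y k"]
  show ?thesis by (simp add: sh_sh)
qed

lemma good_ne: "t \<in> good p \<Longrightarrow> k \<in> I \<Longrightarrow> snd p k * t * q powi n \<noteq> 1"
  by (auto simp: good_def)

lemma good_q:
  assumes t: "t \<in> good p"
  shows "q powi m * t \<in> good p"
proof -
  have "snd p k * (q powi m * t) * q powi n \<noteq> 1" if "k \<in> I" for k n
  proof -
    have "snd p k * (q powi m * t) * q powi n = snd p k * t * q powi (m + n)"
      using q0 by (simp add: power_int_add mult_ac)
    then show ?thesis using good_ne[OF t that] by metis
  qed
  moreover have "q powi m * t \<noteq> 0" using t q0 by (auto simp: good_def)
  ultimately show ?thesis unfolding good_def by blast
qed

lemma good_nz: "t \<in> good p \<Longrightarrow> k \<in> I \<Longrightarrow> qpoch_inf q (snd p k * t) \<noteq> 0"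
proof
  assume "t \<in> good p" "k \<in> I" "qpoch_inf q (snd p k * t) = 0"
  then obtain n where "snd p k * t * q ^ n = 1" using qpoch_inf_eq_0_iff[OF q_less] by blast
  with good_ne[OF \<open>t \<in> good p\<close> \<open>k \<in> I\<close>, of "int n"] show False by simp
qed

lemma W_a:
  assumes k: "k \<in> I"
  shows "W (sh x y p) t = (1 - fst p k * q powi x k * t) * W (sh (x(k := x k + 1)) y p) t"
proof -
  let ?f = "\<lambda>x k. qpoch_inf q (fst (sh x y p) k * t) / qpoch_inf q (snd (sh x y p) k * t)"
  have "W (sh x y p) t = ?f x k * (\<Prod>j\<in>I-{k}. ?f x j)"
    unfolding W_def using k by (intro prod.remove) auto
  also have "(\<Prod>j\<in>I-{k}. ?f x j) = (\<Prod>j\<in>I-{k}. ?f (x(k := x k + 1)) j)"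
    by (intro prod.cong) auto
  also have "?f x k = (1 - fst p k * q powi x k * t) * ?f (x(k := x k + 1)) k"
    using k qpoch_inf_rec[OF q_less, of "q powi x k * fst p k * t"] q0
    by (simp add: power_int_add mult_ac)
  also have "\<dots> * (\<Prod>j\<in>I-{k}. ?f (x(k := x k + 1)) j) =
      (1 - fst p k * q powi x k * t) * (?f (x(k := x k + 1)) k * (\<Prod>j\<in>I-{k}. ?f (x(k := x k + 1)) j))"
    by simp
  also have "?f (x(k := x k + 1)) k * (\<Prod>j\<in>I-{k}. ?f (x(k := x k + 1)) j) = W (sh (x(k := x k + 1)) y p) t"
    unfolding W_def using k by (intro prod.remove[symmetric]) auto
  finally show ?thesis .
qed

text \<open>This turns the last equation of the system, and the value of a primitive at
  \<open>q * t\<close>, into statements about shifted weights at the same \<open>t\<close>.\<close>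

lemma W_q: "W p (q * t) = W (sh (\<lambda>_. 1) (\<lambda>_. 1) p) t"
  by (simp add: W_def mult_ac)

end

section \<open>The action of E_hat on a weight\<close>

lemma prod_one_plus_esym:
  assumes "finite A"
  shows "(\<Prod>i\<in>A. 1 + z * x i) = (\<Sum>k\<le>card A. z ^ k * esym k A x)"
proof -
  have "(\<Prod>i\<in>A. 1 + z * x i) = (\<Prod>i\<in>A. z * x i + 1)" by (simp add: add.commute)
  also have "\<dots> = (\<Sum>S\<in>Pow A. (\<Prod>i\<in>S. z * x i) * (\<Prod>i\<in>A-S. 1))"
    by (rule prod_add[OF assms])
  also have "\<dots> = (\<Sum>S\<in>Pow A. z ^ card S * prod x S)"
    by (simp add: prod.distrib)
  also have "\<dots> = (\<Sum>k\<le>card A. \<Sum>S\<in>{S\<in>Pow A. card S = k}. z ^ card S * prod x S)"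
    by (rule sum.group[symmetric]) (use assms in \<open>auto intro: card_mono\<close>)
  also have "\<dots> = (\<Sum>k\<le>card A. z ^ k * esym k A x)"
    by (intro sum.cong refl) (auto simp: esym_def sum_distrib_left intro!: sum.cong)
  finally show ?thesis .
qed

lemma esym_0: "finite A \<Longrightarrow> esym 0 A x = 1"
proof -
  assume "finite A"
  then have "{S. S \<subseteq> A \<and> card S = 0} = {{}}"
    by (auto dest: finite_subset)
  then show ?thesis unfolding esym_def by simp
qed

lemma esym_card: "finite A \<Longrightarrow> esym (card A) A x = prod x A"
proof -
  assume "finite A"
  then have "{S. S \<subseteq> A \<and> card S = card A} = {A}"
    by (auto dest: card_subset_eq)
  then show ?thesis unfolding esym_def by simp
qed

text \<open>\<open>op_prod\<close> puts the first factor outermost, whereas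
  \<open>[0..<Suc n]\<close> grows at its end; commuting factors let the new one move to the
  front.\<close>

lemma op_prod_snoc:
  assumes "\<And>i j. f i \<circ> f j = f j \<circ> f i"
  shows "op_prod f (xs @ [x]) = f x \<circ> op_prod f xs"
proof (induction xs)
  case (Cons i xs)
  have "op_prod f ((i # xs) @ [x]) = f i \<circ> op_prod f (xs @ [x])"
    by (simp add: op_prod_def)
  also have "\<dots> = f i \<circ> (f x \<circ> op_prod f xs)"
    by (simp only: Cons)
  also have "\<dots> = f x \<circ> op_prod f (i # xs)"
    using assms[of i x] by (simp add: op_prod_def flip: comp_assoc)
  finally show ?case .
qed (simp add: op_prod_def)

text \<open>Functionals are total functions, so linearity is demanded only on a subspace
  \<open>S\<close>: the summable functions for Jackson sums, all functions for the functionals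
  obtained by basis extension.\<close>

definition lin_on :: "(complex \<Rightarrow> complex) set \<Rightarrow> ((complex \<Rightarrow> complex) \<Rightarrow> complex) \<Rightarrow> bool" where
  "lin_on S L \<longleftrightarrow> (\<lambda>_. 0) \<in> S \<and> (\<forall>c f g. f \<in> S \<longrightarrow> g \<in> S \<longrightarrow>
     (\<lambda>t. c * f t + g t) \<in> S \<and> L (\<lambda>t. c * f t + g t) = c * L f + L g)"

lemma lin_onD:
  assumes "lin_on S L"
  shows "(\<lambda>_. 0) \<in> S" "f \<in> S \<Longrightarrow> g \<in> S \<Longrightarrow> (\<lambda>t. c * f t + g t) \<in> S"
    "f \<in> S \<Longrightarrow> g \<in> S \<Longrightarrow> L (\<lambda>t. c * f t + g t) = c * L f + L g"
  using assms by (auto simp: lin_on_def)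

lemma lin_on_0: "lin_on S L \<Longrightarrow> L (\<lambda>_. 0) = 0"
  using lin_onD(1)[of S L] lin_onD(3)[of S L "\<lambda>_. 0" "\<lambda>_. 0" 1] by simp

lemma lin_on_sum:
  assumes "lin_on S L" "finite A" "\<And>i. i \<in> A \<Longrightarrow> f i \<in> S"
  shows "(\<lambda>t. \<Sum>i\<in>A. c i * f i t) \<in> S \<and> L (\<lambda>t. \<Sum>i\<in>A. c i * f i t) = (\<Sum>i\<in>A. c i * L (f i))"
  using assms(2,3)
proof (induction A rule: finite_induct)
  case empty
  then show ?case using lin_onD(1)[OF assms(1)] lin_on_0[OF assms(1)] by simp
next
  case (insert x A)
  then have "(\<lambda>t. \<Sum>i\<in>A. c i * f i t) \<in> S" "f x \<in> S"
     "L (\<lambda>t. \<Sum>i\<in>A. c i * f i t) = (\<Sum>i\<in>A. c i * L (f i))" by auto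
  with lin_onD(2,3)[OF assms(1), of "f x" "\<lambda>t. \<Sum>i\<in>A. c i * f i t" "c x"] insert.hyps
  show ?case by simp
qed

lemma lin_on_three:
  assumes "lin_on S L" "f \<in> S" "g \<in> S" "h \<in> S" "\<And>t. a * f t + b * g t + c * h t = 0"
  shows "a * L f + b * L g + c * L h = 0"
proof -
  let ?f = "\<lambda>i::nat. [f, g, h] ! i" and ?c = "\<lambda>i. [a, b, c] ! i"
  have lt: "{..<3::nat} = {0, 1, 2}" by auto
  have "L (\<lambda>t. \<Sum>i<3. ?c i * ?f i t) = (\<Sum>i<3. ?c i * L (?f i))"
    by (rule conjunct2[OF lin_on_sum[OF assms(1)]]) (use assms(2-4) in \<open>auto simp: lt\<close>)
  then show ?thesis using lin_on_0[OF assms(1)] assms(5) by (simp add: lt add.assoc)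
qed

context q_rp
begin

lemma I1: "1 \<in> I" by simp

lemma prodA_0: "prodA q 0 y p = y p" and prodB_0: "prodB q 0 y p = y p"
  by (simp_all add: prodA_def prodB_def op_prod_def)

text \<open>The factors commute because \<open>a_1 / b_1\<close> is invariant under
  \<open>T\<close>.\<close>

lemma prodA_Suc:
  "prodA q (Suc n) y p = prodA q n y p - (fst p 1 * q ^ n / snd p 1) * prodA q n y (tw 1 p)"
proof -
  define f :: "nat \<Rightarrow> params operator"
    where "f i y = (\<lambda>(a, b). y (a, b) - (a 1 * q ^ i / b 1) * T1 q y (a, b))" for i y
  have f: "f i y p = y p - (fst p 1 * q ^ i / snd p 1) * y (tw 1 p)" for i y p
    by (cases p) (simp add: f_def T1_tw)
  have "f i \<circ> f j = f j \<circ> f i" for i j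
    using q0 by (intro ext) (simp add: f tw_tw fst_tw snd_tw algebra_simps)
  then have "op_prod f ([0..<n] @ [n]) = f n \<circ> op_prod f [0..<n]"
    by (rule op_prod_snoc)
  moreover have "prodA q n = op_prod f [0..<n]" for n
    unfolding prodA_def f_def ..
  ultimately show ?thesis by (simp add: f)
qed

lemma prodB_Suc:
  "prodB q (Suc n) y p = prodB q n y p - q powi (- int n) * prodB q n y (tw 1 p)"
proof -
  define f :: "nat \<Rightarrow> params operator"
    where "f i y = (\<lambda>p. y p - q powi (- int i) * T1 q y p)" for i y
  have f: "f i y p = y p - q powi (- int i) * y (tw 1 p)" for i y p
    by (simp add: f_def T1_tw)
  have "f i \<circ> f j = f j \<circ> f i" for i j
    by (intro ext) (simp add: f algebra_simps)
  then have "op_prod f ([0..<n] @ [n]) = f n \<circ> op_prod f [0..<n]"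
    by (rule op_prod_snoc)
  moreover have "prodB q n = op_prod f [0..<n]" for n
    unfolding prodB_def f_def ..
  ultimately show ?thesis by (simp add: f)
qed

definition xfac :: "params \<Rightarrow> nat \<Rightarrow> complex" where
  "xfac p n = (\<Prod>i<n. 1 - fst p 1 / snd p 1 * q ^ i)"

text \<open>Up to the common factor \<open>F (int M) (-1)\<close>, \<open>polyA\<close> is the
  primitive at \<open>t\<close> and \<open>polyB\<close> is the primitive at
  \<open>q * t\<close>.\<close>

definition polyA :: "params \<Rightarrow> complex \<Rightarrow> complex" where
  "polyA p t = (1 - fst p 1 * q powi (int M - 1) * t) * (\<Prod>k=2..M+3. 1 - fst p k * q powi (-1) * t)"

definition polyB :: "params \<Rightarrow> complex \<Rightarrow> complex" where
  "polyB p t = (1 - snd p 1 * q powi (-1) * t) * (\<Prod>k=2..M+3. 1 - snd p k * t)"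

text \<open>
  \<open>F u v\<close> stands for a weight in which \<open>a\<^sub>1\<close> and \<open>b\<^sub>1\<close> have been shifted independently,
  \<open>u\<close> and \<open>v\<close> times; this keeps all formulas free of divisions.
\<close>

context
  fixes y :: "params \<Rightarrow> complex" and p :: params and t :: complex and F :: "int \<Rightarrow> int \<Rightarrow> complex"
  assumes F1: "\<And>u v. u \<in> {-1..<int M} \<Longrightarrow> v \<in> J' \<Longrightarrow>
      F u v = (1 - fst p 1 * q powi u * t) * F (u + 1) v"
    and F2: "\<And>u v. u \<in> J' \<Longrightarrow> v \<in> {-1..<int M} \<Longrightarrow>
      F u (v + 1) = (1 - snd p 1 * q powi v * t) * F u v"
    and yF: "\<And>s. s \<in> J' \<Longrightarrow> y (tw s p) = F s s"
    and b1: "snd p 1 \<noteq> 0"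
begin

text \<open>A new factor produces \<open>(1 - a_1 q^(r+m) t) - (1 - b_1 q^r t) = b_1 q^r t (1 -
  (a_1/b_1) q^m)\<close>: one power of \<open>t\<close> and the next factor of \<open>xfac\<close>
  split off, and what remains has only \<open>a_1\<close> shifted further.\<close>

lemma prodB_F:
  assumes "r \<ge> -1" "r + int m \<le> int M"
  shows "prodB q m y (tw r p) = (snd p 1 * q powi r * t) ^ m * xfac p m * F (r + int m) r"
  using assms
proof (induction m arbitrary: r)
  case 0
  then show ?case using yF[of r] by (simp add: prodB_0 xfac_def)
next
  case (Suc m)
  let ?b = "snd p 1" and ?a = "fst p 1"
  have 1: "prodB q m y (tw r p) = (?b * q powi r * t) ^ m * xfac p m * F (r + int m) r"
    using Suc.prems by (intro Suc.IH) auto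
  have "prodB q m y (tw 1 (tw r p)) = prodB q m y (tw (r + 1) p)"
    by (simp only: tw_tw add.commute)
  also have "\<dots> = (?b * q powi (r + 1) * t) ^ m * xfac p m * F (r + 1 + int m) (r + 1)"
    using Suc.prems by (intro Suc.IH) auto
  also have "(?b * q powi (r + 1) * t) ^ m = (?b * q powi r * t) ^ m * q ^ m"
    using q0 by (simp add: power_int_add power_mult_distrib mult_ac)
  finally have 2: "q powi (- int m) * prodB q m y (tw 1 (tw r p)) =
     (?b * q powi r * t) ^ m * xfac p m * F (r + 1 + int m) (r + 1)"
    using q0 by (simp add: power_int_minus)
  have 3: "F (r + int m) r = (1 - ?a * q powi (r + int m) * t) * F (r + 1 + int m) r"
    using F1[of "r + int m" r] Suc.prems by (simp add: algebra_simps)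
  have 4: "F (r + 1 + int m) (r + 1) = (1 - ?b * q powi r * t) * F (r + 1 + int m) r"
    using F2[of "r + 1 + int m" r] Suc.prems by (simp add: algebra_simps)
  have 5: "?b * q powi r * t * (1 - ?a / ?b * q ^ m) =
     (1 - ?a * q powi (r + int m) * t) - (1 - ?b * q powi r * t)"
    using b1 q0 by (simp add: power_int_add field_simps)
  have "prodB q (Suc m) y (tw r p) = (?b * q powi r * t) ^ m * xfac p m * F (r + 1 + int m) r *
      ((1 - ?a * q powi (r + int m) * t) - (1 - ?b * q powi r * t))"
    unfolding prodB_Suc 2 1 3 4 by (simp only: ring_distribs mult_ac)
  also have "\<dots> = (?b * q powi r * t) ^ Suc m * xfac p (Suc m) * F (r + int (Suc m)) r"
    unfolding 5[symmetric] by (simp add: xfac_def mult_ac add_ac)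
  finally show ?case .
qed

text \<open>With \<open>N = n + m\<close>, the coefficient \<open>a_1 q^n / b_1\<close> and the
  \<open>q ^ m\<close> coming from the shifted power of \<open>t\<close> combine to \<open>(1 - a_1
  q^(r+N) t) - (a_1 q^N / b_1) (1 - b_1 q^r t) = 1 - (a_1/b_1) q^N\<close>. Here \<open>t\<close>
  cancels, so factors of this kind extend \<open>xfac\<close> without a power of \<open>t\<close>,
  and the mixed products differ only in that power.\<close>

lemma prodAB_F:
  assumes "r \<ge> -1" "r + int (n + m) \<le> int M"
  shows "prodA q n (prodB q m y) (tw r p) =
           (snd p 1 * q powi r * t) ^ m * xfac p (n + m) * F (r + int (n + m)) r"
  using assms
proof (induction n arbitrary: r)
  case 0
  then show ?case using prodB_F[of r m] by (simp add: prodA_0)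
next
  case (Suc n)
  let ?b = "snd p 1" and ?a = "fst p 1"
  let ?N = "n + m"
  have 1: "prodA q n (prodB q m y) (tw r p) = (?b * q powi r * t) ^ m * xfac p ?N * F (r + int ?N) r"
    using Suc.prems by (intro Suc.IH) auto
  have "prodA q n (prodB q m y) (tw 1 (tw r p)) = prodA q n (prodB q m y) (tw (r + 1) p)"
    by (simp only: tw_tw add.commute)
  also have "\<dots> = (?b * q powi (r + 1) * t) ^ m * xfac p ?N * F (r + 1 + int ?N) (r + 1)"
    using Suc.prems by (intro Suc.IH) auto
  also have "(?b * q powi (r + 1) * t) ^ m = (?b * q powi r * t) ^ m * q ^ m"
    using q0 by (simp add: power_int_add power_mult_distrib mult_ac)
  finally have 2: "prodA q n (prodB q m y) (tw 1 (tw r p)) =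
     (?b * q powi r * t) ^ m * q ^ m * xfac p ?N * F (r + 1 + int ?N) (r + 1)" .
  have 3: "F (r + int ?N) r = (1 - ?a * q powi (r + int ?N) * t) * F (r + 1 + int ?N) r"
    using F1[of "r + int ?N" r] Suc.prems by (simp add: algebra_simps)
  have 4: "F (r + 1 + int ?N) (r + 1) = (1 - ?b * q powi r * t) * F (r + 1 + int ?N) r"
    using F2[of "r + 1 + int ?N" r] Suc.prems by (simp add: algebra_simps)
  have 5: "1 - ?a / ?b * q ^ ?N =
     (1 - ?a * q powi (r + int ?N) * t) - ?a * q ^ n / ?b * q ^ m * (1 - ?b * q powi r * t)"
    using b1 q0 by (simp add: power_int_add power_add field_simps)
  have 6: "fst (tw r p) 1 * q ^ n / snd (tw r p) 1 = ?a * q ^ n / ?b"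
    using q0 by (simp add: fst_tw snd_tw)
  have "prodA q (Suc n) (prodB q m y) (tw r p) = (?b * q powi r * t) ^ m * xfac p ?N * F (r + 1 + int ?N) r *
      ((1 - ?a * q powi (r + int ?N) * t) - ?a * q ^ n / ?b * q ^ m * (1 - ?b * q powi r * t))"
    unfolding prodA_Suc 2 1 3 4 6 by (simp only: ring_distribs mult_ac)
  also have "\<dots> = (?b * q powi r * t) ^ m * xfac p (Suc n + m) * F (r + int (Suc n + m)) r"
    unfolding 5[symmetric] by (simp add: xfac_def mult_ac add_ac)
  finally show ?case .
qed

text \<open>By \<open>prodAB_F\<close> every summand of \<open>E_hat\<close> becomes a multiple of
  \<open>F (int M) (-1)\<close>, and the sums over elementary symmetric polynomials are the inner
  parts of the expanded products in \<open>polyA\<close> and \<open>polyB\<close>. The outer parts,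
  of degree 0 and M + 2, come from the first and the last summand of \<open>E_hat\<close>; for the
  last one this is where the relation between the variables enters.\<close>

lemma E_hat_F:
  assumes rel: "prod (fst p) I = q^2 * prod (snd p) I"
  shows "t * E_hat q M y p = q * snd p 1 ^ (M+1) * xfac p M * F (int M) (-1) * (polyA p t - polyB p t)"
proof -
  let ?b = "snd p 1" and ?a = "fst p 1" and ?z = "q powi (-1) * t"
  define SA where "SA k = esym k {2..M+3} (fst p)" for k
  define SB where "SB k = esym k {2..M+3} (snd p)" for k
  define PA where "PA = prod (fst p) {2..M+3}"
  define PB where "PB = prod (snd p) {2..M+3}"
  define G where "G = F (int M) (-1)"
  \<comment> \<open>The factor number M + 1 of \<open>xfac\<close>. Only the first and the last
    summand of \<open>E_hat\<close> contain it: their products have M + 1 factors, all others have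
    M.\<close>
  define w where "w = 1 - ?a / ?b * q ^ M"
  have tinv: "T1_inv q z p = z (tw (-1) p)" for z by (rule T1_inv_tw)
  have X: "xfac p (M + 1) = xfac p M * w" by (simp add: xfac_def w_def)
  have e1: "(T1_inv q \<circ> prodA q (M+1)) y p = xfac p M * w * G"
    using prodAB_F[of "-1" "M+1" 0] by (simp add: tinv prodB_0[abs_def] X G_def flip: X)
  have e2: "(T1_inv q \<circ> prodB q (M+1)) y p = (?b * q powi (-1) * t) ^ (M+1) * (xfac p M * w) * G"
    using prodB_F[of "-1" "M+1"] X by (simp add: tinv G_def)
  have GA: "F (int M - 1) (-1) = (1 - ?a * q powi (int M - 1) * t) * G"
    using F1[of "int M - 1" "-1"] M_pos by (simp add: G_def)
  have GB: "F (int M) 0 = (1 - ?b * q powi (-1) * t) * G"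
    using F2[of "int M" "-1"] M_pos by (simp add: G_def)
  have e3: "(T1_inv q \<circ> prodA q (M+1-k) \<circ> prodB q (k-1)) y p =
     (?b * q powi (-1) * t) ^ (k-1) * xfac p M * ((1 - ?a * q powi (int M - 1) * t) * G)"
    if "k \<in> {1..M+1}" for k
    using prodAB_F[of "-1" "M+1-k" "k-1"] that GA by (simp add: tinv G_def)
  have e4: "(prodA q (M+1-k) \<circ> prodB q (k-1)) y p =
     (?b * t) ^ (k-1) * xfac p M * ((1 - ?b * q powi (-1) * t) * G)"
    if "k \<in> {1..M+1}" for k
    using prodAB_F[of 0 "M+1-k" "k-1"] that GB by (simp add: G_def)
  let ?cA = "1 - ?a * q powi (int M - 1) * t" and ?cB = "1 - ?b * q powi (-1) * t"
  have prodexp: "(\<Prod>k=2..M+3. 1 - f k * z) = 1 + (\<Sum>k=1..M+1. (- z) ^ k * esym k {2..M+3} f)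
       + (- z) ^ (M+2) * prod f {2..M+3}" for z and f :: "nat \<Rightarrow> complex"
  proof -
    have "(\<Prod>k=2..M+3. 1 - f k * z) = (\<Prod>k\<in>{2..M+3}. 1 + (- z) * f k)"
      by (simp add: mult.commute)
    also have "\<dots> = (\<Sum>k\<le>M+2. (- z) ^ k * esym k {2..M+3} f)"
      by (subst prod_one_plus_esym) auto
    also have "{..M+2} = insert 0 (insert (M+2) {1..M+1})" by auto
    also have "(\<Sum>k\<in>\<dots>. (- z) ^ k * esym k {2..M+3} f) =
        (- z) ^ 0 * esym 0 {2..M+3} f + ((- z) ^ (M+2) * esym (M+2) {2..M+3} f +
        (\<Sum>k=1..M+1. (- z) ^ k * esym k {2..M+3} f))"
      by (subst sum.insert; simp del: power_Suc sum.cl_ivl_Suc)+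
    finally show ?thesis
      using esym_0[of "{2..M+3}" f] esym_card[of "{2..M+3}" f] by (simp only: card_atLeastAtMost) simp
  qed
  define UA where "UA = (\<Sum>k=1..M+1. (- ?z) ^ k * SA k)"
  define UB where "UB = (\<Sum>k=1..M+1. (- t) ^ k * SB k)"
  have A: "polyA p t = ?cA * (1 + UA + (- ?z) ^ (M+2) * PA)"
    using prodexp[of "fst p" "q powi (-1) * t"]
    by (simp only: polyA_def UA_def SA_def PA_def mult.assoc)
  have B: "polyB p t = ?cB * (1 + UB + (- t) ^ (M+2) * PB)"
    using prodexp[of "snd p" "t"] by (simp only: polyB_def UB_def SB_def PB_def)
  define R where "R k = (-1) ^ k * ?b ^ (M+2-k) *
     (SA k * ((?b * q powi (-1) * t) ^ (k-1) * xfac p M * (?cA * G))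
      - q * SB k * ((?b * t) ^ (k-1) * xfac p M * (?cB * G)))" for k
  have hterm: "t * R k = q * ?b ^ (M+1) * xfac p M * G *
        (?cA * ((- ?z) ^ k * SA k) - ?cB * ((- t) ^ k * SB k))" if k: "k \<in> {1..M+1}" for k
  proof -
    obtain j where j: "k = Suc j" using k by (cases k) auto
    have bj: "?b ^ (M+2-k) * ?b ^ j = ?b ^ (M+1)" using k j by (simp flip: power_add)
    have q1: "q * q powi (-1) = 1" using q0 by (simp add: power_int_minus)
    have "t * R k = (?b ^ (M+2-k) * ?b ^ j) * (-1) ^ k * xfac p M * G *
          (t * ?z ^ j * SA k * ?cA - q * t * t ^ j * SB k * ?cB)"
      by (simp add: R_def j power_mult_distrib right_diff_distrib mult_ac)
    also have "t * ?z ^ j = q * ?z ^ k"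
    proof -
      have "q * ?z ^ k = (q * q powi (-1)) * (t * ?z ^ j)"
        by (simp add: j mult_ac)
      then show ?thesis by (simp only: q1 mult_1)
    qed
    also have "q * t * t ^ j = q * t ^ k" by (simp add: j)
    also have "(?b ^ (M+2-k) * ?b ^ j) * (-1) ^ k * xfac p M * G *
          (q * ?z ^ k * SA k * ?cA - q * t ^ k * SB k * ?cB) =
        q * ?b ^ (M+1) * xfac p M * G *
        (?cA * (((-1) ^ k * ?z ^ k) * SA k) - ?cB * (((-1) ^ k * t ^ k) * SB k))"
      unfolding bj by (simp only: ring_distribs mult_ac)
    also have "(-1) ^ k * ?z ^ k = (- ?z) ^ k"
      by (metis mult_minus1 power_mult_distrib)
    also have "(-1) ^ k * t ^ k = (- t) ^ k"
      by (metis mult_minus1 power_mult_distrib)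
    finally show ?thesis .
  qed
  have "E_hat q M y p = ?b ^ (M+2) * (xfac p M * w * G) + (\<Sum>k=1..M+1. R k)
     + (-1) ^ M * PA * ((?b * q powi (-1) * t) ^ (M+1) * (xfac p M * w) * G)"
  proof -
    have "E_hat q M y p = ?b ^ (M+2) * (T1_inv q \<circ> prodA q (M+1)) y p
     + (\<Sum>k=1..M+1. (-1) ^ k * ?b ^ (M+2-k) *
          (SA k * (T1_inv q \<circ> prodA q (M+1-k) \<circ> prodB q (k-1)) y p
           - q * SB k * (prodA q (M+1-k) \<circ> prodB q (k-1)) y p))
     + (-1) ^ M * PA * (T1_inv q \<circ> prodB q (M+1)) y p" (is "_ = _ + sum ?R _ + _")
      by (simp only: E_hat_def SA_def SB_def PA_def split_beta prod.collapse)
    also have "sum ?R {1..M+1} = sum R {1..M+1}"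
      by (rule sum.cong[OF refl]) (simp only: e3 e4 R_def)
    finally show ?thesis unfolding e1 e2 .
  qed
  then have "t * E_hat q M y p = t * (?b ^ (M+2) * (xfac p M * w * G)) + (\<Sum>k=1..M+1. t * R k)
     + t * ((-1) ^ M * PA * ((?b * q powi (-1) * t) ^ (M+1) * (xfac p M * w) * G))"
    by (simp only: distrib_left sum_distrib_left)
  also have "(\<Sum>k=1..M+1. t * R k) = (\<Sum>k=1..M+1. q * ?b ^ (M+1) * xfac p M * G *
        (?cA * ((- ?z) ^ k * SA k) - ?cB * ((- t) ^ k * SB k)))"
    by (rule sum.cong[OF refl hterm])
  also have "\<dots> = q * ?b ^ (M+1) * xfac p M * G * (?cA * UA - ?cB * UB)"
    by (simp only: UA_def UB_def sum_distrib_left sum_subtractf right_diff_distrib)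
  finally have main: "t * E_hat q M y p = t * (?b ^ (M+2) * (xfac p M * w * G)) +
      q * ?b ^ (M+1) * xfac p M * G * (?cA * UA - ?cB * UB)
     + t * ((-1) ^ M * PA * ((?b * q powi (-1) * t) ^ (M+1) * (xfac p M * w) * G))" .
  have split: "I = insert 1 {2..M+3}" by auto
  have rel': "?a * PA = q^2 * (?b * PB)"
    using rel unfolding split PA_def PB_def by (subst (asm) (1 2) prod.insert) auto
  have qM: "q powi (int M - 1) = q ^ M / q" using q0 by (simp add: power_int_diff)
  have h1: "q * (?cA - ?cB) = t * ?b * w"
    using q0 b1 by (simp add: qM w_def power_int_minus field_simps)
  have m1: "(-1 :: complex) ^ (M+2) = (-1) ^ M" by simp
  have "- ?z = (-1) * (t / q)" "- t = (-1) * t"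
    by (simp_all add: power_int_minus divide_inverse mult.commute)
  then have sg: "(- ?z) ^ (M+2) = (-1) ^ M * (t ^ (M+2) / q ^ (M+2))"
      "(- t) ^ (M+2) = (-1) ^ M * t ^ (M+2)"
    by (simp_all only: power_mult_distrib power_divide m1)
  have PB': "PB = ?a * PA / (q^2 * ?b)" using rel' b1 q0 by (simp add: field_simps)
  have h2: "q * (?cA * ((- ?z) ^ (M+2) * PA) - ?cB * ((- t) ^ (M+2) * PB))
     = t * ((-1) ^ M * PA * (?z ^ (M+1) * w))"
    unfolding sg PB' using q0 b1
    by (simp add: qM w_def power_int_minus power_mult_distrib field_simps power2_eq_square)
  have bb: "(?b * q powi (-1) * t) ^ (M+1) = ?b ^ (M+1) * ?z ^ (M+1)"
    by (simp only: power_mult_distrib mult.assoc)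
  have "t * E_hat q M y p = ?b ^ (M+1) * xfac p M * G * (t * ?b * w + q * (?cA * UA - ?cB * UB)
     + t * ((-1) ^ M * PA * (?z ^ (M+1) * w)))"
    unfolding main bb by (simp add: algebra_simps)
  also have "\<dots> = ?b ^ (M+1) * xfac p M * G * (q * (polyA p t - polyB p t))"
    unfolding h1[symmetric] h2[symmetric] A B by (simp only: ring_distribs add_ac mult_ac) (simp add: algebra_simps)
  finally show ?thesis by (simp add: G_def mult_ac)
qed

end

end

section \<open>The pointwise relations\<close>

context q_rp
begin

abbreviation K where "K \<equiv> {2..M+3}"

lemma I_split: "I = insert 1 K" by auto

definition three_term :: "(params \<Rightarrow> complex) \<Rightarrow> params \<Rightarrow> bool" where
  "three_term Y p \<longleftrightarrow> (let a = fst p; b = snd p in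
     (\<forall>k\<in>K. \<forall>l\<in>K. k \<noteq> l \<longrightarrow>
        (a 1 - a k * q) * Y (sh (Z(k := 1, l := -1)) Z p)
          - (a l - a k * q) * Y (sh (Z(k := 1, 1 := -1)) Z p) + (a l - a 1) * Y p = 0) \<and>
     (\<forall>k\<in>K. (b 1 - a 1) * Y (sh (Z(1 := 1, k := -1)) Z p)
          - (inverse q * a k - a 1) * Y (tw 1 p) + (inverse q * a k - b 1) * Y p = 0) \<and>
     (\<forall>k\<in>K. \<forall>l\<in>K. k \<noteq> l \<longrightarrow>
        (b 1 - inverse q * b l) * Y (sh Z (Z(k := 1, l := -1)) p)
          - (b k - inverse q * b l) * Y (sh Z (Z(1 := 1, l := -1)) p) + (b k - b 1) * Y p = 0) \<and>
     (\<forall>k\<in>K. (a 1 - b 1) * Y (sh Z (Z(k := 1, 1 := -1)) p)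
          - (b k * q - b 1) * Y (tw (-1) p) + (b k * q - a 1) * Y p = 0) \<and>
     (\<forall>k\<in>K. \<forall>l\<in>K. k \<noteq> l \<longrightarrow>
        (b 1 - a k) * Y (sh (Z(k := 1)) (Z(l := 1)) p)
          - (b l - a k) * Y (sh (Z(k := 1)) (Z(1 := 1)) p) + (b l - b 1) * Y p = 0) \<and>
     (\<forall>k\<in>K. \<forall>l\<in>K. k \<noteq> l \<longrightarrow>
        (b l - a 1) * Y (sh (Z(k := -1)) (Z(l := -1)) p)
          - (b l - a k) * Y (sh (Z(1 := -1)) (Z(l := -1)) p) + (a 1 - a k) * Y p = 0))"

abbreviation sh1 :: "params \<Rightarrow> params" where "sh1 \<equiv> sh (\<lambda>_. 1) (\<lambda>_. 1)"

lemma op_prod_shift: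
  assumes "distinct xs" "set xs \<subseteq> I"
  shows "op_prod (\<lambda>k. Ta q k 1 \<circ> Tb q k 1) xs Y p =
           Y (sh (\<lambda>k. if k \<in> set xs then 1 else 0) (\<lambda>k. if k \<in> set xs then 1 else 0) p)"
  using assms
proof (induction xs arbitrary: p)
  case Nil
  then show ?case by (simp add: op_prod_def)
next
  case (Cons k xs)
  let ?f = "\<lambda>k. Ta q k 1 \<circ> Tb q k 1"
  have k: "k \<in> I" using Cons.prems by auto
  have "op_prod ?f (k # xs) Y p = (Ta q k 1 \<circ> Tb q k 1) (op_prod ?f xs Y) p"
    by (simp add: op_prod_def)
  also have "\<dots> = op_prod ?f xs Y (sh (Z(k := 1)) (Z(k := 1)) p)"
    by (rule Tab_sh[OF k k])
  also have "\<dots> = Y (sh (\<lambda>k. if k \<in> set xs then 1 else 0) (\<lambda>k. if k \<in> set xs then 1 else 0)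
                  (sh (Z(k := 1)) (Z(k := 1)) p))"
    using Cons.prems by (intro Cons.IH) auto
  also have "\<dots> = Y (sh (\<lambda>j. if j \<in> set (k # xs) then 1 else 0) (\<lambda>j. if j \<in> set (k # xs) then 1 else 0) p)"
    unfolding sh_sh using Cons.prems by (intro arg_cong[of _ _ Y] sh_cong) auto
  finally show ?case .
qed

lemma qRP_solution_iff:
  "qRP_solution q M Y \<longleftrightarrow> (\<forall>p\<in>D. E_hat q M Y p = 0 \<and> three_term Y p \<and> q * Y (sh1 p) - Y p = 0)"
proof -
  have k1: "k \<in> I" "k \<noteq> 1" "1 \<noteq> k" if "k \<in> K" for k using that by auto
  have tot: "op_prod (\<lambda>k. Ta q k 1 \<circ> Tb q k 1) [1..<M+4] Y p = Y (sh1 p)" for p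
  proof -
    have "op_prod (\<lambda>k. Ta q k 1 \<circ> Tb q k 1) [1..<M+4] Y p =
      Y (sh (\<lambda>k. if k \<in> set [1..<M+4] then 1 else 0) (\<lambda>k. if k \<in> set [1..<M+4] then 1 else 0) p)"
      by (rule op_prod_shift) auto
    also have "\<dots> = Y (sh1 p)" by (intro arg_cong[of _ _ Y] sh_cong) auto
    finally show ?thesis .
  qed
  show ?thesis unfolding qRP_solution_def
  proof (intro ball_cong refl, goal_cases)
    case (1 p)
    show ?case unfolding three_term_def Let_def
      by (cases p) (simp only: prod.case fst_conv snd_conv tot tw_def Taa_sh Tbb_sh Tab_sh k1 I1
          not_False_eq_True simp_thms conj_assoc cong: ball_cong imp_cong)
  qed
qed

lemma qpoch_inf_powi_split:
  assumes "m \<le> n"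
  shows "qpoch_inf q (q powi m * c) = (\<Prod>j\<in>{m..<n}. 1 - c * q powi j) * qpoch_inf q (q powi n * c)"
  using assms
proof (induction n rule: int_ge_induct)
  case (step n)
  have "{m..<n+1} = insert n {m..<n}" using step by auto
  then have "(\<Prod>j\<in>{m..<n+1}. 1 - c * q powi j) = (1 - c * q powi n) * (\<Prod>j\<in>{m..<n}. 1 - c * q powi j)"
    by simp
  moreover have "qpoch_inf q (q powi n * c) = (1 - c * q powi n) * qpoch_inf q (q powi (n + 1) * c)"
    using qpoch_inf_rec[OF q_less, of "q powi n * c"] q0 by (simp add: power_int_add mult_ac)
  ultimately show ?case using step.IH by simp
qed simp

text \<open>Lowering a-exponents and raising b-exponents only adds linear factors to the weight, so
  in this direction the quotient is a polynomial in \<open>t\<close>. Weights are always compared by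
  passing to a common shift from which all of them arise in this way.\<close>

lemma W_ratio:
  assumes "\<And>k. k \<in> I \<Longrightarrow> x' k \<le> x k" "\<And>k. k \<in> I \<Longrightarrow> y k \<le> y' k" "t \<in> good p"
  shows "W (sh x' y' p) t = (\<Prod>k\<in>I. (\<Prod>j\<in>{x' k..<x k}. 1 - fst p k * q powi j * t) *
           (\<Prod>j\<in>{y k..<y' k}. 1 - snd p k * q powi j * t)) * W (sh x y p) t"
  unfolding W_def prod.distrib[symmetric]
proof (rule prod.cong[OF refl])
  fix k assume k: "k \<in> I"
  let ?a = "fst p k" and ?b = "snd p k"
  have A: "qpoch_inf q (q powi x' k * (?a * t)) =
      (\<Prod>j\<in>{x' k..<x k}. 1 - ?a * t * q powi j) * qpoch_inf q (q powi x k * (?a * t))"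
    using assms(1)[OF k] by (rule qpoch_inf_powi_split)
  have B: "qpoch_inf q (q powi y k * (?b * t)) =
      (\<Prod>j\<in>{y k..<y' k}. 1 - ?b * t * q powi j) * qpoch_inf q (q powi y' k * (?b * t))"
    using assms(2)[OF k] by (rule qpoch_inf_powi_split)
  have nz: "qpoch_inf q (q powi m * (?b * t)) \<noteq> 0" for m
    using good_nz[OF good_q[OF assms(3)] k, of m] by (simp add: mult_ac)
  have nz': "(\<Prod>j\<in>{y k..<y' k}. 1 - ?b * t * q powi j) \<noteq> 0"
    using good_ne[OF assms(3) k] by (simp add: mult_ac)
  have eqA: "(\<lambda>j. 1 - ?a * q powi j * t) = (\<lambda>j. 1 - ?a * t * q powi j)"
    and eqB: "(\<lambda>j. 1 - ?b * q powi j * t) = (\<lambda>j. 1 - ?b * t * q powi j)" by (auto simp: mult_ac)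
  show "qpoch_inf q (fst (sh x' y' p) k * t) / qpoch_inf q (snd (sh x' y' p) k * t) =
     (\<Prod>j\<in>{x' k..<x k}. 1 - ?a * q powi j * t) * (\<Prod>j\<in>{y k..<y' k}. 1 - ?b * q powi j * t) *
     (qpoch_inf q (fst (sh x y p) k * t) / qpoch_inf q (snd (sh x y p) k * t))"
    unfolding eqA eqB fst_sh[OF k] snd_sh[OF k] mult.assoc A B
    using nz nz' by (simp add: field_simps)
qed

lemma W_b:
  assumes k: "k \<in> I" and t: "t \<in> good p"
  shows "W (sh x (y(k := y k + 1)) p) t = (1 - snd p k * q powi y k * t) * W (sh x y p) t"
proof -
  have "{y k..<y k + 1} = {y k}" by auto
  then have "(\<Prod>l\<in>I. (\<Prod>j\<in>{x l..<x l}. 1 - fst p l * q powi j * t) *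
      (\<Prod>j\<in>{y l..<(y(k := y k + 1)) l}. 1 - snd p l * q powi j * t)) =
    (\<Prod>l\<in>I. if l = k then 1 - snd p l * q powi y l * t else 1)"
    by (intro prod.cong) auto
  also have "\<dots> = 1 - snd p k * q powi y k * t" using k by (subst prod.delta) auto
  finally show ?thesis using W_ratio[of x x y "y(k := y k + 1)" t p] t by simp
qed

lemma W_a_eq:
  assumes "k \<in> I" "\<And>j. j \<in> I \<Longrightarrow> x' j = (if j = k then x k + 1 else x j)"
  shows "W (sh x y p) t = (1 - fst p k * q powi x k * t) * W (sh x' y p) t"
proof -
  have "sh (x(k := x k + 1)) y p = sh x' y p" using assms(2) by (intro sh_cong) auto
  then show ?thesis using W_a[OF assms(1), of x y p t] by simp
qed

lemma W_b_eq:
  assumes "k \<in> I" "t \<in> good p" "\<And>j. j \<in> I \<Longrightarrow> y' j = (if j = k then y k + 1 else y j)"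
  shows "W (sh x y' p) t = (1 - snd p k * q powi y k * t) * W (sh x y p) t"
proof -
  have "sh x (y(k := y k + 1)) p = sh x y' p" using assms(3) by (intro sh_cong) auto
  then show ?thesis using W_b[OF assms(1,2), of x y] by simp
qed

text \<open>One step below the a-exponents of the common factor \<open>F (int M) (-1)\<close>, so
  that the linear factors gained are exactly those of \<open>polyA\<close>. These exponents sum to
  -3 and the b-exponents in \<open>bdry\<close> to -1: this shift does not preserve the relation and
  only serves as a function of \<open>t\<close>.\<close>

definition bexp :: "nat \<Rightarrow> int" where "bexp k = (if k = 1 then int M - 1 else -1)"

definition bdry :: "params \<Rightarrow> complex \<Rightarrow> complex" where
  "bdry p t = W (sh bexp (Z(1 := -1)) p) t"

lemma E_hat_W:
  assumes p: "p \<in> D" and t: "t \<in> good p"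
  shows "t * E_hat q M (\<lambda>p'. W p' t) p = q * snd p 1 ^ (M+1) * xfac p M * (bdry p t - bdry p (q * t))"
proof -
  define F where "F u v = W (sh (Z(1 := u)) (Z(1 := v)) p) t" for u v
  have main: "t * E_hat q M (\<lambda>p'. W p' t) p =
      q * snd p 1 ^ (M+1) * xfac p M * F (int M) (-1) * (polyA p t - polyB p t)"
  proof (rule E_hat_F)
    fix u v :: int
    show "F u v = (1 - fst p 1 * q powi u * t) * F (u + 1) v"
      unfolding F_def using W_a_eq[of 1 "Z(1 := u + 1)" "Z(1 := u)" "Z(1 := v)" p t] by simp
    show "F u (v + 1) = (1 - snd p 1 * q powi v * t) * F u v"
      unfolding F_def using W_b_eq[OF _ t, of 1 "Z(1 := v + 1)" "Z(1 := v)" "Z(1 := u)"] by simp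
  next
    show "W (tw s p) t = F s s" for s by (simp add: F_def tw_def)
    show "snd p 1 \<noteq> 0" using D_nz(2)[OF p] by simp
    show "prod (fst p) I = q^2 * prod (snd p) I" by (rule D_prod[OF p])
  qed
  have A: "bdry p t = F (int M) (-1) * polyA p t"
  proof -
    have e: "{bexp k..<(Z(Suc 0 := int M)) k} = {bexp k}" for k by (auto simp: bexp_def)
    have "bdry p t = (\<Prod>k\<in>I. 1 - fst p k * q powi bexp k * t) * F (int M) (-1)"
      unfolding bdry_def F_def
      by (subst W_ratio[OF _ _ t, of _ "Z(1 := int M)" "Z(1 := -1)"]) (auto simp: e simp del: fun_upd_apply, auto simp: bexp_def)
    also have "(\<Prod>k\<in>I. 1 - fst p k * q powi bexp k * t) = polyA p t"
      unfolding I_split polyA_def by (subst prod.insert) (auto simp: bexp_def intro!: prod.cong)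
    finally show ?thesis by (simp add: mult.commute)
  qed
  have B: "bdry p (q * t) = F (int M) (-1) * polyB p t"
  proof -
    have e: "{(Z(Suc 0 := -1)) k..<(if k = Suc 0 then 0 else 1)} = {(Z(Suc 0 := -1)) k}" for k :: nat by auto
    \<comment> \<open>The total shift brings the a-exponents from \<open>bexp\<close> back to those
      of \<open>F (int M) (-1)\<close>; hence only b-factors are left, and they make up
      \<open>polyB\<close>.\<close>
    have "bdry p (q * t) = W (sh (Z(1 := int M)) (\<lambda>k. if k = 1 then 0 else 1) p) t"
      unfolding bdry_def W_q sh_sh
      by (intro arg_cong[of _ _ "\<lambda>p. W p t"] sh_cong) (auto simp: bexp_def)
    also have "\<dots> = (\<Prod>k\<in>I. 1 - snd p k * q powi (Z(1 := -1)) k * t) * F (int M) (-1)"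
      unfolding F_def
      by (subst W_ratio[OF _ _ t, of _ "Z(1 := int M)" "Z(1 := -1)"]) (auto simp: e simp del: fun_upd_apply, auto)
    also have "(\<Prod>k\<in>I. 1 - snd p k * q powi (Z(1 := -1)) k * t) = polyB p t"
      unfolding I_split polyB_def by (subst prod.insert) (auto intro!: prod.cong)
    finally show ?thesis by (simp add: mult.commute)
  qed
  show ?thesis unfolding main A B by (simp add: algebra_simps)
qed

text \<open>The factor \<open>t\<close> belongs to the measure of the Jackson integral. Cutting down
  to a set \<open>S\<close> of good points discards the places where \<open>W\<close> divides by
  zero.\<close>

definition tW :: "complex set \<Rightarrow> params \<Rightarrow> complex \<Rightarrow> complex" where
  "tW S p t = (if t \<in> S then t * W p t else 0)"

lemma powi_m1: "q powi (-1) = inverse q" by (simp add: power_int_minus)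

context
  fixes p :: params and S :: "complex set" and V L and Y :: "params \<Rightarrow> complex"
  assumes p: "p \<in> D" and S: "S \<subseteq> good p" and L: "lin_on V L"
    and V: "\<And>x y. wt x = wt y \<Longrightarrow> tW S (sh x y p) \<in> V"
    and Y: "\<And>x y. wt x = wt y \<Longrightarrow> Y (sh x y p) = L (tW S (sh x y p))"
begin

lemma pointwise_functional:
  assumes "wt x = wt y" "wt x' = wt y'"
    and eq: "\<And>t. t \<in> good p \<Longrightarrow> c * W (sh x y p) t - c' * W (sh x' y' p) t + d * W p t = 0"
  shows "c * Y (sh x y p) - c' * Y (sh x' y' p) + d * Y p = 0"
proof -
  have "c * tW S (sh x y p) t + (- c') * tW S (sh x' y' p) t + d * tW S p t = 0" for t
  proof (cases "t \<in> S")
    case True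
    then have "c * tW S (sh x y p) t + (- c') * tW S (sh x' y' p) t + d * tW S p t =
        t * (c * W (sh x y p) t - c' * W (sh x' y' p) t + d * W p t)"
      by (simp add: tW_def algebra_simps)
    then show ?thesis using eq[of t] True S by auto
  qed (simp add: tW_def)
  from lin_on_three[OF L V V V[of Z Z, unfolded sh_0] this] assms(1,2)
  show ?thesis using Y[of x y] Y[of x' y'] Y[of Z Z] by simp
qed

text \<open>In each equation the three weights are one common shifted weight, called
  \<open>F\<close> below, times polynomials of degree at most one in \<open>t\<close>. Three such
  polynomials are linearly dependent, and the equation records the dependence.\<close>

lemma three_term_functional: "three_term Y p"
proof -
  have st: "wt (Z(k := m)) = wt (Z(l := m))" if "k \<in> I" "l \<in> I" for k l and m :: int
    using that by (simp only: wt_single)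
  have dz: "wt (Z(k := 1, l := -1)) = wt Z" if "k \<in> I" "l \<in> I" "k \<noteq> l" for k l
    using wt_double[OF that, of 1 "-1"] by simp
  show ?thesis unfolding three_term_def Let_def tw_def
  proof (intro conjI ballI impI pointwise_functional)
    fix k l t assume kl: "k \<in> K" "l \<in> K" "k \<noteq> l" and t: "t \<in> good p"
    have I: "k \<in> I" "l \<in> I" "1 \<noteq> k" "1 \<noteq> l" "l \<noteq> k" "k \<noteq> l" using kl by auto
    define F where "F = W (sh (Z(k := 1)) Z p) t"
    have a: "W p t = (1 - fst p k * t) * F"
      using W_a_eq[of k "Z(k := 1)" Z Z p t] kl by (simp add: F_def)
    have b: "W (sh (Z(k := 1, j := -1)) Z p) t = (1 - fst p j * inverse q * t) * F"
      if "j \<in> I" "j \<noteq> k" for j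
      unfolding F_def by (subst W_a_eq[of j "Z(k := 1)"]) (use that kl in \<open>auto simp: powi_m1\<close>)
    show "(fst p 1 - fst p k * q) * W (sh (Z(k := 1, l := - 1)) Z p) t -
         (fst p l - fst p k * q) * W (sh (Z(k := 1, 1 := - 1)) Z p) t + (fst p l - fst p 1) * W p t = 0"
      unfolding a b[OF I(2,5)] b[OF I1 I(3)] using q0 by (simp add: field_simps)
  next
    fix k t assume kl: "k \<in> K" and t: "t \<in> good p"
    define F where "F = W (sh (Z(1 := 1)) Z p) t"
    have a: "W p t = (1 - fst p 1 * t) * F"
      using W_a_eq[of 1 "Z(1 := 1)" Z Z p t] by (simp add: F_def)
    have b: "W (sh (Z(1 := 1, k := -1)) Z p) t = (1 - fst p k * inverse q * t) * F"
      unfolding F_def by (subst W_a_eq[of k "Z(1 := 1)"]) (use kl in \<open>auto simp: powi_m1\<close>)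
    have c: "W (sh (Z(1 := 1)) (Z(1 := 1)) p) t = (1 - snd p 1 * t) * F"
      unfolding F_def by (subst W_b_eq[OF _ t, of 1 _ Z]) auto
    show "(snd p 1 - fst p 1) * W (sh (Z(1 := 1, k := - 1)) Z p) t -
         (inverse q * fst p k - fst p 1) * W (sh (Z(1 := 1)) (Z(1 := 1)) p) t +
         (inverse q * fst p k - snd p 1) * W p t = 0"
      unfolding a b c using q0 by (simp add: field_simps)
  next
    fix k l t assume kl: "k \<in> K" "l \<in> K" "k \<noteq> l" and t: "t \<in> good p"
    have I: "k \<in> I" "l \<in> I" "1 \<noteq> k" "1 \<noteq> l" "l \<noteq> k" "k \<noteq> l" using kl by auto
    define F where "F = W (sh Z (Z(l := -1)) p) t"
    have a: "W p t = (1 - snd p l * inverse q * t) * F"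
      using W_b_eq[OF _ t, of l Z "Z(l := -1)" Z] kl by (simp add: F_def powi_m1)
    have b: "W (sh Z (Z(j := 1, l := -1)) p) t = (1 - snd p j * t) * F" if "j \<in> I" "j \<noteq> l" for j
      unfolding F_def by (subst W_b_eq[OF _ t, of j _ "Z(l := -1)"]) (use that kl in auto)
    show "(snd p 1 - inverse q * snd p l) * W (sh Z (Z(k := 1, l := - 1)) p) t -
         (snd p k - inverse q * snd p l) * W (sh Z (Z(1 := 1, l := - 1)) p) t + (snd p k - snd p 1) * W p t = 0"
      unfolding a b[OF I(1,6)] b[OF I1 I(4)] using q0 by (simp add: field_simps)
  next
    fix k t assume kl: "k \<in> K" and t: "t \<in> good p"
    define F where "F = W (sh Z (Z(1 := -1)) p) t"
    have a: "W p t = (1 - snd p 1 * inverse q * t) * F"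
      using W_b_eq[OF I1 t, of Z "Z(1 := -1)" Z] by (simp add: F_def powi_m1)
    have b: "W (sh Z (Z(k := 1, 1 := -1)) p) t = (1 - snd p k * t) * F"
      unfolding F_def by (subst W_b_eq[OF _ t, of k _ "Z(1 := -1)"]) (use kl in auto)
    have c: "W (sh (Z(1 := -1)) (Z(1 := -1)) p) t = (1 - fst p 1 * inverse q * t) * F"
      unfolding F_def by (subst W_a_eq[of 1 Z]) (auto simp: powi_m1)
    show "(fst p 1 - snd p 1) * W (sh Z (Z(k := 1, 1 := - 1)) p) t -
         (snd p k * q - snd p 1) * W (sh (Z(1 := -1)) (Z(1 := -1)) p) t + (snd p k * q - fst p 1) * W p t = 0"
      unfolding a b c using q0 by (simp add: field_simps)
  next
    fix k l t assume kl: "k \<in> K" "l \<in> K" "k \<noteq> l" and t: "t \<in> good p"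
    have I: "k \<in> I" "l \<in> I" "1 \<noteq> k" "1 \<noteq> l" "l \<noteq> k" "k \<noteq> l" using kl by auto
    define F where "F = W (sh (Z(k := 1)) Z p) t"
    have a: "W p t = (1 - fst p k * t) * F"
      using W_a_eq[of k "Z(k := 1)" Z Z p t] kl by (simp add: F_def)
    have b: "W (sh (Z(k := 1)) (Z(j := 1)) p) t = (1 - snd p j * t) * F" if "j \<in> I" for j
      unfolding F_def by (subst W_b_eq[OF _ t, of j _ Z]) (use that in auto)
    show "(snd p 1 - fst p k) * W (sh (Z(k := 1)) (Z(l := 1)) p) t -
         (snd p l - fst p k) * W (sh (Z(k := 1)) (Z(1 := 1)) p) t + (snd p l - snd p 1) * W p t = 0"
      unfolding a b[OF I(2)] b[OF I1] using q0 by (simp add: field_simps)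
  next
    fix k l t assume kl: "k \<in> K" "l \<in> K" "k \<noteq> l" and t: "t \<in> good p"
    have I: "k \<in> I" "l \<in> I" "1 \<noteq> k" "1 \<noteq> l" "l \<noteq> k" "k \<noteq> l" using kl by auto
    define F where "F = W (sh Z (Z(l := -1)) p) t"
    have a: "W p t = (1 - snd p l * inverse q * t) * F"
      using W_b_eq[OF _ t, of l Z "Z(l := -1)" Z] kl by (simp add: F_def powi_m1)
    have b: "W (sh (Z(j := -1)) (Z(l := -1)) p) t = (1 - fst p j * inverse q * t) * F" if "j \<in> I" for j
      unfolding F_def by (subst W_a_eq[of j Z]) (use that in \<open>auto simp: powi_m1\<close>)
    show "(snd p l - fst p 1) * W (sh (Z(k := - 1)) (Z(l := - 1)) p) t -
         (snd p l - fst p k) * W (sh (Z(1 := - 1)) (Z(l := - 1)) p) t + (fst p 1 - fst p k) * W p t = 0"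
      unfolding a b[OF I(1)] b[OF I1] using q0 by (simp add: field_simps)
  qed ((rule dz | rule dz[symmetric] | rule st); force)+
qed

end

end

section \<open>Expansion of E_hat in powers of T\<close>

context q_rp
begin

abbreviation X where "X \<equiv> rp_coords M"

text \<open>Denominators may vanish nowhere on \<open>D\<close>, which is stronger than being a
  rational function. It makes these functions stable under shifts and lets every equation of the
  reduction hold at all points, not just generically.\<close>

definition reg :: "(params \<Rightarrow> complex) set" where
  "reg = {f. \<exists>g\<in>polys. \<exists>h\<in>polys. \<forall>p\<in>D. h p \<noteq> 0 \<and> f p = g p / h p}"

lemma regI: "g \<in> polys \<Longrightarrow> h \<in> polys \<Longrightarrow> (\<And>p. p \<in> D \<Longrightarrow> h p \<noteq> 0) \<Longrightarrow>
    (\<And>p. p \<in> D \<Longrightarrow> f p = g p / h p) \<Longrightarrow> f \<in> reg"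
  unfolding reg_def by blast

lemma regE:
  assumes "f \<in> reg"
  obtains g h where "g \<in> polys" "h \<in> polys" "\<And>p. p \<in> D \<Longrightarrow> h p \<noteq> 0"
    "\<And>p. p \<in> D \<Longrightarrow> f p = g p / h p"
  using assms unfolding reg_def by blast

lemma poly_fst: "k \<in> I \<Longrightarrow> (\<lambda>p. fst p k) \<in> polys"
  and poly_snd: "k \<in> I \<Longrightarrow> (\<lambda>p. snd p k) \<in> polys"
proof -
  assume k: "k \<in> I"
  have "(\<lambda>p. fst p k) = (\<lambda>(a, b). a k)" "(\<lambda>p. snd p k) = (\<lambda>(a, b). b k)" by auto
  then have "(\<lambda>p. fst p k) \<in> X" "(\<lambda>p. snd p k) \<in> X" using k unfolding rp_coords_def by blast+
  then show "(\<lambda>p. fst p k) \<in> polys" "(\<lambda>p. snd p k) \<in> polys"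
    by (auto intro: polyfuns.coord)
qed

lemma poly_sh:
  assumes "f \<in> polys"
  shows "(\<lambda>p. f (sh x y p)) \<in> polys"
  using assms
proof (induction rule: polyfuns.induct)
  case (coord f)
  then obtain k where k: "k \<in> I" "f = (\<lambda>(a, b). a k) \<or> f = (\<lambda>(a, b). b k)"
    unfolding rp_coords_def by blast
  then have "(\<lambda>p. f (sh x y p)) = (\<lambda>p. q powi x k * fst p k) \<or> (\<lambda>p. f (sh x y p)) = (\<lambda>p. q powi y k * snd p k)"
    by (auto simp: split_beta)
  moreover have "(\<lambda>p. q powi x k * fst p k) \<in> polys" "(\<lambda>p. q powi y k * snd p k) \<in> polys"
    using k(1) by (auto intro!: polyfuns.mult polyfuns.const poly_fst poly_snd)
  ultimately show ?case by auto
qed (auto intro: polyfuns.intros)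

lemma poly_reg: "f \<in> polys \<Longrightarrow> f \<in> reg"
  by (rule regI[of f "\<lambda>_. 1"]) (auto intro: polyfuns.const)

lemma reg_const: "(\<lambda>_. c) \<in> reg" by (intro poly_reg polyfuns.const)
lemma reg_fst: "k \<in> I \<Longrightarrow> (\<lambda>p. fst p k) \<in> reg" by (intro poly_reg poly_fst)
lemma reg_snd: "k \<in> I \<Longrightarrow> (\<lambda>p. snd p k) \<in> reg" by (intro poly_reg poly_snd)

lemma
  assumes "f \<in> reg" "g \<in> reg"
  shows reg_mult: "(\<lambda>p. f p * g p) \<in> reg" and reg_add: "(\<lambda>p. f p + g p) \<in> reg"
proof -
  obtain f1 f2 where f: "f1 \<in> polys" "f2 \<in> polys" "\<And>p. p \<in> D \<Longrightarrow> f2 p \<noteq> 0"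
    "\<And>p. p \<in> D \<Longrightarrow> f p = f1 p / f2 p" using regE[OF assms(1)] by blast
  obtain g1 g2 where g: "g1 \<in> polys" "g2 \<in> polys" "\<And>p. p \<in> D \<Longrightarrow> g2 p \<noteq> 0"
    "\<And>p. p \<in> D \<Longrightarrow> g p = g1 p / g2 p" using regE[OF assms(2)] by blast
  show "(\<lambda>p. f p * g p) \<in> reg"
    by (rule regI[of "\<lambda>p. f1 p * g1 p" "\<lambda>p. f2 p * g2 p"]) (use f g in \<open>auto intro: polyfuns.mult\<close>)
  show "(\<lambda>p. f p + g p) \<in> reg"
    by (rule regI[of "\<lambda>p. f1 p * g2 p + g1 p * f2 p" "\<lambda>p. f2 p * g2 p"])
       (use f g in \<open>auto intro: polyfuns.mult polyfuns.add simp: field_simps\<close>)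
qed

lemma reg_uminus: "f \<in> reg \<Longrightarrow> (\<lambda>p. - f p) \<in> reg"
  using reg_mult[OF reg_const[of "-1"]] by simp

lemma reg_diff: "f \<in> reg \<Longrightarrow> g \<in> reg \<Longrightarrow> (\<lambda>p. f p - g p) \<in> reg"
  using reg_add[OF _ reg_uminus] by simp

lemma reg_inverse: "f \<in> reg \<Longrightarrow> (\<And>p. p \<in> D \<Longrightarrow> f p \<noteq> 0) \<Longrightarrow> (\<lambda>p. inverse (f p)) \<in> reg"
proof (elim regE)
  fix g h
  assume *: "g \<in> polys" "h \<in> polys" "\<And>p. p \<in> D \<Longrightarrow> h p \<noteq> 0" "\<And>p. p \<in> D \<Longrightarrow> f p = g p / h p"
   and nz: "\<And>p. p \<in> D \<Longrightarrow> f p \<noteq> 0"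
  show ?thesis by (rule regI[of h g]) (use * nz in force)+
qed

lemma reg_divide: "f \<in> reg \<Longrightarrow> g \<in> reg \<Longrightarrow> (\<And>p. p \<in> D \<Longrightarrow> g p \<noteq> 0) \<Longrightarrow> (\<lambda>p. f p / g p) \<in> reg"
  unfolding divide_inverse by (intro reg_mult reg_inverse)

lemma reg_power: "f \<in> reg \<Longrightarrow> (\<lambda>p. f p ^ n) \<in> reg"
  by (induction n) (auto intro: reg_const reg_mult)

lemma reg_sum: "(\<And>i. i \<in> A \<Longrightarrow> f i \<in> reg) \<Longrightarrow> (\<lambda>p. \<Sum>i\<in>A. f i p) \<in> reg"
  by (induction A rule: infinite_finite_induct) (auto intro: reg_const reg_add)

lemma reg_prod: "(\<And>i. i \<in> A \<Longrightarrow> f i \<in> reg) \<Longrightarrow> (\<lambda>p. \<Prod>i\<in>A. f i p) \<in> reg"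
  by (induction A rule: infinite_finite_induct) (auto intro: reg_const reg_mult)

lemma reg_sh:
  assumes "f \<in> reg" "wt x = wt y"
  shows "(\<lambda>p. f (sh x y p)) \<in> reg"
  using assms(1)
proof (elim regE)
  fix g h
  assume *: "g \<in> polys" "h \<in> polys" "\<And>p. p \<in> D \<Longrightarrow> h p \<noteq> 0" "\<And>p. p \<in> D \<Longrightarrow> f p = g p / h p"
  show ?thesis
    by (rule regI[of "\<lambda>p. g (sh x y p)" "\<lambda>p. h (sh x y p)"]) (use * assms(2) sh_D in \<open>auto intro: poly_sh\<close>)
qed

lemma reg_tw: "f \<in> reg \<Longrightarrow> (\<lambda>p. f (tw n p)) \<in> reg"
  unfolding tw_def by (intro reg_sh) simp_all

lemmas reg_intros = reg_const reg_fst reg_snd reg_mult reg_add reg_uminus reg_diff reg_divide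
  reg_power reg_sum reg_prod reg_tw

section \<open>Operators that are Laurent polynomials in \<open>T\<close> with regular
  coefficients\<close>

definition T_poly :: "params operator \<Rightarrow> int \<Rightarrow> int \<Rightarrow> bool" where
  "T_poly A lo hi \<longleftrightarrow> (\<exists>e. (\<forall>s. e s \<in> reg) \<and> (\<forall>Y. \<forall>p\<in>D. A Y p = (\<Sum>s\<in>{lo..hi}. e s p * Y (tw s p))))"

lemma T_poly_id: "T_poly (\<lambda>Y. Y) 0 0"
  unfolding T_poly_def by (intro exI[of _ "\<lambda>_ _. 1"]) (auto intro: reg_const)

lemma T_poly_mono:
  assumes "T_poly A lo hi" "lo' \<le> lo" "hi \<le> hi'"
  shows "T_poly A lo' hi'"
proof -
  obtain e where e: "\<And>s. e s \<in> reg" "\<And>Y p. p \<in> D \<Longrightarrow> A Y p = (\<Sum>s\<in>{lo..hi}. e s p * Y (tw s p))"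
    using assms(1) unfolding T_poly_def by blast
  define e' where "e' s = (if s \<in> {lo..hi} then e s else (\<lambda>_. 0))" for s
  have "A Y p = (\<Sum>s\<in>{lo'..hi'}. e' s p * Y (tw s p))" if "p \<in> D" for Y p
    unfolding e(2)[OF that] by (rule sum.mono_neutral_cong_left) (use assms in \<open>auto simp: e'_def\<close>)
  moreover have "e' s \<in> reg" for s using e(1) by (auto simp: e'_def reg_const)
  ultimately show ?thesis unfolding T_poly_def by blast
qed

lemma T_poly_tw:
  assumes "T_poly A lo hi"
  shows "T_poly (\<lambda>Y p. A Y (tw n p)) (lo + n) (hi + n)"
proof -
  obtain e where e: "\<And>s. e s \<in> reg" "\<And>Y p. p \<in> D \<Longrightarrow> A Y p = (\<Sum>s\<in>{lo..hi}. e s p * Y (tw s p))"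
    using assms(1) unfolding T_poly_def by blast
  have "A Y (tw n p) = (\<Sum>s\<in>{lo+n..hi+n}. e (s - n) (tw n p) * Y (tw s p))" if "p \<in> D" for Y p
    unfolding e(2)[OF tw_D[OF that]]
    by (rule sum.reindex_bij_witness[of _ "\<lambda>s. s - n" "\<lambda>s. s + n"]) (auto simp: tw_tw)
  then show ?thesis unfolding T_poly_def
    by (intro exI[of _ "\<lambda>s p. e (s - n) (tw n p)"]) (auto intro: reg_tw e)
qed

lemma T_poly_add:
  assumes "T_poly A lo hi" "T_poly B lo hi"
  shows "T_poly (\<lambda>Y p. A Y p + B Y p) lo hi"
proof -
  obtain e where e: "\<And>s. e s \<in> reg" "\<And>Y p. p \<in> D \<Longrightarrow> A Y p = (\<Sum>s\<in>{lo..hi}. e s p * Y (tw s p))"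
    using assms(1) unfolding T_poly_def by blast
  obtain f where f: "\<And>s. f s \<in> reg" "\<And>Y p. p \<in> D \<Longrightarrow> B Y p = (\<Sum>s\<in>{lo..hi}. f s p * Y (tw s p))"
    using assms(2) unfolding T_poly_def by blast
  show ?thesis unfolding T_poly_def
    by (intro exI[of _ "\<lambda>s p. e s p + f s p"]) (auto intro: reg_add e f simp: e(2) f(2) sum.distrib distrib_right)
qed

lemma T_poly_scale:
  assumes "T_poly A lo hi" "c \<in> reg"
  shows "T_poly (\<lambda>Y p. c p * A Y p) lo hi"
proof -
  obtain e where e: "\<And>s. e s \<in> reg" "\<And>Y p. p \<in> D \<Longrightarrow> A Y p = (\<Sum>s\<in>{lo..hi}. e s p * Y (tw s p))"
    using assms(1) unfolding T_poly_def by blast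
  show ?thesis unfolding T_poly_def
    by (intro exI[of _ "\<lambda>s p. c p * e s p"]) (auto intro: reg_mult e assms simp: e(2) sum_distrib_left mult.assoc)
qed

lemma T_poly_diff:
  assumes "T_poly A lo hi" "T_poly B lo hi"
  shows "T_poly (\<lambda>Y p. A Y p - B Y p) lo hi"
  using T_poly_add[OF assms(1) T_poly_scale[OF assms(2) reg_const[of "-1"]]] by simp

lemma T_poly_zero: "T_poly (\<lambda>Y p. 0) lo hi"
  unfolding T_poly_def by (intro exI[of _ "\<lambda>_ _. 0"]) (auto intro: reg_const)

lemma T_poly_sum:
  "(\<And>i. i \<in> A \<Longrightarrow> T_poly (B i) lo hi) \<Longrightarrow> T_poly (\<lambda>Y p. \<Sum>i\<in>A. B i Y p) lo hi"
  by (induction A rule: infinite_finite_induct) (auto intro: T_poly_zero T_poly_add)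

lemma T_poly_prodB: "T_poly (\<lambda>Y. prodB q m Y) 0 (int m)"
proof (induction m)
  case 0
  then show ?case using T_poly_id by (simp add: prodB_0[abs_def])
next
  case (Suc m)
  have "T_poly (\<lambda>Y p. prodB q m Y p - q powi (- int m) * prodB q m Y (tw 1 p)) 0 (int (Suc m))"
    by (intro T_poly_diff T_poly_scale reg_const T_poly_mono[OF Suc] T_poly_mono[OF T_poly_tw[OF Suc, of 1]]) auto
  then show ?case by (simp add: prodB_Suc[abs_def])
qed

lemma T_poly_prodAB: "T_poly (\<lambda>Y. prodA q n (prodB q m Y)) 0 (int (n + m))"
proof (induction n)
  case 0
  then show ?case using T_poly_prodB[of m] by (simp add: prodA_0[abs_def])
next
  case (Suc n)
  have "T_poly (\<lambda>Y p. prodA q n (prodB q m Y) p - (fst p 1 * q ^ n / snd p 1) * prodA q n (prodB q m Y) (tw 1 p))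
          0 (int (Suc n + m))"
    by (intro T_poly_diff T_poly_scale reg_intros T_poly_mono[OF Suc] T_poly_mono[OF T_poly_tw[OF Suc, of 1]])
       (auto simp: D_nz)
  then show ?case by (simp add: prodA_Suc[abs_def])
qed

lemma reg_esym: "(\<lambda>p. esym k K (fst p)) \<in> reg" "(\<lambda>p. esym k K (snd p)) \<in> reg"
  unfolding esym_def by (intro reg_sum reg_prod reg_fst reg_snd; auto)+

lemma T_poly_E_hat: "T_poly (E_hat q M) (-1) (int M)"
proof -
  have E: "E_hat q M = (\<lambda>Y p.
     snd p 1 ^ (M+2) * prodA q (M+1) (prodB q 0 Y) (tw (-1) p)
     + (\<Sum>k=1..M+1. ((-1) ^ k * snd p 1 ^ (M+2-k)) *
          (esym k K (fst p) * prodA q (M+1-k) (prodB q (k-1) Y) (tw (-1) p)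
           - (q * esym k K (snd p)) * prodA q (M+1-k) (prodB q (k-1) Y) p))
     + ((-1) ^ M * (\<Prod>k=2..M+3. fst p k)) * prodA q 0 (prodB q (M+1) Y) (tw (-1) p))"
    by (intro ext) (simp add: E_hat_def split_beta T1_inv_tw prodA_0[abs_def] prodB_0[abs_def] del: sum.cl_ivl_Suc)
  have 1: "T_poly (\<lambda>Y p. prodA q n (prodB q m Y) (tw (-1) p)) (-1) (int M)" if "n + m \<le> M + 1" for n m
    by (rule T_poly_mono[OF T_poly_tw[OF T_poly_prodAB[of n m], of "-1"]]) (use that in auto)
  have 2: "T_poly (\<lambda>Y. prodA q n (prodB q m Y)) (-1) (int M)" if "n + m \<le> M" for n m
    by (rule T_poly_mono[OF T_poly_prodAB[of n m]]) (use that in auto)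
  show ?thesis unfolding E
    by (intro T_poly_add T_poly_scale T_poly_sum T_poly_diff 1 2 reg_intros reg_esym) auto
qed

text \<open>The coefficients are chosen, never computed. What is needed about them follows by
  applying \<open>E_hat\<close> to functions with prescribed values.\<close>

definition e_hat :: "int \<Rightarrow> params \<Rightarrow> complex" where
  "e_hat = (SOME e. (\<forall>s. e s \<in> reg) \<and> (\<forall>Y. \<forall>p\<in>D. E_hat q M Y p = (\<Sum>s\<in>J'. e s p * Y (tw s p))))"

lemma e_hat_reg: "e_hat s \<in> reg"
  and E_hat_expand: "p \<in> D \<Longrightarrow> E_hat q M Y p = (\<Sum>s\<in>J'. e_hat s p * Y (tw s p))"
  using someI_ex[OF T_poly_E_hat[unfolded T_poly_def]] unfolding e_hat_def[symmetric] by blast+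

lemma tw_eq_iff: "p \<in> D \<Longrightarrow> tw m p = tw n p \<longleftrightarrow> m = n"
proof -
  assume p: "p \<in> D"
  have "m = n" if "tw m p = tw n p"
  proof -
    have "fst (tw m p) 1 = fst (tw n p) 1" using that by simp
    then show ?thesis using D_nz(1)[OF p, of 1] by (simp add: fst_tw powi_q_eq_iff)
  qed
  then show ?thesis by auto
qed

text \<open>The points \<open>tw s p\<close> are distinct, so some function has the values
  \<open>F s s\<close> there and \<open>E_hat_F\<close> applies to it. As no weight is involved,
  \<open>t\<close> may be any complex number.\<close>

lemma e_hat_identity:
  assumes p: "p \<in> D"
    and F1: "\<And>u v. u \<in> {-1..<int M} \<Longrightarrow> v \<in> J' \<Longrightarrow>
      F u v = (1 - fst p 1 * q powi u * t) * F (u + 1) v"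
    and F2: "\<And>u v. u \<in> J' \<Longrightarrow> v \<in> {-1..<int M} \<Longrightarrow>
      F u (v + 1) = (1 - snd p 1 * q powi v * t) * F u v"
  shows "t * (\<Sum>s\<in>J'. e_hat s p * F s s) =
           q * snd p 1 ^ (M+1) * xfac p M * F (int M) (-1) * (polyA p t - polyB p t)"
proof -
  define Y where "Y p' = (\<Sum>s\<in>J'. if tw s p = p' then F s s else 0)" for p'
  have Y: "Y (tw s p) = F s s" if "s \<in> J'" for s
    unfolding Y_def tw_eq_iff[OF p] using that by (subst sum.delta) auto
  have "t * E_hat q M Y p = q * snd p 1 ^ (M+1) * xfac p M * F (int M) (-1) * (polyA p t - polyB p t)"
    by (rule E_hat_F) (use F1 F2 Y D_nz(2)[OF p] D_prod[OF p] in auto)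
  moreover have "E_hat q M Y p = (\<Sum>s\<in>J'. e_hat s p * F s s)"
    unfolding E_hat_expand[OF p] by (rule sum.cong) (auto simp: Y)
  ultimately show ?thesis by simp
qed

text \<open>The formal solution: the weight with \<open>a_1\<close> and \<open>b_1\<close> shifted
  \<open>u\<close> and \<open>v\<close> times, divided by the one with exponents \<open>M\<close>
  and \<open>-1\<close>. Being a polynomial in \<open>t\<close>, it makes sense where the weights
  themselves vanish or have poles.\<close>

definition Fp :: "params \<Rightarrow> complex \<Rightarrow> int \<Rightarrow> int \<Rightarrow> complex" where
  "Fp p t u v = (\<Prod>j\<in>{u..<int M}. 1 - fst p 1 * q powi j * t) * (\<Prod>j\<in>{-1..<v}. 1 - snd p 1 * q powi j * t)"

lemma Fp_1: "u \<in> {-1..<int M} \<Longrightarrow> Fp p t u v = (1 - fst p 1 * q powi u * t) * Fp p t (u + 1) v"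
proof -
  assume "u \<in> {-1..<int M}"
  then have "{u..<int M} = insert u {u+1..<int M}" by auto
  then show ?thesis by (simp add: Fp_def)
qed

lemma Fp_2: "v \<in> {-1..<int M} \<Longrightarrow> Fp p t u (v + 1) = (1 - snd p 1 * q powi v * t) * Fp p t u v"
proof -
  assume "v \<in> {-1..<int M}"
  then have "{-1..<v+1} = insert v {-1..<v}" by auto
  then show ?thesis by (simp add: Fp_def)
qed

lemma Fp_top [simp]: "Fp p t (int M) (-1) = 1" by (simp add: Fp_def)

lemma Fp_identity:
  "p \<in> D \<Longrightarrow> t * (\<Sum>s\<in>J'. e_hat s p * Fp p t s s) =
     q * snd p 1 ^ (M+1) * xfac p M * (polyA p t - polyB p t)"
  using e_hat_identity[of p "Fp p t" t] by (simp add: Fp_1 Fp_2)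

lemma ab_ne:
  assumes "p \<in> D" "i \<in> I" "k \<in> I"
  shows "1 - fst p i * q powi m * (q powi n / snd p k) \<noteq> 0"
    and "1 - snd p k * q powi m * (q powi n / fst p i) \<noteq> 0"
proof -
  have nz: "fst p i \<noteq> 0" "snd p k \<noteq> 0" using D_nz assms by auto
  show "1 - fst p i * q powi m * (q powi n / snd p k) \<noteq> 0"
  proof
    assume "1 - fst p i * q powi m * (q powi n / snd p k) = 0"
    then have e: "snd p k = fst p i * q powi (m + n)" using nz q0 by (simp add: field_simps power_int_add)
    have "fst p i = snd p k * q powi (- (m + n))"
      unfolding e using q0 by (simp flip: power_int_add)
    with D_ne[OF assms] show False by blast
  qed
  show "1 - snd p k * q powi m * (q powi n / fst p i) \<noteq> 0"
  proof
    assume "1 - snd p k * q powi m * (q powi n / fst p i) = 0"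
    then have "fst p i = snd p k * q powi (m + n)" using nz q0 by (simp add: field_simps power_int_add)
    with D_ne[OF assms] show False by blast
  qed
qed

lemma polyA_ne: "p \<in> D \<Longrightarrow> k \<in> I \<Longrightarrow> polyA p (q powi n / snd p k) \<noteq> 0"
proof -
  assume p: "p \<in> D" and k: "k \<in> I"
  have "1 - fst p j * q powi m * (q powi n / snd p k) \<noteq> 0" if "j \<in> I" for j m
    by (rule ab_ne(1)[OF p that k])
  moreover have "j \<in> I" if "j \<in> K" for j using that by auto
  ultimately show ?thesis
    unfolding polyA_def using I1 by (simp only: mult_eq_0_iff prod_zero_iff finite_atLeastAtMost) blast
qed

lemma polyB_ne:
  assumes p: "p \<in> D" and k: "k \<in> I"
  shows "polyB p (q powi n / fst p k) \<noteq> 0"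
proof -
  have "1 - snd p j * (q powi n / fst p k) \<noteq> 0" if "j \<in> I" for j
    using ab_ne(2)[OF p k that, of 0 n] by simp
  moreover have "1 - snd p 1 * q powi (-1) * (q powi n / fst p k) \<noteq> 0"
    by (rule ab_ne(2)[OF p k I1])
  moreover have "j \<in> I" if "j \<in> K" for j using that by auto
  ultimately show ?thesis
    unfolding polyB_def by (simp only: mult_eq_0_iff prod_zero_iff finite_atLeastAtMost) blast
qed

lemma xfac_ne: "p \<in> D \<Longrightarrow> xfac p n \<noteq> 0"
proof -
  assume p: "p \<in> D"
  have "1 - fst p 1 / snd p 1 * q ^ i \<noteq> 0" for i
    using ab_ne(1)[OF p I1 I1, of "int i" 0] by (simp add: mult_ac)
  then show ?thesis by (auto simp: xfac_def)
qed

lemma polyA_0: "p \<in> D \<Longrightarrow> k \<in> K \<Longrightarrow> polyA p (q / fst p k) = 0"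
  using D_nz(1)[of p k] q0 unfolding polyA_def by (auto simp: powi_m1 intro!: bexI[of _ k])

lemma polyB_0: "p \<in> D \<Longrightarrow> k \<in> K \<Longrightarrow> polyB p (1 / snd p k) = 0"
  using D_nz(2)[of p k] unfolding polyB_def by (auto intro!: bexI[of _ k])

lemma polyB_0': "p \<in> D \<Longrightarrow> polyB p (q / snd p 1) = 0"
  using D_nz(2)[of p 1] q0 unfolding polyB_def by (auto simp: powi_m1)

text \<open>At \<open>t = q / b_1\<close> the b-factor of index \<open>-1\<close> kills
  \<open>Fp p t s s\<close> for all \<open>s\<close> except \<open>-1\<close>, which isolates this
  coefficient. On the right \<open>polyB\<close> vanishes there, while \<open>polyA\<close> does
  not.\<close>

lemma e_hat_low_ne:
  assumes p: "p \<in> D"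
  shows "e_hat (-1) p \<noteq> 0"
proof -
  let ?t = "q / snd p 1"
  have b: "snd p 1 \<noteq> 0" using D_nz(2)[OF p] by simp
  have z: "Fp p ?t s s = 0" if "s \<in> J' - {-1}" for s
    unfolding Fp_def using that b q0 by (auto simp: powi_m1 intro!: bexI[of _ "-1"])
  have "(\<Sum>s\<in>J'. e_hat s p * Fp p ?t s s) = (\<Sum>s\<in>{-1}. e_hat s p * Fp p ?t s s)"
    by (rule sum.mono_neutral_right) (use z in auto)
  moreover have "q * snd p 1 ^ (M+1) * xfac p M * (polyA p ?t - polyB p ?t) \<noteq> 0"
    using polyA_ne[OF p I1, of 1] polyB_0'[OF p] xfac_ne[OF p] b q0 by auto
  ultimately show ?thesis using Fp_identity[OF p, of ?t] by auto
qed

text \<open>At \<open>t = q^(1-M) / a_1\<close> the a-factor of index \<open>M - 1\<close> vanishes.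
  It is present in \<open>Fp p t s s\<close> for all \<open>s < M\<close> and in
  \<open>polyA\<close>, but \<open>polyB\<close> is nonzero.\<close>

lemma e_hat_high_ne:
  assumes p: "p \<in> D"
  shows "e_hat (int M) p \<noteq> 0"
proof -
  let ?t = "q powi (1 - int M) / fst p 1"
  have a: "fst p 1 \<noteq> 0" using D_nz(1)[OF p] by simp
  have a0: "1 - fst p 1 * q powi (int M - 1) * ?t = 0"
    using a q0 by (simp add: field_simps flip: power_int_add)
  have z: "Fp p ?t s s = 0" if "s \<in> J' - {int M}" for s
    unfolding Fp_def using that a0 by (auto intro!: bexI[of _ "int M - 1"] simp del: times_divide_eq_right)
  have "(\<Sum>s\<in>J'. e_hat s p * Fp p ?t s s) = (\<Sum>s\<in>{int M}. e_hat s p * Fp p ?t s s)"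
    by (rule sum.mono_neutral_right) (use z in auto)
  moreover have "polyA p ?t = 0" unfolding polyA_def using a0 by simp
  then have "q * snd p 1 ^ (M+1) * xfac p M * (polyA p ?t - polyB p ?t) \<noteq> 0"
    using polyB_ne[OF p I1, of "1 - int M"] xfac_ne[OF p] D_nz(2)[OF p I1] q0 by auto
  ultimately show ?thesis using Fp_identity[OF p, of ?t] by auto
qed

context
  fixes p :: params and S :: "complex set" and V L and Y :: "params \<Rightarrow> complex"
  assumes p: "p \<in> D" and S: "S \<subseteq> good p" and L: "lin_on V L"
    and V: "\<And>x y. wt x = wt y \<Longrightarrow> tW S (sh x y p) \<in> V"
    and Y: "\<And>x y. wt x = wt y \<Longrightarrow> Y (sh x y p) = L (tW S (sh x y p))"
begin

text \<open>\<open>G\<close> lies in \<open>V\<close> because it is a combination of the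
  \<open>tW S (tw s p)\<close>. Its two terms separately need not: along the lattices of the Jackson
  sums \<open>bdry\<close> tends to 1 and is not summable.\<close>

lemma E_hat_functional:
  defines "G \<equiv> (\<lambda>t. if t \<in> S then q * snd p 1 ^ (M+1) * xfac p M * (bdry p t - bdry p (q * t)) else 0)"
  shows "E_hat q M Y p = L G" and "G \<in> V"
proof -
  have tw: "Y (tw s p) = L (tW S (tw s p))" "tW S (tw s p) \<in> V" for s
    unfolding tw_def by (intro Y V; simp)+
  have "(\<lambda>t. \<Sum>s\<in>J'. e_hat s p * tW S (tw s p) t) = G"
  proof
    fix t
    show "(\<Sum>s\<in>J'. e_hat s p * tW S (tw s p) t) = G t"
    proof (cases "t \<in> S")
      case True
      then have "(\<Sum>s\<in>J'. e_hat s p * tW S (tw s p) t) = t * E_hat q M (\<lambda>p'. W p' t) p"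
        unfolding E_hat_expand[OF p] by (simp add: tW_def sum_distrib_left mult_ac)
      also have "\<dots> = G t" using E_hat_W[OF p, of t] True S by (auto simp: G_def)
      finally show ?thesis .
    qed (simp add: G_def tW_def)
  qed
  with lin_on_sum[OF L, of "J'" "\<lambda>s. tW S (tw s p)" "\<lambda>s. e_hat s p"] tw
  show "E_hat q M Y p = L G" "G \<in> V" unfolding E_hat_expand[OF p] by simp_all
qed

lemma total_functional:
  defines "G \<equiv> (\<lambda>t. if t \<in> S then (q * t) * W p (q * t) - t * W p t else 0)"
  shows "q * Y (sh1 p) - Y p = L G" and "G \<in> V"
proof -
  have Y0: "Y p = L (tW S p)" and V0: "tW S p \<in> V" using Y[of Z Z] V[of Z Z] by auto
  have Y1: "Y (sh1 p) = L (tW S (sh1 p))" and V1: "tW S (sh1 p) \<in> V"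
    using Y[of "\<lambda>_. 1" "\<lambda>_. 1"] V[of "\<lambda>_. 1" "\<lambda>_. 1"] by auto
  have "G = (\<lambda>t. q * tW S (sh1 p) t + (- 1 * tW S p t + 0))"
    by (auto simp: G_def tW_def W_q)
  moreover have a: "(\<lambda>t. - 1 * tW S p t + 0) \<in> V" "L (\<lambda>t. - 1 * tW S p t + 0) = - 1 * L (tW S p) + L (\<lambda>_. 0)"
    by (rule lin_onD(2,3)[OF L V0 lin_onD(1)[OF L]])+
  ultimately show "q * Y (sh1 p) - Y p = L G" "G \<in> V"
    using lin_onD(2,3)[OF L V1 a(1), of q] lin_on_0[OF L] Y0 Y1 by simp_all
qed

end

end

section \<open>The Jackson integrals are solutions\<close>

lemma has_sum_int_from:
  fixes g :: "int \<Rightarrow> complex"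
  assumes "\<And>m. m < c \<Longrightarrow> g m = 0"
  shows "(g has_sum s) UNIV \<longleftrightarrow> ((\<lambda>n. g (int n + c)) has_sum s) UNIV"
proof -
  have "bij_betw (\<lambda>n. int n + c) UNIV {c..}"
    by (rule bij_betwI[where g = "\<lambda>m. nat (m - c)"]) auto
  then have "((\<lambda>n. g (int n + c)) has_sum s) UNIV \<longleftrightarrow> (g has_sum s) {c..}"
    by (rule has_sum_reindex_bij_betw)
  also have "\<dots> \<longleftrightarrow> (g has_sum s) UNIV"
    by (rule has_sum_cong_neutral) (use assms in auto)
  finally show ?thesis by simp
qed

lemma infsum_int_telescope:
  fixes H :: "int \<Rightarrow> complex"
  assumes "(\<lambda>m. H m - H (m + 1)) summable_on UNIV"
    and "\<And>m. m < c \<Longrightarrow> H m = 0" and "(\<lambda>n. H (int n + c)) \<longlonglongrightarrow> l"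
  shows "infsum (\<lambda>m. H m - H (m + 1)) UNIV = - l"
proof -
  let ?g = "\<lambda>m. H m - H (m + 1)"
  have "(?g has_sum infsum ?g UNIV) UNIV" using assms(1) by simp
  then have "((\<lambda>n. ?g (int n + (c - 1))) has_sum infsum ?g UNIV) UNIV"
    by (subst (asm) has_sum_int_from[where c = "c - 1"]) (use assms(2) in auto)
  then have 1: "(\<lambda>n. ?g (int n + (c - 1))) sums infsum ?g UNIV"
    by (rule has_sum_imp_sums)
  have "(\<lambda>n. H (int (Suc n) + (c - 1))) \<longlonglongrightarrow> l"
    using assms(3) by (simp add: algebra_simps)
  then have "(\<lambda>n. H (int n + (c - 1))) \<longlonglongrightarrow> l"
    by (rule LIMSEQ_imp_Suc)
  from telescope_sums'[OF this]
  have "(\<lambda>n. ?g (int n + (c - 1))) sums (H (c - 1) - l)"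
    by (simp add: algebra_simps)
  with 1 have "infsum ?g UNIV = H (c - 1) - l" by (rule sums_unique2)
  then show ?thesis using assms(2)[of "c - 1"] by simp
qed

context q_rp
begin

definition pt :: "params \<Rightarrow> nat \<Rightarrow> int \<Rightarrow> complex" where
  "pt p i n = q powi n / fst p i"

lemma pt_Suc: "pt p i (n + 1) = q * pt p i n"
  using q0 by (simp add: pt_def power_int_add)

lemma pt_add_nat: "pt p i (int n + c) = pt p i c * q ^ n"
  using q0 by (simp add: pt_def power_int_add)

lemma pt_good:
  assumes "p \<in> D" "i \<in> I"
  shows "pt p i n \<in> good p"
proof -
  have "snd p k * pt p i n * q powi m \<noteq> 1" if "k \<in> I" for k m
    using ab_ne(2)[OF assms that, of m n] by (simp add: pt_def mult_ac)
  then show ?thesis using D_nz(1)[OF assms] q0 by (simp add: good_def pt_def)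
qed

text \<open>Because of these zeros, a sum over the whole lattice starts by itself at the limit of
  the integral, wherever a shift of \<open>a_i\<close> has moved that limit.\<close>

lemma W_pt_0:
  assumes "p \<in> D" "i \<in> I" "m \<le> - x i"
  shows "W (sh x y p) (pt p i m) = 0"
proof -
  define n where "n = nat (- x i - m)"
  have "fst (sh x y p) i * pt p i m = q powi (x i + m)"
    using D_nz(1)[OF assms(1,2)] assms(2) q0 by (simp add: pt_def power_int_add)
  moreover have "q powi (x i + m) * q ^ n = q powi (x i + m + int n)"
    using q0 by (simp add: power_int_add)
  moreover have "x i + m + int n = 0" using assms(3) by (simp add: n_def)
  ultimately have "fst (sh x y p) i * pt p i m * q ^ n = 1" by simp
  then have "qpoch_inf q (fst (sh x y p) i * pt p i m) = 0"
    using qpoch_inf_eq_0_iff[OF q_less] by blast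
  then show ?thesis unfolding W_def using assms(2) by (intro prod_zero) auto
qed

lemma W_pt_tendsto: "(\<lambda>n. W p' (pt p i (int n + c))) \<longlonglongrightarrow> 1"
proof -
  have "(\<lambda>n. qpoch_inf q (z * pt p i (int n + c))) \<longlonglongrightarrow> 1" for z
    using tendsto_qpoch_inf_power[OF q_less, of "z * pt p i c"] by (simp add: pt_add_nat mult_ac)
  then have "(\<lambda>n. \<Prod>k\<in>I. qpoch_inf q (fst p' k * pt p i (int n + c)) / qpoch_inf q (snd p' k * pt p i (int n + c)))
      \<longlonglongrightarrow> (\<Prod>k\<in>I. 1 / 1)"
    by (intro tendsto_prod tendsto_divide) auto
  then show ?thesis by (simp add: W_def)
qed

lemma W_pt_has_sum:
  assumes "p \<in> D" "i \<in> I"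
  shows "((\<lambda>n. pt p i n * W (sh x y p) (pt p i n)) has_sum
           (\<Sum>n. pt p i (int n + (1 - x i)) * W (sh x y p) (pt p i (int n + (1 - x i))))) UNIV"
proof -
  let ?c = "1 - x i"
  let ?g = "\<lambda>n. pt p i n * W (sh x y p) (pt p i n)"
  have "Bseq (\<lambda>n. W (sh x y p) (pt p i (int n + ?c)))"
    by (rule convergent_imp_Bseq, unfold convergent_def, rule exI, rule W_pt_tendsto)
  then obtain B where B: "\<And>n. norm (W (sh x y p) (pt p i (int n + ?c))) \<le> B"
    unfolding Bseq_def by blast
  have "summable (\<lambda>n. norm (?g (int n + ?c)))"
  proof (rule summable_comparison_test)
    show "\<exists>N. \<forall>n\<ge>N. norm (norm (?g (int n + ?c))) \<le> B * norm (pt p i ?c * q ^ n)"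
    proof (intro exI allI impI)
      fix n
      have "norm (?g (int n + ?c)) = norm (W (sh x y p) (pt p i (int n + ?c))) * norm (pt p i (int n + ?c))"
        by (simp add: norm_mult mult.commute)
      also have "\<dots> \<le> B * norm (pt p i (int n + ?c))"
        by (rule mult_right_mono[OF B]) simp
      finally show "norm (norm (?g (int n + ?c))) \<le> B * norm (pt p i ?c * q ^ n)"
        by (simp only: pt_add_nat real_norm_def abs_norm_cancel)
    qed
    show "summable (\<lambda>n. B * norm (pt p i ?c * q ^ n))"
      by (intro summable_mult summable_norm_geometric q_less)
  qed
  then have "((\<lambda>n. ?g (int n + ?c)) has_sum (\<Sum>n. ?g (int n + ?c))) UNIV"
    by (intro norm_summable_imp_has_sum summable_sums[OF summable_norm_cancel])
  then show ?thesis
    by (subst has_sum_int_from[where c = ?c]) (use W_pt_0[OF assms] in auto)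
qed

lemma jackson_pt:
  assumes "p \<in> D" "i \<in> I"
  shows "jackson0 q (W (sh x y p)) (q / fst (sh x y p) i) =
     (1 - q) * infsum (\<lambda>n. pt p i n * W (sh x y p) (pt p i n)) UNIV"
proof -
  \<comment> \<open>The shifted limit \<open>q / (q^(x i) a_i)\<close> is the lattice point with
    number \<open>1 - x i\<close>, the first one beyond the forced zeros of the weight.\<close>
  have e: "q / fst (sh x y p) i * q ^ n = pt p i (int n + (1 - x i))" for n
    using D_nz(1)[OF assms] q0 assms(2) by (simp add: pt_def power_int_add power_int_diff)
  have "jackson0 q (W (sh x y p)) (q / fst (sh x y p) i) =
     (1 - q) * (\<Sum>n. pt p i (int n + (1 - x i)) * W (sh x y p) (pt p i (int n + (1 - x i))))"
    unfolding jackson0_def mult.assoc e by (simp only: mult.commute)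
  also have "(\<Sum>n. pt p i (int n + (1 - x i)) * W (sh x y p) (pt p i (int n + (1 - x i)))) =
      infsum (\<lambda>n. pt p i n * W (sh x y p) (pt p i n)) UNIV"
    using W_pt_has_sum[OF assms, of x y] by (rule infsumI[symmetric])
  finally show ?thesis .
qed

lemma phi_W: "phi q M i j p = jackson0 q (W p) (q / fst p j) - jackson0 q (W p) (q / fst p i)"
  by (simp add: phi_def jackson_def W_def[abs_def] split_beta)

lemma phi_solution:
  assumes i: "i \<in> I" and j: "j \<in> I"
  shows "qRP_solution q M (phi q M i j)"
  unfolding qRP_solution_iff
proof
  fix p assume p: "p \<in> D"
  define S where "S = range (pt p i) \<union> range (pt p j)"
  define V where "V = {f :: complex \<Rightarrow> complex. (\<lambda>n. f (pt p i n)) summable_on UNIV \<and> (\<lambda>n. f (pt p j n)) summable_on UNIV}"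
  define L where "L f = (1 - q) * (infsum (\<lambda>n. f (pt p j n)) UNIV - infsum (\<lambda>n. f (pt p i n)) UNIV)"
    for f :: "complex \<Rightarrow> complex"
  have S: "S \<subseteq> good p" unfolding S_def using pt_good[OF p i] pt_good[OF p j] by auto
  have inS: "pt p i n \<in> S" "pt p j n \<in> S" for n by (auto simp: S_def)
  have L: "lin_on V L"
    unfolding lin_on_def V_def L_def
    by (auto simp: infsum_add infsum_cmult_right summable_on_cmult_right summable_on_add algebra_simps)
  have V: "tW S (sh x y p) \<in> V" for x y
    unfolding V_def tW_def using inS has_sum_imp_summable[OF W_pt_has_sum[OF p i, of x y]]
      has_sum_imp_summable[OF W_pt_has_sum[OF p j, of x y]] by simp
  have Y: "phi q M i j (sh x y p) = L (tW S (sh x y p))" for x y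
    unfolding phi_W jackson_pt[OF p i] jackson_pt[OF p j] L_def tW_def using inS
    by (simp add: right_diff_distrib)
  \<comment> \<open>Each of the two sums equals \<open>- l\<close>. The limit has to be the same
    along both lattices; then it cancels in the difference.\<close>
  have telescope: "L G = 0" if G: "G \<in> V" "\<And>t. t \<in> S \<Longrightarrow> G t = H t - H (q * t)"
      and H: "\<And>k. k \<in> {i, j} \<Longrightarrow> \<exists>c. \<forall>m<c. H (pt p k m) = 0"
      and l: "\<And>k c. k \<in> {i, j} \<Longrightarrow> (\<lambda>n. H (pt p k (int n + c))) \<longlonglongrightarrow> l" for G H l
  proof -
    have "infsum (\<lambda>n. G (pt p k n)) UNIV = - l" if k: "k \<in> {i, j}" for k
    proof -
      obtain c where c: "\<And>m. m < c \<Longrightarrow> H (pt p k m) = 0" using H[OF k] by blast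
      have e: "(\<lambda>n. G (pt p k n)) = (\<lambda>n. H (pt p k n) - H (pt p k (n + 1)))"
        using G(2) inS k by (auto simp: pt_Suc)
      have "(\<lambda>n. G (pt p k n)) summable_on UNIV" using G(1) k by (auto simp: V_def)
      then show ?thesis unfolding e
        by (rule infsum_int_telescope) (use c l[OF k] in auto)
    qed
    then show ?thesis by (simp add: L_def)
  qed
  define c where "c = q * snd p 1 ^ (M+1) * xfac p M"
  note E = E_hat_functional[OF p S L V Y, folded c_def]
  \<comment> \<open>The limit is \<open>c\<close>, which is nonzero on \<open>D\<close>, so this
    equation uses the difference of the two sums. For the last equation of the system the primitive
    contains \<open>t\<close> and tends to 0.\<close>
  have "E_hat q M (phi q M i j) p = 0"
    unfolding E(1)
  proof (rule telescope[where l = "c * 1", OF E(2)])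
    fix t assume "t \<in> S"
    then show "(if t \<in> S then c * (bdry p t - bdry p (q * t)) else 0) = c * bdry p t - c * bdry p (q * t)"
      by (simp add: right_diff_distrib)
  next
    fix k assume "k \<in> {i, j}"
    then have k: "k \<in> I" using i j by auto
    show "\<exists>ca. \<forall>m<ca. c * bdry p (pt p k m) = 0"
      unfolding bdry_def using W_pt_0[OF p k] by (intro exI[of _ "- bexp k"]) auto
  next
    show "(\<lambda>n. c * bdry p (pt p k (int n + ca))) \<longlonglongrightarrow> c * 1" for k ca
      unfolding bdry_def by (intro tendsto_intros W_pt_tendsto)
  qed
  moreover have "three_term (phi q M i j) p"
    by (rule three_term_functional[OF p S L V Y])
  moreover note Tot = total_functional[OF p S L V Y]
  have "q * phi q M i j (sh1 p) - phi q M i j p = 0"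
    unfolding Tot(1)
  proof (rule telescope[where l = "- 0" and H = "\<lambda>t. - (t * W p t)", OF Tot(2)])
    fix t assume "t \<in> S"
    then show "(if t \<in> S then q * t * W p (q * t) - t * W p t else 0) = - (t * W p t) - - (q * t * W p (q * t))"
      by simp
  next
    fix k assume "k \<in> {i, j}"
    then have k: "k \<in> I" using i j by auto
    show "\<exists>ca. \<forall>m<ca. - (pt p k m * W p (pt p k m)) = 0"
      using W_pt_0[OF p k, of _ Z Z] by (intro exI[of _ "0"]) auto
  next
    fix k ca
    have "(\<lambda>n. pt p k ca * q ^ n) \<longlonglongrightarrow> pt p k ca * 0"
      by (intro tendsto_intros LIMSEQ_power_zero q_less)
    then have "(\<lambda>n. pt p k (int n + ca)) \<longlonglongrightarrow> 0" by (simp add: pt_add_nat)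
    from tendsto_minus[OF tendsto_mult[OF this W_pt_tendsto[of p p k ca]]]
    show "(\<lambda>n. - (pt p k (int n + ca) * W p (pt p k (int n + ca)))) \<longlonglongrightarrow> - 0" by simp
  qed
  ultimately show "E_hat q M (phi q M i j) p = 0 \<and> three_term (phi q M i j) p \<and>
      q * phi q M i j (sh1 p) - phi q M i j p = 0" by blast
qed

end

section \<open>Reduction to powers of T\<close>

lemma solve_three:
  fixes c :: complex
  assumes "c * x - g * y + h * z = 0" "c \<noteq> 0"
  shows "x = g / c * y + - h / c * z"
proof -
  have "c * x = g * y - h * z" using assms(1) by (simp add: algebra_simps)
  then have "x = (g * y - h * z) / c" using assms(2) by (simp add: field_simps)
  then show ?thesis by (simp add: diff_divide_distrib)
qed

lemma swap_outer: "x - y + z = 0 \<Longrightarrow> z - y + x = 0" for x y z :: complex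
  by (simp add: algebra_simps)

lemma quotient_ratio:
  fixes c :: complex
  assumes "f * c = d * g" "c \<noteq> 0"
  shows "f / n = d / c * (g / n)"
proof -
  have "f = d * g / c" using assms by (simp add: field_simps)
  then show ?thesis by simp
qed

lemma cross_ratio:
  fixes q :: complex
  assumes "d * t = q"
  shows "(1 - b * (r * q) * t) * f * (d - a * (r * q)) = (d - b * (r * q * q)) * ((1 - a * r * t) * f)"
  unfolding assms[symmetric] by (simp add: algebra_simps)

context q_rp
begin

abbreviation Sol where "Sol \<equiv> {Y. qRP_solution q M Y}"

lemma Sol_E_hat: "Y \<in> Sol \<Longrightarrow> p \<in> D \<Longrightarrow> (\<Sum>s\<in>J'. e_hat s p * Y (tw s p)) = 0"
  using E_hat_expand[of p Y] by (simp add: qRP_solution_iff)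

lemma Sol_a:
  assumes "Y \<in> Sol" "p \<in> D" "k \<in> K"
  shows "(snd p 1 - fst p 1) * Y (sh (Z(1 := 1, k := -1)) Z p)
          - (inverse q * fst p k - fst p 1) * Y (tw 1 p) + (inverse q * fst p k - snd p 1) * Y p = 0"
  using assms by (simp add: qRP_solution_iff three_term_def Let_def)

lemma Sol_b:
  assumes "Y \<in> Sol" "p \<in> D" "k \<in> K"
  shows "(fst p 1 - snd p 1) * Y (sh Z (Z(k := 1, 1 := -1)) p)
          - (snd p k * q - snd p 1) * Y (tw (-1) p) + (snd p k * q - fst p 1) * Y p = 0"
  using assms by (simp add: qRP_solution_iff three_term_def Let_def)

abbreviation comb :: "(int \<Rightarrow> params \<Rightarrow> complex) \<Rightarrow> (params \<Rightarrow> complex) \<Rightarrow> params \<Rightarrow> complex" where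
  "comb c Y p \<equiv> (\<Sum>s\<in>J. c s p * Y (tw s p))"

text \<open>The coefficients do not depend on the solution and the equality holds on all of
  \<open>D\<close>, so that reductions can be substituted into each other at shifted points.\<close>

definition red :: "(params \<Rightarrow> params) \<Rightarrow> bool" where
  "red \<mu> \<longleftrightarrow> (\<exists>c. (\<forall>s. c s \<in> reg) \<and>
     (\<forall>Y\<in>Sol. \<forall>p\<in>D. Y (\<mu> p) = comb c Y p))"

lemma red_lincomb:
  assumes "\<And>i. i \<in> A \<Longrightarrow> g i \<in> reg" "\<And>i. i \<in> A \<Longrightarrow> red (\<nu> i)"
    and eq: "\<And>Y p. Y \<in> Sol \<Longrightarrow> p \<in> D \<Longrightarrow> Y (\<mu> p) = (\<Sum>i\<in>A. g i p * Y (\<nu> i p))"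
  shows "red \<mu>"
proof -
  have "\<forall>i\<in>A. \<exists>c. (\<forall>s. c s \<in> reg) \<and>
     (\<forall>Y\<in>Sol. \<forall>p\<in>D. Y (\<nu> i p) = comb c Y p)"
    using assms(2) unfolding red_def by blast
  from bchoice[OF this] obtain c where c: "\<And>i s. i \<in> A \<Longrightarrow> c i s \<in> reg"
     "\<And>i Y p. i \<in> A \<Longrightarrow> Y \<in> Sol \<Longrightarrow> p \<in> D \<Longrightarrow> Y (\<nu> i p) = comb (c i) Y p"
    by blast
  define d where "d s p = (\<Sum>i\<in>A. g i p * c i s p)" for s p
  have "Y (\<mu> p) = comb d Y p" if Y: "Y \<in> Sol" "p \<in> D" for Y p
  proof -
    have "Y (\<mu> p) = (\<Sum>i\<in>A. \<Sum>s\<in>J. g i p * c i s p * Y (tw s p))"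
      unfolding eq[OF Y] by (intro sum.cong refl) (simp add: c(2)[OF _ Y] sum_distrib_left mult.assoc)
    also have "\<dots> = comb d Y p"
      unfolding d_def sum_distrib_right by (rule sum.swap)
    finally show ?thesis .
  qed
  moreover have "d s \<in> reg" for s unfolding d_def using assms(1) c(1) by (intro reg_intros) auto
  ultimately show ?thesis unfolding red_def by blast
qed

lemma red_three:
  assumes "c \<in> reg" "g \<in> reg" "h \<in> reg" "red \<mu>" "red \<nu>" and nz: "\<And>p. p \<in> D \<Longrightarrow> c p \<noteq> 0"
    and eq: "\<And>Y p. Y \<in> Sol \<Longrightarrow> p \<in> D \<Longrightarrow> c p * Y (\<rho> p) - g p * Y (\<mu> p) + h p * Y (\<nu> p) = 0"
  shows "red \<rho>"
proof (rule red_lincomb[of UNIV "\<lambda>i p. if i then g p / c p else - h p / c p" "\<lambda>i. if i then \<mu> else \<nu>"])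
  show "(\<lambda>p. if i then g p / c p else - h p / c p) \<in> reg" for i
    using assms by (cases i) (auto intro!: reg_intros)
  show "Y (\<rho> p) = (\<Sum>i\<in>UNIV. (if i then g p / c p else - h p / c p) * Y ((if i then \<mu> else \<nu>) p))"
    if "Y \<in> Sol" "p \<in> D" for Y p
    using solve_three[OF eq[OF that] nz[OF that(2)]] by (simp add: UNIV_bool add.commute)
qed (use assms in simp)

lemma red_base:
  assumes "s \<in> J"
  shows "red (tw s)"
  unfolding red_def
proof (intro exI[of _ "\<lambda>r _. if r = s then 1 else 0"] conjI allI ballI)
  show "(\<lambda>_. if r = s then 1 else 0) \<in> reg" for r by (rule reg_const)
  fix Y :: "params \<Rightarrow> complex" and p
  have "(\<Sum>r\<in>J. (if r = s then 1 else 0) * Y (tw r p)) = (\<Sum>r\<in>J. if r = s then Y (tw r p) else 0)"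
    by (rule sum.cong) auto
  also have "\<dots> = Y (tw s p)" using assms by (subst sum.delta) auto
  finally show "Y (tw s p) = (\<Sum>r\<in>J. (if r = s then 1 else 0) * Y (tw r p))" by simp
qed

lemma tw_sh: "tw s (sh x y p) = sh x y (tw s p)"
  unfolding tw_def sh_sh by (intro sh_cong) auto

lemma red_comp:
  assumes "red \<mu>" "wt x = wt y" "\<And>s. s \<in> J \<Longrightarrow> red (\<lambda>p. tw s (sh x y p))"
  shows "red (\<lambda>p. \<mu> (sh x y p))"
proof -
  obtain c where c: "\<And>s. c s \<in> reg" "\<And>Y p. Y \<in> Sol \<Longrightarrow> p \<in> D \<Longrightarrow> Y (\<mu> p) = comb c Y p"
    using assms(1) unfolding red_def by blast
  show ?thesis
    by (rule red_lincomb[of "J" "\<lambda>s p. c s (sh x y p)" "\<lambda>s p. tw s (sh x y p)"])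
       (use assms(2,3) c sh_D reg_sh in auto)
qed

text \<open>The two end coefficients of \<open>E_hat\<close> vanish nowhere on \<open>D\<close>.
  Hence \<open>M + 1\<close> consecutive powers of \<open>T\<close> determine the next one on either
  side, and the window slides in both directions. The shift \<open>sh x y\<close> in front is merely
  carried along.\<close>

lemma red_tw_all:
  assumes wt: "wt x = wt y" and n: "\<And>s. s \<in> {n..n + int M} \<Longrightarrow> red (\<lambda>p. tw s (sh x y p))"
  shows "red (\<lambda>p. tw s (sh x y p))"
proof -
  let ?R = "\<lambda>s. red (\<lambda>p. tw s (sh x y p))"
  define P where "P m \<longleftrightarrow> (\<forall>s\<in>{m..m + int M}. ?R s)" for m
  have E: "(\<Sum>j\<in>J'. e_hat j (tw r (sh x y p)) * Y (tw (j + r) (sh x y p))) = 0"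
    if "Y \<in> Sol" "p \<in> D" for Y p r
    using Sol_E_hat[OF that(1) tw_D[OF sh_D[OF that(2) wt]], of r] by (simp add: tw_tw)
  have regE: "(\<lambda>p. e_hat j (tw r (sh x y p))) \<in> reg" for j r
    by (rule reg_sh[of "\<lambda>p. e_hat j (tw r p)", OF reg_tw[OF e_hat_reg] wt])
  have split: "?R (i + r)" if i: "i \<in> J'" and nz: "\<And>p. p \<in> D \<Longrightarrow> e_hat i p \<noteq> 0"
     and R: "\<And>j. j \<in> J' - {i} \<Longrightarrow> ?R (j + r)" for i r
  proof (rule red_lincomb[of "J' - {i}" "\<lambda>j p. - e_hat j (tw r (sh x y p)) / e_hat i (tw r (sh x y p))"
        "\<lambda>j p. tw (j + r) (sh x y p)"])
    fix Y p assume Y: "Y \<in> Sol" and p: "p \<in> D"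
    let ?e = "\<lambda>j. e_hat j (tw r (sh x y p))" and ?Y = "\<lambda>j. Y (tw (j + r) (sh x y p))"
    have nz': "?e i \<noteq> 0" using nz[OF tw_D[OF sh_D[OF p wt]]] .
    have "(\<Sum>j\<in>J'. ?e j * ?Y j) = ?e i * ?Y i + (\<Sum>j\<in>J' - {i}. ?e j * ?Y j)"
      by (rule sum.remove) (use i in auto)
    then have "?e i * ?Y i = - (\<Sum>j\<in>J' - {i}. ?e j * ?Y j)"
      using E[OF Y p, of r] by (simp add: eq_neg_iff_add_eq_0)
    then have "?Y i = - (\<Sum>j\<in>J' - {i}. ?e j * ?Y j) / ?e i"
      using nz' by (simp add: field_simps)
    also have "\<dots> = (\<Sum>j\<in>J' - {i}. - ?e j / ?e i * ?Y j)"
      by (simp add: sum_divide_distrib sum_negf)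
    finally show "?Y i = (\<Sum>j\<in>J' - {i}. - ?e j / ?e i * ?Y j)" .
  next
    fix j show "(\<lambda>p. - e_hat j (tw r (sh x y p)) / e_hat i (tw r (sh x y p))) \<in> reg"
      by (intro reg_intros regE) (use nz tw_D sh_D wt in auto)
  qed (use R in auto)
  have up: "P (m + 1)" if "P m" for m
  proof -
    have "?R (int M + (m + 1))"
      by (rule split) (use that e_hat_high_ne in \<open>auto simp: P_def\<close>)
    then have "?R s" if "s = m + 1 + int M" for s using that by (simp add: add_ac)
    moreover have "?R s" if "s \<in> {m..m + int M}" for s using that \<open>P m\<close> by (simp add: P_def)
    moreover have "s \<in> {m..m + int M} \<or> s = m + 1 + int M" if "s \<in> {m+1..m+1+int M}" for s
      using that by auto
    ultimately show ?thesis unfolding P_def by blast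
  qed
  have down: "P (m - 1)" if "P m" for m
  proof -
    have "?R (-1 + m)"
      by (rule split) (use that e_hat_low_ne in \<open>auto simp: P_def\<close>)
    then have "?R s" if "s = m - 1" for s using that by simp
    moreover have "?R s" if "s \<in> {m..m + int M}" for s using that \<open>P m\<close> by (simp add: P_def)
    moreover have "s \<in> {m..m + int M} \<or> s = m - 1" if "s \<in> {m-1..m-1+int M}" for s
      using that by auto
    ultimately show ?thesis unfolding P_def by blast
  qed
  have "P n" using n by (simp add: P_def)
  then have "P s" by (induction s rule: int_induct[where k = n]) (use up down in auto)
  then show ?thesis by (simp add: P_def)
qed

lemma red_tw: "red (tw s)"
  using red_tw_all[of Z Z 0 s] red_base by simp

text \<open>Reducing the outer of two shifts leaves powers of \<open>T\<close> in front of the inner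
  one. Asking for reducibility together with every power of \<open>T\<close> therefore makes the
  property stable under composition.\<close>

definition closed_shift :: "(nat \<Rightarrow> int) \<Rightarrow> (nat \<Rightarrow> int) \<Rightarrow> bool" where
  "closed_shift x y \<longleftrightarrow> wt x = wt y \<and> (\<forall>s. red (\<lambda>p. tw s (sh x y p)))"

lemma closed_shift_cong:
  "(\<And>k. k \<in> I \<Longrightarrow> x k = x' k) \<Longrightarrow> (\<And>k. k \<in> I \<Longrightarrow> y k = y' k) \<Longrightarrow> closed_shift x y \<Longrightarrow> closed_shift x' y'"
proof -
  assume *: "\<And>k. k \<in> I \<Longrightarrow> x k = x' k" "\<And>k. k \<in> I \<Longrightarrow> y k = y' k" "closed_shift x y"
  have "sh x y = sh x' y'" using * by (intro ext sh_cong) auto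
  moreover have "wt x = wt x'" "wt y = wt y'" using * by (auto intro: sum.cong simp del: sum.cl_ivl_Suc)
  ultimately show ?thesis using *(3) by (simp add: closed_shift_def)
qed

lemma closed_shift_0: "closed_shift Z Z"
  using red_tw by (simp add: closed_shift_def)

lemma closed_shift_add:
  assumes "closed_shift x y" "closed_shift x' y'"
  shows "closed_shift (\<lambda>k. x k + x' k) (\<lambda>k. y k + y' k)"
proof -
  have "red (\<lambda>p. tw s (sh x y (sh x' y' p)))" for s
    by (rule red_comp[of "\<lambda>p. tw s (sh x y p)"]) (use assms in \<open>auto simp: closed_shift_def\<close>)
  then show ?thesis using assms by (simp add: closed_shift_def sh_sh sum.distrib del: sum.cl_ivl_Suc)
qed

lemma closed_shift_scale:
  assumes "closed_shift x y" "closed_shift (\<lambda>k. - x k) (\<lambda>k. - y k)"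
  shows "closed_shift (\<lambda>k. i * x k) (\<lambda>k. i * y k)"
proof -
  have pos: "closed_shift (\<lambda>k. int n * x k) (\<lambda>k. int n * y k)" if "closed_shift x y" for x y n
  proof (induction n)
    case 0
    then show ?case using closed_shift_0 by simp
  next
    case (Suc n)
    from closed_shift_add[OF that Suc] show ?case by (simp add: algebra_simps)
  qed
  show ?thesis
  proof (cases "i \<ge> 0")
    case True
    then show ?thesis using pos[OF assms(1), of "nat i"] by simp
  next
    case False
    then show ?thesis using pos[OF assms(2), of "nat (- i)"] by simp
  qed
qed

lemma closed_tw: "closed_shift (Z(1 := n)) (Z(1 := n))"
proof -
  have "red (\<lambda>p. tw s (tw n p))" for s
    using red_tw[of "s + n"] by (simp add: tw_tw)
  then show ?thesis unfolding closed_shift_def by (simp add: tw_def del: sum.cl_ivl_Suc)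
qed

lemma wt_pm: "k \<in> K \<Longrightarrow> wt (Z(1 := m, k := - m)) = 0" "k \<in> K \<Longrightarrow> wt (Z(k := m, 1 := - m)) = 0"
  by (subst wt_double; simp)+

text \<open>At \<open>tw s p\<close> the new value has the coefficient
  \<open>q^s (b_1 - a_1)\<close>, which is nonzero on \<open>D\<close>. For the inverse shift the
  same equation contains two unknown values instead of one, so inverses need a separate
  argument.\<close>

lemma closed_a:
  assumes k: "k \<in> K"
  shows "closed_shift (Z(1 := 1, k := -1)) Z"
  unfolding closed_shift_def
proof (intro conjI allI)
  show wt: "wt (Z(1 := 1, k := -1)) = wt Z" using wt_pm(1)[OF k, of 1] by simp
  fix s
  let ?s = "sh (Z(1 := 1, k := -1)) Z"
  have kI: "k \<in> I" "k \<noteq> 1" using k by auto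
  have nz: "snd p 1 - fst p 1 \<noteq> 0" if "p \<in> D" for p
    using D_ne[OF that I1 I1, of 0] by auto
  show "red (\<lambda>p. tw s (?s p))"
  proof (rule red_three[of "\<lambda>p. q powi s * (snd p 1 - fst p 1)" "\<lambda>p. inverse q * fst p k - q powi s * fst p 1"
        "\<lambda>p. inverse q * fst p k - q powi s * snd p 1" "tw (1 + s)" "tw s"])
    show "q powi s * (snd p 1 - fst p 1) * Y (tw s (?s p))
          - (inverse q * fst p k - q powi s * fst p 1) * Y (tw (1 + s) p)
          + (inverse q * fst p k - q powi s * snd p 1) * Y (tw s p) = 0" if "Y \<in> Sol" "p \<in> D" for Y p
      using Sol_a[OF that(1) tw_D[OF that(2)] k, of s] kI by (simp add: fst_tw snd_tw tw_tw tw_sh algebra_simps)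
  qed (use nz q0 kI in \<open>auto intro!: reg_intros red_tw\<close>)
qed

lemma closed_b:
  assumes k: "k \<in> K"
  shows "closed_shift Z (Z(k := 1, 1 := -1))"
  unfolding closed_shift_def
proof (intro conjI allI)
  show wt: "wt Z = wt (Z(k := 1, 1 := -1))" using wt_pm(2)[OF k, of 1] by simp
  fix s
  let ?s = "sh Z (Z(k := 1, 1 := -1))"
  have kI: "k \<in> I" "k \<noteq> 1" using k by auto
  have nz: "fst p 1 - snd p 1 \<noteq> 0" if "p \<in> D" for p
    using D_ne[OF that I1 I1, of 0] by auto
  show "red (\<lambda>p. tw s (?s p))"
  proof (rule red_three[of "\<lambda>p. q powi s * (fst p 1 - snd p 1)" "\<lambda>p. snd p k * q - q powi s * snd p 1"
        "\<lambda>p. snd p k * q - q powi s * fst p 1" "tw (-1 + s)" "tw s"])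
    show "q powi s * (fst p 1 - snd p 1) * Y (tw s (?s p))
          - (snd p k * q - q powi s * snd p 1) * Y (tw (-1 + s) p)
          + (snd p k * q - q powi s * fst p 1) * Y (tw s p) = 0" if "Y \<in> Sol" "p \<in> D" for Y p
      using Sol_b[OF that(1) tw_D[OF that(2)] k, of s] kI by (simp add: fst_tw snd_tw tw_tw tw_sh algebra_simps)
  qed (use nz q0 kI in \<open>auto intro!: reg_intros red_tw\<close>)
qed

text \<open>
  The inverse of a one-step reduction: the equations express every \<open>Y (tw s (\<sigma> p))\<close> through a
  single one of them, modulo reducible terms, and the coefficient that \<open>E_hat\<close> then gives to this
  one is its value on a formal solution, which is known explicitly.
\<close>

definition semired :: "(params \<Rightarrow> params) \<Rightarrow> (params \<Rightarrow> complex) \<Rightarrow> (params \<Rightarrow> params) \<Rightarrow> bool" where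
  "semired \<mu> g \<nu> \<longleftrightarrow> g \<in> reg \<and> (\<exists>c. (\<forall>s. c s \<in> reg) \<and>
     (\<forall>Y\<in>Sol. \<forall>p\<in>D. Y (\<mu> p) = g p * Y (\<nu> p) + comb c Y p))"

lemma semired_refl: "semired \<mu> (\<lambda>_. 1) \<mu>"
  unfolding semired_def by (auto intro!: reg_const exI[of _ "\<lambda>_ _. 0"])

lemma semired_step:
  assumes "semired \<mu> g \<nu>" "h \<in> reg" "k \<in> reg" "w \<in> reg" "g' \<in> reg" "red \<rho>"
    and nz: "\<And>p. p \<in> D \<Longrightarrow> k p \<noteq> 0"
    and eq: "\<And>Y p. Y \<in> Sol \<Longrightarrow> p \<in> D \<Longrightarrow> k p * Y (\<mu>' p) - h p * Y (\<mu> p) + w p * Y (\<rho> p) = 0"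
    and g': "\<And>p. p \<in> D \<Longrightarrow> g' p = h p / k p * g p"
  shows "semired \<mu>' g' \<nu>"
proof -
  obtain c where c: "\<And>s. c s \<in> reg"
     "\<And>Y p. Y \<in> Sol \<Longrightarrow> p \<in> D \<Longrightarrow> Y (\<mu> p) = g p * Y (\<nu> p) + comb c Y p"
    using assms(1) unfolding semired_def by blast
  obtain d where d: "\<And>s. d s \<in> reg"
     "\<And>Y p. Y \<in> Sol \<Longrightarrow> p \<in> D \<Longrightarrow> Y (\<rho> p) = comb d Y p"
    using assms(6) unfolding red_def by blast
  define H V where "H p = h p / k p" and "V p = - w p / k p" for p
  define e where "e s p = H p * c s p + V p * d s p" for s p
  have "Y (\<mu>' p) = g' p * Y (\<nu> p) + comb e Y p"
    if "Y \<in> Sol" "p \<in> D" for Y p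
    unfolding solve_three[OF eq[OF that] nz[OF that(2)]] c(2)[OF that] d(2)[OF that] g'[OF that(2)] e_def
      H_def[symmetric] V_def[symmetric]
    by (simp add: distrib_left distrib_right sum.distrib sum_distrib_left mult.assoc)
  moreover have "e s \<in> reg" for s
    unfolding e_def H_def V_def using assms(2-4) c(1) d(1) nz by (intro reg_intros)
  ultimately show ?thesis unfolding semired_def using assms(5) by blast
qed

text \<open>Substituted into \<open>E_hat\<close> at the shifted point, the hypotheses leave the
  single unknown \<open>Y (tw s0 (sh x y p))\<close>, and \<open>nz\<close> says that its
  coefficient does not vanish. The other values follow, and then \<open>red_tw_all\<close>
  applies.\<close>

lemma closed_shift_inverse:
  assumes wt: "wt x = wt y"
    and semi: "\<And>s. s \<in> J' \<Longrightarrow> semired (\<lambda>p. tw s (sh x y p)) (g s) (\<lambda>p. tw s0 (sh x y p))"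
    and nz: "\<And>p. p \<in> D \<Longrightarrow> (\<Sum>s\<in>J'. e_hat s (sh x y p) * g s p) \<noteq> 0"
  shows "closed_shift x y"
proof -
  define E where "E p = (\<Sum>s\<in>J'. e_hat s (sh x y p) * g s p)" for p
  have reg_e: "(\<lambda>p. e_hat s (sh x y p)) \<in> reg" for s by (rule reg_sh[OF e_hat_reg wt])
  have reg_g: "g s \<in> reg" if "s \<in> J'" for s using semi[OF that] by (simp add: semired_def)
  have "\<forall>s\<in>J'. \<exists>c. (\<forall>j. c j \<in> reg) \<and> (\<forall>Y\<in>Sol. \<forall>p\<in>D. Y (tw s (sh x y p)) =
      g s p * Y (tw s0 (sh x y p)) + comb c Y p)"
    using semi unfolding semired_def by blast
  from bchoice[OF this] obtain c where c: "\<And>s j. s \<in> J' \<Longrightarrow> c s j \<in> reg"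
     "\<And>s Y p. s \<in> J' \<Longrightarrow> Y \<in> Sol \<Longrightarrow> p \<in> D \<Longrightarrow> Y (tw s (sh x y p)) =
      g s p * Y (tw s0 (sh x y p)) + comb (c s) Y p"
    by blast
  define d where "d j p = (\<Sum>s\<in>J'. e_hat s (sh x y p) * c s j p)" for j p
  have regE: "E \<in> reg" unfolding E_def by (intro reg_intros reg_e reg_g)
  have regd: "d j \<in> reg" for j unfolding d_def by (intro reg_intros reg_e c)
  have red0: "red (\<lambda>p. tw s0 (sh x y p))" unfolding red_def
  proof (intro exI[of _ "\<lambda>j p. - d j p / E p"] conjI allI ballI)
    show "(\<lambda>p. - d j p / E p) \<in> reg" for j
      by (intro reg_intros regd regE) (use nz in \<open>auto simp: E_def\<close>)
    fix Y p assume Y: "Y \<in> Sol" and p: "p \<in> D"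
    have "0 = (\<Sum>s\<in>J'. e_hat s (sh x y p) * Y (tw s (sh x y p)))"
      using Sol_E_hat[OF Y sh_D[OF p wt]] by simp
    also have "\<dots> = (\<Sum>s\<in>J'. e_hat s (sh x y p) * g s p * Y (tw s0 (sh x y p)) +
        (\<Sum>j\<in>J. e_hat s (sh x y p) * c s j p * Y (tw j p)))"
      by (rule sum.cong[OF refl]) (simp add: c(2)[OF _ Y p] distrib_left sum_distrib_left mult.assoc)
    also have "\<dots> = E p * Y (tw s0 (sh x y p)) +
        (\<Sum>s\<in>J'. \<Sum>j\<in>J. e_hat s (sh x y p) * c s j p * Y (tw j p))"
      by (simp add: sum.distrib E_def sum_distrib_right)
    also have "(\<Sum>s\<in>J'. \<Sum>j\<in>J. e_hat s (sh x y p) * c s j p * Y (tw j p)) =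
        comb d Y p"
      unfolding d_def sum_distrib_right by (rule sum.swap)
    finally have "E p * Y (tw s0 (sh x y p)) = - comb d Y p"
      by (simp add: eq_neg_iff_add_eq_0)
    then have "Y (tw s0 (sh x y p)) = - comb d Y p / E p"
      using nz[OF p] by (simp add: E_def field_simps)
    also have "\<dots> = (\<Sum>j\<in>J. - d j p / E p * Y (tw j p))"
      by (simp add: sum_divide_distrib sum_negf)
    finally show "Y (tw s0 (sh x y p)) = (\<Sum>j\<in>J. - d j p / E p * Y (tw j p))" .
  qed
  have "red (\<lambda>p. tw s (sh x y p))" if s: "s \<in> J'" for s
  proof -
    obtain e where e: "\<And>j. e j \<in> reg"
      "\<And>Y p. Y \<in> Sol \<Longrightarrow> p \<in> D \<Longrightarrow> Y (tw s0 (sh x y p)) = comb e Y p"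
      using red0 unfolding red_def by blast
    have "Y (tw s (sh x y p)) = (\<Sum>j\<in>J. (g s p * e j p + c s j p) * Y (tw j p))"
      if "Y \<in> Sol" "p \<in> D" for Y p
      unfolding c(2)[OF s that] e(2)[OF that] by (simp add: sum_distrib_left distrib_right sum.distrib mult.assoc)
    then show ?thesis unfolding red_def
      by (intro exI[of _ "\<lambda>j p. g s p * e j p + c s j p"]) (auto intro!: reg_intros e c reg_g s)
  qed
  then have "\<And>s. s \<in> {-1..-1 + int M} \<Longrightarrow> red (\<lambda>p. tw s (sh x y p))" by simp
  then have "red (\<lambda>p. tw s (sh x y p))" for s
    by (rule red_tw_all[OF wt])
  then show ?thesis using wt by (simp add: closed_shift_def)
qed

lemma reg_FF:
  assumes "wt x = wt y" "t \<in> reg"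
  shows "(\<lambda>p. Fp (sh x y p) (t p) u w) \<in> reg"
proof -
  have "(\<lambda>p. fst (sh x y p) 1) \<in> reg" "(\<lambda>p. snd (sh x y p) 1) \<in> reg"
    using reg_sh[OF reg_fst[OF I1] assms(1)] reg_sh[OF reg_snd[OF I1] assms(1)] by auto
  then show ?thesis unfolding Fp_def by (intro reg_intros assms(2))
qed

text \<open>The formal solution is taken at \<open>t = 1 / a_k\<close>, which is \<open>q\<close>
  divided by the k-th a-variable of the shifted point. There the weight of the reducible term
  vanishes, so \<open>Fp\<close> obeys the two-term recursion of the unknowns. Also
  \<open>polyA\<close> vanishes there, and \<open>E_hat\<close> gives the last unknown a nonzero
  multiple of \<open>polyB\<close> as coefficient.\<close>

lemma closed_a_inv:
  assumes k: "k \<in> K"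
  shows "closed_shift (Z(1 := -1, k := 1)) Z"
proof -
  let ?x = "Z(1 := -1, k := 1)"
  let ?s = "sh ?x Z"
  have kI: "k \<in> I" "k \<noteq> 1" using k by auto
  have wt: "wt ?x = wt Z" using wt_pm(1)[OF k, of "-1"] by simp
  define g where "g s p = Fp (?s p) (1 / fst p k) s s / Fp (?s p) (1 / fst p k) (int M) (int M)" for s p
  have nzM: "Fp (?s p) (1 / fst p k) (int M) (int M) \<noteq> 0" if p: "p \<in> D" for p
  proof -
    have "1 - snd p 1 * q powi j * (q powi 0 / fst p k) \<noteq> 0" for j by (rule ab_ne(2)[OF p kI(1) I1])
    then show ?thesis using kI by (auto simp: Fp_def)
  qed
  have a_reg: "(\<lambda>p. 1 / fst p k) \<in> reg" using kI by (intro reg_intros) (auto simp: D_nz)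
  have g_reg: "g s \<in> reg" for s
    unfolding g_def by (intro reg_intros reg_FF[OF wt a_reg]) (use nzM in auto)
  \<comment> \<open>The recursion descends from \<open>int M\<close>: each step divides by
    \<open>a_k - b_1 q^s\<close>, nonzero on \<open>D\<close>. Ascending would divide by
    \<open>a_k - a_1 q^(s-1)\<close>, which may vanish.\<close>
  have semi: "semired (\<lambda>p. tw s (?s p)) (g s) (\<lambda>p. tw (int M) (?s p))" if "-1 \<le> s" "s \<le> int M" for s
    using that(2,1)
  proof (induction s rule: int_le_induct)
    case base
    have "semired (\<lambda>p. tw (int M) (?s p)) (\<lambda>_. 1) (\<lambda>p. tw (int M) (?s p))" by (rule semired_refl)
    then show ?case using g_reg[of "int M"] nzM unfolding semired_def by (simp add: g_def)
  next
    case (step r)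
    define s where "s = r - 1"
    have s: "r = s + 1" "-1 \<le> s" "s < int M" using step by (auto simp: s_def)
    have vne: "fst p k - snd p 1 * q powi s \<noteq> 0" if "p \<in> D" for p
      using D_ne[OF that kI(1) I1, of s] by simp
    have "semired (\<lambda>p. tw s (?s p)) (g s) (\<lambda>p. tw (int M) (?s p))"
    proof (rule semired_step[of "\<lambda>p. tw (s + 1) (?s p)" "g (s + 1)" _ "\<lambda>p. fst p k - fst p 1 * q powi (s - 1)"
          "\<lambda>p. fst p k - snd p 1 * q powi s" "\<lambda>p. snd p 1 * q powi s - fst p 1 * q powi (s - 1)" _ "tw s"])
      show "semired (\<lambda>p. tw (s + 1) (?s p)) (g (s + 1)) (\<lambda>p. tw (int M) (?s p))"
        unfolding s(1)[symmetric] by (rule step.IH) (use s in auto)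
      fix p assume p: "p \<in> D"
      have e: "sh (Z(1 := 1, k := -1)) Z (tw s (?s p)) = tw s p"
        unfolding tw_def sh_sh using kI by (intro sh_cong) auto
      have f: "inverse q * fst (tw s (?s p)) k = fst p k" "fst (tw s (?s p)) 1 = fst p 1 * q powi (s - 1)"
         "snd (tw s (?s p)) 1 = snd p 1 * q powi s"
        using kI q0 by (simp_all add: fst_tw snd_tw power_int_diff power_int_minus divide_inverse mult_ac)
      show "(fst p k - snd p 1 * q powi s) * Y (tw s (?s p))
          - (fst p k - fst p 1 * q powi (s - 1)) * Y (tw (s + 1) (?s p))
          + (snd p 1 * q powi s - fst p 1 * q powi (s - 1)) * Y (tw s p) = 0" if "Y \<in> Sol" for Y
        using swap_outer[OF Sol_a[OF that tw_D[OF sh_D[OF p wt]] k, of s]] unfolding e f tw_tw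
        by (simp only: add.commute[of 1 s])
      define t where "t = 1 / fst p k"
      have t: "fst p k * t = 1" using D_nz(1)[OF p kI(1)] by (simp add: t_def)
      have 1: "Fp (?s p) t s s = (1 - fst p 1 * q powi (s - 1) * t) * Fp (?s p) t (s + 1) s"
        by (subst Fp_1) (use s q0 kI in \<open>auto simp: power_int_diff power_int_minus divide_inverse mult_ac\<close>)
      have 2: "Fp (?s p) t (s + 1) (s + 1) = (1 - snd p 1 * q powi s * t) * Fp (?s p) t (s + 1) s"
        by (subst Fp_2) (use s kI in auto)
      have "Fp (?s p) t s s * (fst p k - snd p 1 * q powi s) =
          (fst p k - fst p 1 * q powi (s - 1)) * Fp (?s p) t (s + 1) (s + 1)"
        unfolding 1 2 using t by algebra
      then show "g s p = (fst p k - fst p 1 * q powi (s - 1)) / (fst p k - snd p 1 * q powi s) * g (s + 1) p"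
        unfolding g_def t_def[symmetric] by (rule quotient_ratio[OF _ vne[OF p]])
    qed (use vne kI g_reg in \<open>auto intro!: reg_intros red_tw\<close>)
    then show ?case unfolding s_def .
  qed
  show ?thesis
  proof (rule closed_shift_inverse[OF wt])
    show "semired (\<lambda>p. tw s (?s p)) (g s) (\<lambda>p. tw (int M) (?s p))" if "s \<in> J'" for s
      using semi that by auto
    fix p assume p: "p \<in> D"
    have p': "?s p \<in> D" by (rule sh_D[OF p wt])
    let ?t = "1 / fst p k"
    have t: "?t = q / fst (?s p) k" "q / fst (?s p) k = q powi 1 / fst (?s p) k" using kI q0 by auto
    have "(\<Sum>s\<in>J'. e_hat s (?s p) * Fp (?s p) ?t s s) \<noteq> 0"
      using Fp_identity[OF p', of ?t] polyA_0[OF p' k] polyB_ne[OF p' kI(1), of 1] xfac_ne[OF p']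
         D_nz(2)[OF p' I1] q0 unfolding t by auto
    moreover have "(\<Sum>s\<in>J'. e_hat s (?s p) * g s p) =
       (\<Sum>s\<in>J'. e_hat s (?s p) * Fp (?s p) ?t s s) / Fp (?s p) ?t (int M) (int M)"
      by (simp add: g_def sum_divide_distrib)
    ultimately show "(\<Sum>s\<in>J'. e_hat s (?s p) * g s p) \<noteq> 0"
      using nzM[OF p] by simp
  qed
qed

text \<open>The mirror image, with \<open>t = q / b_k\<close>, the reciprocal of the k-th b-variable
  of the shifted point: it annihilates the weight of the reducible term and \<open>polyB\<close>,
  and \<open>polyA\<close> is what remains.\<close>

lemma closed_b_inv:
  assumes k: "k \<in> K"
  shows "closed_shift Z (Z(k := -1, 1 := 1))"
proof -
  let ?y = "Z(k := -1, 1 := 1)"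
  let ?s = "sh Z ?y"
  have kI: "k \<in> I" "k \<noteq> 1" using k by auto
  have wt: "wt Z = wt ?y" using wt_pm(2)[OF k, of "-1"] by simp
  define g where "g s p = Fp (?s p) (q / snd p k) s s / Fp (?s p) (q / snd p k) (-1) (-1)" for s p
  have nzM: "Fp (?s p) (q / snd p k) (-1) (-1) \<noteq> 0" if p: "p \<in> D" for p
  proof -
    have "1 - fst p 1 * q powi j * (q powi 1 / snd p k) \<noteq> 0" for j by (rule ab_ne(1)[OF p I1 kI(1)])
    then show ?thesis using kI by (auto simp: Fp_def)
  qed
  have a_reg: "(\<lambda>p. q / snd p k) \<in> reg" using kI by (intro reg_intros) (auto simp: D_nz)
  have g_reg: "g s \<in> reg" for s
    unfolding g_def by (intro reg_intros reg_FF[OF wt a_reg]) (use nzM in auto)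
  \<comment> \<open>Here the recursion ascends from \<open>-1\<close>, dividing by
    \<open>b_k - a_1 q^s\<close>. The opposite direction would divide by
    \<open>b_k - b_1 q^(s+1)\<close>, which may vanish.\<close>
  have semi: "semired (\<lambda>p. tw s (?s p)) (g s) (\<lambda>p. tw (-1) (?s p))" if "-1 \<le> s" "s \<le> int M" for s
    using that
  proof (induction s rule: int_ge_induct)
    case base
    have "semired (\<lambda>p. tw (-1) (?s p)) (\<lambda>_. 1) (\<lambda>p. tw (-1) (?s p))" by (rule semired_refl)
    then show ?case using g_reg[of "-1"] nzM unfolding semired_def by (simp add: g_def)
  next
    case (step r)
    define s where "s = r + 1"
    have s: "r = s - 1" "0 \<le> s" "s \<le> int M" using step by (auto simp: s_def)
    have vne: "snd p k - fst p 1 * q powi s \<noteq> 0" if "p \<in> D" for p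
    proof -
      have "1 - fst p 1 * q powi s * (q powi 0 / snd p k) \<noteq> 0" by (rule ab_ne(1)[OF that I1 kI(1)])
      then show ?thesis using D_nz(2)[OF that kI(1)] by (auto simp: field_simps)
    qed
    have "semired (\<lambda>p. tw s (?s p)) (g s) (\<lambda>p. tw (-1) (?s p))"
    proof (rule semired_step[of "\<lambda>p. tw (s - 1) (?s p)" "g (s - 1)" _ "\<lambda>p. snd p k - snd p 1 * q powi (s + 1)"
          "\<lambda>p. snd p k - fst p 1 * q powi s" "\<lambda>p. fst p 1 * q powi s - snd p 1 * q powi (s + 1)" _ "tw s"])
      show "semired (\<lambda>p. tw (s - 1) (?s p)) (g (s - 1)) (\<lambda>p. tw (-1) (?s p))"
        unfolding s(1)[symmetric] by (rule step.IH) (use s in auto)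
      fix p assume p: "p \<in> D"
      have e: "sh Z (Z(k := 1, 1 := -1)) (tw s (?s p)) = tw s p"
        unfolding tw_def sh_sh using kI by (intro sh_cong) auto
      have f: "snd (tw s (?s p)) k * q = snd p k" "fst (tw s (?s p)) 1 = fst p 1 * q powi s"
         "snd (tw s (?s p)) 1 = snd p 1 * q powi (s + 1)"
        using kI q0 by (simp_all add: fst_tw snd_tw power_int_add power_int_minus mult_ac)
      show "(snd p k - fst p 1 * q powi s) * Y (tw s (?s p))
          - (snd p k - snd p 1 * q powi (s + 1)) * Y (tw (s - 1) (?s p))
          + (fst p 1 * q powi s - snd p 1 * q powi (s + 1)) * Y (tw s p) = 0" if "Y \<in> Sol" for Y
        using swap_outer[OF Sol_b[OF that tw_D[OF sh_D[OF p wt]] k, of s]] unfolding e f tw_tw by simp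
      define t where "t = q / snd p k"
      have t: "snd p k * t = q" using D_nz(2)[OF p kI(1)] by (simp add: t_def)
      have 1: "Fp (?s p) t (s - 1) (s - 1) = (1 - fst p 1 * q powi (s - 1) * t) * Fp (?s p) t s (s - 1)"
        by (subst Fp_1) (use s kI in auto)
      have "Fp (?s p) t s (s - 1 + 1) = (1 - snd p 1 * q powi s * t) * Fp (?s p) t s (s - 1)"
        by (subst Fp_2) (use s kI q0 in \<open>auto simp: power_int_diff\<close>)
      then have 2: "Fp (?s p) t s s = (1 - snd p 1 * q powi s * t) * Fp (?s p) t s (s - 1)" by simp
      have qs: "q powi s = q powi (s - 1) * q" "q powi (s + 1) = q powi s * q" using q0 by (simp_all add: power_int_diff power_int_add)
      have "Fp (?s p) t s s * (snd p k - fst p 1 * q powi s) =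
          (snd p k - snd p 1 * q powi (s + 1)) * Fp (?s p) t (s - 1) (s - 1)"
        unfolding 1 2 qs(2) unfolding qs(1) by (rule cross_ratio[OF t])
      then show "g s p = (snd p k - snd p 1 * q powi (s + 1)) / (snd p k - fst p 1 * q powi s) * g (s - 1) p"
        unfolding g_def t_def[symmetric] by (rule quotient_ratio[OF _ vne[OF p]])
    qed (use vne kI g_reg in \<open>auto intro!: reg_intros red_tw\<close>)
    then show ?case unfolding s_def .
  qed
  show ?thesis
  proof (rule closed_shift_inverse[OF wt])
    show "semired (\<lambda>p. tw s (?s p)) (g s) (\<lambda>p. tw (-1) (?s p))" if "s \<in> J'" for s
      using semi that by auto
    fix p assume p: "p \<in> D"
    have p': "?s p \<in> D" by (rule sh_D[OF p wt])
    let ?t = "q / snd p k"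
    have t: "?t = 1 / snd (?s p) k" "1 / snd (?s p) k = q powi 0 / snd (?s p) k"
      using kI q0 D_nz(2)[OF p kI(1)] by (auto simp: power_int_minus field_simps)
    have "(\<Sum>s\<in>J'. e_hat s (?s p) * Fp (?s p) ?t s s) \<noteq> 0"
      using Fp_identity[OF p', of ?t] polyB_0[OF p' k] polyA_ne[OF p' kI(1), of 0] xfac_ne[OF p']
         D_nz(2)[OF p' I1] q0 unfolding t by auto
    moreover have "(\<Sum>s\<in>J'. e_hat s (?s p) * g s p) =
       (\<Sum>s\<in>J'. e_hat s (?s p) * Fp (?s p) ?t s s) / Fp (?s p) ?t (-1) (-1)"
      by (simp add: g_def sum_divide_distrib)
    ultimately show "(\<Sum>s\<in>J'. e_hat s (?s p) * g s p) \<noteq> 0"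
      using nzM[OF p] by simp
  qed
qed

text \<open>Powers of these, of \<open>gb\<close> and of \<open>T\<close> generate all admissible
  shifts. The trivial value at \<open>k = 1\<close> spares a separate treatment of the index
  1.\<close>

definition ga :: "nat \<Rightarrow> nat \<Rightarrow> int" where "ga k = (if k = 1 then Z else Z(1 := 1, k := -1))"
definition gb :: "nat \<Rightarrow> nat \<Rightarrow> int" where "gb k = (if k = 1 then Z else Z(k := 1, 1 := -1))"

lemma closed_ga: "k \<in> I \<Longrightarrow> closed_shift (\<lambda>j. i * ga k j) Z"
proof -
  assume k: "k \<in> I"
  have "closed_shift (\<lambda>j. i * ga k j) (\<lambda>j. i * Z j)"
  proof (rule closed_shift_scale)
    show "closed_shift (ga k) Z"
      using k closed_a[of k] closed_shift_0 by (auto simp: ga_def)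
    show "closed_shift (\<lambda>j. - ga k j) (\<lambda>j. - Z j)"
    proof (cases "k = 1")
      case False
      show ?thesis
        by (rule closed_shift_cong[OF _ _ closed_a_inv[of k]]) (use k False in \<open>auto simp: ga_def\<close>)
    qed (use closed_shift_0 in \<open>simp add: ga_def\<close>)
  qed
  then show ?thesis by simp
qed

lemma closed_gb: "k \<in> I \<Longrightarrow> closed_shift Z (\<lambda>j. i * gb k j)"
proof -
  assume k: "k \<in> I"
  have "closed_shift (\<lambda>j. i * Z j) (\<lambda>j. i * gb k j)"
  proof (rule closed_shift_scale)
    show "closed_shift Z (gb k)"
      using k closed_b[of k] closed_shift_0 by (auto simp: gb_def)
    show "closed_shift (\<lambda>j. - Z j) (\<lambda>j. - gb k j)"
    proof (cases "k = 1")
      case False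
      show ?thesis
        by (rule closed_shift_cong[OF _ _ closed_b_inv[of k]]) (use k False in \<open>auto simp: gb_def\<close>)
    qed (use closed_shift_0 in \<open>simp add: gb_def\<close>)
  qed
  then show ?thesis by simp
qed

lemma closed_shift_red: "closed_shift x y \<Longrightarrow> red (sh x y)"
proof -
  assume "closed_shift x y"
  then have "red (\<lambda>p. tw 0 (sh x y p))" unfolding closed_shift_def by blast
  then show ?thesis by simp
qed

lemma shift_powers_red:
  assumes "A \<in> rp_shift_powers q M"
  obtains \<mu> where "red \<mu>" "\<And>Y p. A Y p = Y (\<mu> p)"
proof -
  consider k l i where "k \<in> I" "l \<in> I" "k \<noteq> l" "A = Ta q k i \<circ> Ta q l (- i)"
    | k l i where "k \<in> I" "l \<in> I" "k \<noteq> l" "A = Tb q k i \<circ> Tb q l (- i)"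
    | k l i where "k \<in> I" "l \<in> I" "A = Ta q k i \<circ> Tb q l i"
    using assms unfolding rp_shift_powers_def by blast
  then show thesis
  proof cases
    case 1
    have "closed_shift (\<lambda>j. i * ga l j + (- i) * ga k j) (\<lambda>j. Z j + Z j)"
      using 1 by (intro closed_shift_add closed_ga)
    then have *: "closed_shift (Z(k := i, l := - i)) Z"
      by (rule closed_shift_cong[rotated 2]) (use 1 in \<open>auto simp: ga_def\<close>)
    show thesis by (rule that[OF closed_shift_red[OF *]]) (simp only: 1(4) Taa_sh[OF 1(1-3)])
  next
    case 2
    have "closed_shift (\<lambda>j. Z j + Z j) (\<lambda>j. i * gb k j + (- i) * gb l j)"
      using 2 by (intro closed_shift_add closed_gb)
    then have *: "closed_shift Z (Z(k := i, l := - i))"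
      by (rule closed_shift_cong[rotated 2]) (use 2 in \<open>auto simp: gb_def\<close>)
    show thesis by (rule that[OF closed_shift_red[OF *]]) (simp only: 2(4) Tbb_sh[OF 2(1-3)])
  next
    case 3
    have "closed_shift (\<lambda>j. (Z(1 := i)) j + ((- i) * ga k j + Z j)) (\<lambda>j. (Z(1 := i)) j + (Z j + i * gb l j))"
      using 3 by (intro closed_shift_add closed_ga closed_gb closed_tw)
    then have *: "closed_shift (Z(k := i)) (Z(l := i))"
      by (rule closed_shift_cong[rotated 2]) (use 3 in \<open>auto simp: ga_def gb_def\<close>)
    show thesis by (rule that[OF closed_shift_red[OF *]]) (simp only: 3(3) Tab_sh[OF 3(1-2)])
  qed
qed

end

section \<open>Linear independence of the powers of T\<close>

text \<open>Coordinates are fixed one at a time, the highest first. Along the coordinate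
  \<open>n\<close> through its witness, each \<open>g\<close> is an entire function that is not
  identically zero, so it has countably many zeros. Countably many such sets leave a value of that
  coordinate which is suitable for all \<open>g\<close> at once.\<close>

lemma common_nonzero_point:
  fixes G :: "((nat \<Rightarrow> complex) \<Rightarrow> complex) set"
  assumes "countable G" "\<And>g x i. g \<in> G \<Longrightarrow> (\<lambda>z. g (x(i := z))) holomorphic_on UNIV"
    and "\<And>g. g \<in> G \<Longrightarrow> \<exists>x. (\<forall>i\<ge>n. x i = x0 i) \<and> g x \<noteq> 0"
  shows "\<exists>x. (\<forall>i\<ge>n. x i = x0 i) \<and> (\<forall>g\<in>G. g x \<noteq> 0)"
  using assms(3)
proof (induction n arbitrary: x0)
  case 0
  have "g x0 \<noteq> 0" if g: "g \<in> G" for g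
  proof -
    obtain x where "\<forall>i. x i = x0 i" "g x \<noteq> 0" using 0[OF g] by auto
    then show ?thesis by (metis ext)
  qed
  then show ?case by auto
next
  case (Suc n)
  from bchoice[of G "\<lambda>g x. (\<forall>i\<ge>Suc n. x i = x0 i) \<and> g x \<noteq> 0"] Suc.prems
  obtain X where X: "\<forall>g\<in>G. (\<forall>i\<ge>Suc n. X g i = x0 i) \<and> g (X g) \<noteq> 0" by blast
  define Z where "Z g = {z. g ((X g)(n := z)) = 0}" for g
  have "countable (Z g)" if g: "g \<in> G" for g
  proof (rule ccontr)
    assume "uncountable (Z g)"
    then have "(\<lambda>z. g ((X g)(n := z))) = (\<lambda>_. 0)"
      by (intro holomorphic_countable_equal_UNIV assms(2)[OF g]) (auto simp: Z_def)
    then have "g ((X g)(n := X g n)) = 0" by metis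
    then show False using X g by simp
  qed
  then have "countable (\<Union>g\<in>G. Z g)" using assms(1) by auto
  then obtain z where z: "z \<notin> (\<Union>g\<in>G. Z g)"
    using uncountable_UNIV_complex by (metis UNIV_eq_I)
  have "\<exists>x. (\<forall>i\<ge>n. x i = (x0(n := z)) i) \<and> g x \<noteq> 0" if g: "g \<in> G" for g
    using X g z by (intro exI[of _ "(X g)(n := z)"]) (auto simp: Z_def)
  from Suc.IH[OF this] obtain x where x: "\<forall>i\<ge>n. x i = (x0(n := z)) i" "\<forall>g\<in>G. g x \<noteq> 0" by blast
  then show ?case by (intro exI[of _ x]) auto
qed

lemma linear_dvd_root:
  fixes c :: complex
  assumes "c \<noteq> 0" "poly V (1 / c) = 0"
  obtains V' where "V = [:1, - c:] * V'" "degree V' \<le> degree V - 1"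
proof -
  have "[:- (1 / c), 1:] dvd V" using assms by (simp add: poly_eq_0_iff_dvd)
  moreover have lin: "[:1, - c:] = smult (- c) [:- (1 / c), 1:]" using assms by simp
  ultimately have "[:1, - c:] dvd V"
    by (metis assms(1) neg_equal_0_iff_equal smult_dvd)
  then obtain V' where V': "V = [:1, - c:] * V'" by (elim dvdE)
  have "degree V' \<le> degree V - 1"
  proof (cases "V' = 0")
    case False
    have "degree V = degree [:1, - c:] + degree V'"
      unfolding V' by (rule degree_mult_eq) (use False in auto)
    also have "degree [:1, - c:] = 1" using assms by simp
    finally show ?thesis by simp
  qed simp
  with V' show thesis by (rule that)
qed

text \<open>The linear factors are split off one by one, so coinciding \<open>\<alpha> j\<close> are
  counted with multiplicity. This matters because several \<open>a_k q^(x k)\<close> may be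
  equal.\<close>

lemma prod_linear_dvd:
  fixes \<alpha> :: "'a \<Rightarrow> complex"
  assumes "finite J" "(\<Prod>j\<in>J. [:1, - \<alpha> j:]) dvd V * B"
    and "\<And>j. j \<in> J \<Longrightarrow> \<alpha> j \<noteq> 0 \<and> poly B (1 / \<alpha> j) \<noteq> 0"
  shows "(\<Prod>j\<in>J. [:1, - \<alpha> j:]) dvd V"
  using assms
proof (induction J arbitrary: V rule: finite_induct)
  case (insert j J)
  have a: "\<alpha> j \<noteq> 0" "poly B (1 / \<alpha> j) \<noteq> 0" using insert.prems by auto
  have P: "(\<Prod>j\<in>insert j J. [:1, - \<alpha> j:]) = [:1, - \<alpha> j:] * (\<Prod>j\<in>J. [:1, - \<alpha> j:])"
    using insert.hyps by simp
  have "[:1, - \<alpha> j:] dvd V * B" using insert.prems(1) unfolding P by (rule dvd_mult_left)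
  then obtain k where "V * B = [:1, - \<alpha> j:] * k" by (elim dvdE)
  then have "poly V (1 / \<alpha> j) * poly B (1 / \<alpha> j) = poly [:1, - \<alpha> j:] (1 / \<alpha> j) * poly k (1 / \<alpha> j)"
    by (simp only: flip: poly_mult)
  then have "poly V (1 / \<alpha> j) = 0" using a by simp
  then obtain V' where V': "V = [:1, - \<alpha> j:] * V'" using linear_dvd_root[OF a(1)] by blast
  have "(\<Prod>j\<in>J. [:1, - \<alpha> j:]) dvd V' * B"
    using insert.prems(1) unfolding P V' mult.assoc by (subst (asm) dvd_mult_cancel_left) auto
  then have "(\<Prod>j\<in>J. [:1, - \<alpha> j:]) dvd V'" using insert by blast
  then show ?case unfolding P V' by (rule mult_dvd_mono[OF dvd_refl])
qed auto

text \<open>A basis of \<open>U\<close> stays independent when \<open>w\<close> is added, so a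
  linear map can be prescribed on both and extended to all functions. The result is purely
  algebraic, which suffices because solutions are arbitrary functions.\<close>

lemma separating_functional:
  fixes U :: "(complex \<Rightarrow> complex) set"
  assumes "(\<lambda>_. 0) \<in> U" "\<And>c f g. f \<in> U \<Longrightarrow> g \<in> U \<Longrightarrow> (\<lambda>t. c * f t + g t) \<in> U" "w \<notin> U"
  obtains L where "lin_on UNIV L" "\<And>u. u \<in> U \<Longrightarrow> L u = 0" "L w = 1"
proof -
  define sc where "sc c f = (\<lambda>t. c * f t)" for c :: complex and f :: "complex \<Rightarrow> complex"
  interpret V: vector_space sc
    by unfold_locales (auto simp: sc_def fun_eq_iff algebra_simps)
  interpret C: vector_space "(*) :: complex \<Rightarrow> complex \<Rightarrow> complex"
    by unfold_locales (auto simp: algebra_simps)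
  interpret P: vector_space_pair sc "(*) :: complex \<Rightarrow> complex \<Rightarrow> complex" ..
  have "V.subspace U"
  proof (rule V.subspaceI)
    show "0 \<in> U" using assms(1) by (simp add: zero_fun_def)
    show "f + g \<in> U" if "f \<in> U" "g \<in> U" for f g
      using assms(2)[OF that, of 1] by (simp add: plus_fun_def)
    show "sc c f \<in> U" if "f \<in> U" for c f
      using assms(2)[OF that assms(1), of c] by (simp add: sc_def)
  qed
  obtain B where B: "B \<subseteq> U" "V.independent B" "U \<subseteq> V.span B"
    by (rule V.maximal_independent_subset)
  have "V.span B \<subseteq> U" by (rule V.span_minimal[OF B(1) \<open>V.subspace U\<close>])
  then have w: "w \<notin> V.span B" using assms(3) by auto
  then have "V.independent (insert w B)" by (rule V.independent_insertI[OF _ B(2)])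
  from P.linear_independent_extend[OF this, of "\<lambda>x. if x = w then 1 else 0"]
  obtain L where L: "Vector_Spaces.linear sc (*) L" "\<forall>x\<in>insert w B. L x = (if x = w then 1 else 0)"
    by blast
  interpret L: Vector_Spaces.linear sc "(*)" L by fact
  have "L x = 0" if "x \<in> B" for x
  proof -
    have "x \<noteq> w" using that w V.span_base by blast
    then show ?thesis using L(2) that by simp
  qed
  then have "L u = 0" if "u \<in> V.span B" for u
    using that by (rule L.eq_0_on_span)
  moreover have "lin_on UNIV L"
  proof -
    have "L (\<lambda>t. c * f t + g t) = c * L f + L g" for c f g
    proof -
      have "(\<lambda>t. c * f t + g t) = sc c f + g" by (simp add: sc_def plus_fun_def)
      then show ?thesis by (simp add: L.add L.scale)
    qed
    then show ?thesis by (simp add: lin_on_def)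
  qed
  moreover have "L w = 1" using L(2) by simp
  ultimately show thesis using that B(3) by blast
qed

section \<open>Exponential coordinates and generic points\<close>

context q_rp
begin

text \<open>Exponential coordinates on the variety of the relation. The coordinates 1 to M + 3 give
  the a's and M + 4 to 2M + 5 give \<open>b_1\<close> to \<open>b_(M+2)\<close>; the last b is
  determined by the relation. All entries are entire in each coordinate, so zero sets can be treated
  one complex variable at a time.\<close>

definition Pexp :: "(nat \<Rightarrow> complex) \<Rightarrow> params" where
  "Pexp x = ((\<lambda>k. if k \<in> I then exp (x k) else undefined),
     (\<lambda>k. if k \<in> {1..M+2} then exp (x (M+3+k))
          else if k = M+3 then exp ((\<Sum>j\<in>I. x j) - (\<Sum>j\<in>{1..M+2}. x (M+3+j))) / q^2 else undefined))"

lemma I_last: "I = insert (M+3) {1..M+2}" by auto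

lemma Pexp_prod: "prod (fst (Pexp x)) I = q^2 * prod (snd (Pexp x)) I"
proof -
  have a: "prod (fst (Pexp x)) I = exp (\<Sum>j\<in>I. x j)"
  proof -
    have "prod (fst (Pexp x)) I = (\<Prod>j\<in>I. exp (x j))" by (rule prod.cong) (auto simp: Pexp_def)
    then show ?thesis by (simp add: exp_sum del: prod.cl_ivl_Suc sum.cl_ivl_Suc)
  qed
  have "prod (snd (Pexp x)) {1..M+2} = (\<Prod>j\<in>{1..M+2}. exp (x (M+3+j)))"
    by (rule prod.cong) (auto simp: Pexp_def)
  also have "\<dots> = exp (\<Sum>j\<in>{1..M+2}. x (M+3+j))" by (subst exp_sum) auto
  finally have b: "prod (snd (Pexp x)) {1..M+2} = exp (\<Sum>j\<in>{1..M+2}. x (M+3+j))" .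
  have c: "snd (Pexp x) (M+3) = exp ((\<Sum>j\<in>I. x j) - (\<Sum>j\<in>{1..M+2}. x (M+3+j))) / q^2"
    by (auto simp: Pexp_def)
  have "prod (snd (Pexp x)) I = snd (Pexp x) (M+3) * prod (snd (Pexp x)) {1..M+2}"
    unfolding I_last by (subst prod.insert) auto
  then show ?thesis unfolding a b c using q0 by (simp add: exp_diff del: prod.cl_ivl_Suc sum.cl_ivl_Suc)
qed

lemma Pexp_carrier: "fst (Pexp x) \<in> I \<rightarrow>\<^sub>E - {0}" "snd (Pexp x) \<in> I \<rightarrow>\<^sub>E - {0}"
  using q0 by (auto simp: Pexp_def PiE_iff extensional_def)

lemma D_Pexp:
  assumes p: "p \<in> D"
  obtains x where "Pexp x = p" "\<forall>i\<ge>2*M+6. x i = 0"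
proof -
  define x where "x i = (if i \<in> I then Ln (fst p i) else if i \<in> {M+4..2*M+5} then Ln (snd p (i - (M+3))) else 0)" for i
  have a: "fst (Pexp x) = fst p"
  proof
    fix k
    show "fst (Pexp x) k = fst p k"
    proof (cases "k \<in> I")
      case True
      then show ?thesis using D_nz(1)[OF p True] by (simp add: Pexp_def x_def exp_Ln)
    next
      case False
      moreover have "fst p k = undefined" using p False by (auto simp: D_iff PiE_iff extensional_def)
      ultimately show ?thesis by (auto simp: Pexp_def)
    qed
  qed
  have b: "snd (Pexp x) k = snd p k" if k: "k \<in> {1..M+2}" for k
  proof -
    have "x (M+3+k) = Ln (snd p k)" using k by (auto simp: x_def)
    then show ?thesis using k D_nz(2)[OF p, of k] by (auto simp: Pexp_def exp_Ln)
  qed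
  have nz: "prod (snd p) {1..M+2} \<noteq> 0" using D_nz(2)[OF p] by simp
  have "prod (snd (Pexp x)) I = prod (snd p) I"
    using Pexp_prod[of x] D_prod[OF p] q0 unfolding a by simp
  then have "snd (Pexp x) (M+3) * prod (snd (Pexp x)) {1..M+2} = snd p (M+3) * prod (snd p) {1..M+2}"
    unfolding I_last by (subst (asm) (1 2) prod.insert) auto
  moreover have "prod (snd (Pexp x)) {1..M+2} = prod (snd p) {1..M+2}"
    by (rule prod.cong) (use b in auto)
  ultimately have c: "snd (Pexp x) (M+3) = snd p (M+3)" using nz by simp
  have "snd (Pexp x) k = snd p k" for k
  proof (cases "k \<in> I")
    case True
    then consider "k \<in> {1..M+2}" | "k = M+3" unfolding I_last by blast
    then show ?thesis using b c by cases auto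
  next
    case False
    moreover have "snd p k = undefined" using p False by (auto simp: D_iff PiE_iff extensional_def)
    ultimately show ?thesis by (auto simp: Pexp_def)
  qed
  then have "Pexp x = p" using a by (auto simp: prod_eq_iff)
  moreover have "\<forall>i\<ge>2*M+6. x i = 0" by (auto simp: x_def)
  ultimately show thesis by (rule that)
qed

lemma holomorphic_upd: "(\<lambda>z. (x(i := z)) k) holomorphic_on UNIV"
  by (cases "k = i") auto

lemma holomorphic_Pexp_coord:
  assumes "k \<in> I"
  shows "(\<lambda>z. fst (Pexp (x(i := z))) k) holomorphic_on UNIV"
    and "(\<lambda>z. snd (Pexp (x(i := z))) k) holomorphic_on UNIV"
proof -
  have "(\<lambda>z. exp ((x(i := z)) k)) holomorphic_on UNIV"
    by (intro holomorphic_intros holomorphic_upd)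
  then show "(\<lambda>z. fst (Pexp (x(i := z))) k) holomorphic_on UNIV" using assms by (simp add: Pexp_def)
  show "(\<lambda>z. snd (Pexp (x(i := z))) k) holomorphic_on UNIV"
  proof (cases "k = M+3")
    case True
    have "(\<lambda>z. exp ((\<Sum>j\<in>I. (x(i := z)) j) - (\<Sum>j\<in>{1..M+2}. (x(i := z)) (M+3+j))) / q^2) holomorphic_on UNIV"
      by (intro holomorphic_intros holomorphic_upd) (use q0 in auto)
    moreover have "snd (Pexp y) k = exp ((\<Sum>j\<in>I. y j) - (\<Sum>j\<in>{1..M+2}. y (M+3+j))) / q^2" for y
      using True by (simp add: Pexp_def del: sum.cl_ivl_Suc)
    ultimately show ?thesis by (simp del: sum.cl_ivl_Suc)
  next
    case False
    have "(\<lambda>z. exp ((x(i := z)) (M+3+k))) holomorphic_on UNIV"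
      by (intro holomorphic_intros holomorphic_upd)
    moreover have "snd (Pexp y) k = exp (y (M+3+k))" for y
      using False assms by (simp add: Pexp_def del: sum.cl_ivl_Suc)
    ultimately show ?thesis by simp
  qed
qed

lemma holomorphic_poly_Pexp:
  assumes "f \<in> polys"
  shows "(\<lambda>z. f (Pexp (x(i := z)))) holomorphic_on UNIV"
  using assms
proof (induction rule: polyfuns.induct)
  case (coord f)
  then obtain k where k: "k \<in> I" "f = (\<lambda>(a, b). a k) \<or> f = (\<lambda>(a, b). b k)"
    unfolding rp_coords_def by blast
  then have "f = (\<lambda>p. fst p k) \<or> f = (\<lambda>p. snd p k)" by (auto simp: split_beta)
  then show ?case using holomorphic_Pexp_coord[OF k(1), of x i] by (elim disjE) (simp_all only:)
qed (auto intro: holomorphic_intros)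

text \<open>The origin is compared with the unit vector \<open>j\<close>, chosen such that exactly
  one of \<open>a_i\<close> and \<open>b_k\<close> changes, namely by the factor
  \<open>exp 1\<close>. As \<open>b_(M+3)\<close> depends on all coordinates, \<open>j\<close> must
  avoid \<open>i\<close> in that case.\<close>

lemma Pexp_generic_ne:
  assumes ik: "i \<in> I" "k \<in> I"
  shows "\<exists>x. (\<forall>j\<ge>2*M+6. x j = 0) \<and> fst (Pexp x) i \<noteq> snd (Pexp x) k * q powi n"
proof (rule ccontr)
  assume "\<not> ?thesis"
  then have E: "fst (Pexp x) i = snd (Pexp x) k * q powi n" if "\<forall>j\<ge>2*M+6. x j = 0" for x
    using that by blast
  define j where "j = (if k = M+3 then (if i = 1 then 2 else 1) else i)"
  have j: "j \<in> I" "k = M+3 \<longrightarrow> j \<noteq> i" "k \<noteq> M+3 \<longrightarrow> j = i" using ik by (auto simp: j_def)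
  let ?x = "(\<lambda>_. 0)(j := 1) :: nat \<Rightarrow> complex"
  have e: "exp (1 :: complex) \<noteq> 1"
    by (metis exp_eq_1 Re_complex_of_real one_complex.simps(1) zero_neq_one)
  have sx: "(\<Sum>l\<in>I. ?x l) = 1"
  proof -
    have "(\<Sum>l\<in>I. ?x l) = (\<Sum>l\<in>I. if l = j then 1 else 0)" by (rule sum.cong) auto
    then show ?thesis using j(1) by (subst (asm) sum.delta) auto
  qed
  have sy: "(\<Sum>l\<in>{1..M+2}. ?x (M+3+l)) = 0"
    by (rule sum.neutral) (use j(1) in auto)
  have 0: "fst (Pexp (\<lambda>_. 0)) i = snd (Pexp (\<lambda>_. 0)) k * q powi n" by (rule E) auto
  have 1: "fst (Pexp ?x) i = snd (Pexp ?x) k * q powi n" by (rule E) (use j(1) in auto)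
  show False
  proof (cases "k = M+3")
    case True
    have "fst (Pexp ?x) i = 1" "fst (Pexp (\<lambda>_. 0)) i = 1" using ik j True by (auto simp: Pexp_def)
    moreover have "snd (Pexp ?x) k = exp 1 / q^2"
      using True sx sy by (simp add: Pexp_def del: sum.cl_ivl_Suc fun_upd_apply)
    moreover have "snd (Pexp (\<lambda>_. 0)) k = 1 / q^2"
      using True by (simp add: Pexp_def del: sum.cl_ivl_Suc)
    ultimately show False using 0 1 e q0 by (auto simp: field_simps)
  next
    case False
    then have "snd (Pexp ?x) k = 1" "snd (Pexp (\<lambda>_. 0)) k = 1" using ik j by (auto simp: Pexp_def)
    moreover have "fst (Pexp ?x) i = exp 1" "fst (Pexp (\<lambda>_. 0)) i = 1"
      using False ik j by (auto simp: Pexp_def)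
    ultimately show False using 0 1 e by auto
  qed
qed

text \<open>A point \<open>Pexp x\<close> satisfies the relation but may lie outside
  \<open>D\<close>. Adding the countably many differences \<open>a_i - b_k q^n\<close> to
  \<open>H\<close> puts it into \<open>D\<close>.\<close>

lemma generic_point:
  assumes "countable H" "H \<subseteq> polys" "\<And>h. h \<in> H \<Longrightarrow> \<exists>p\<in>D. h p \<noteq> 0"
  obtains p where "p \<in> D" "\<And>h. h \<in> H \<Longrightarrow> h p \<noteq> 0"
proof -
  define d where "d = (\<lambda>(i, k, n) (p :: params). fst p i - snd p k * q powi n :: complex)"
  define H' where "H' = H \<union> d ` (I \<times> I \<times> (UNIV :: int set))"
  have H': "h \<in> polys" "\<exists>x. (\<forall>i\<ge>2*M+6. x i = 0) \<and> h (Pexp x) \<noteq> 0" if "h \<in> H'" for h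
  proof -
    from that consider "h \<in> H" | i k n where "i \<in> I" "k \<in> I" "h = d (i, k, n)" by (auto simp: H'_def)
    then have "h \<in> polys \<and> (\<exists>x. (\<forall>i\<ge>2*M+6. x i = 0) \<and> h (Pexp x) \<noteq> 0)"
    proof cases
      case 1
      then obtain p where "p \<in> D" "h p \<noteq> 0" using assms(3) by blast
      then show ?thesis using 1 assms(2) D_Pexp[of p] by (metis subsetD)
    next
      case 2
      have h: "h = (\<lambda>p. fst p i + (- (q powi n)) * snd p k)" unfolding 2 d_def by auto
      have "h \<in> polys"
        unfolding h by (intro polyfuns.add polyfuns.mult polyfuns.const poly_fst poly_snd 2)
      then show ?thesis using Pexp_generic_ne[OF 2(1,2), of n] by (simp add: 2(3) d_def)
    qed
    then show "h \<in> polys" "\<exists>x. (\<forall>i\<ge>2*M+6. x i = 0) \<and> h (Pexp x) \<noteq> 0" by auto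
  qed
  have "countable H'" unfolding H'_def using assms(1) by auto
  then have "\<exists>x. (\<forall>i\<ge>2*M+6. x i = (\<lambda>_. 0) i) \<and> (\<forall>g\<in>(\<lambda>h x. h (Pexp x)) ` H'. g x \<noteq> 0)"
    by (intro common_nonzero_point) (use H' holomorphic_poly_Pexp in auto)
  then obtain x where x: "\<And>h. h \<in> H' \<Longrightarrow> h (Pexp x) \<noteq> 0" by auto
  have "Pexp x \<in> D" unfolding D_iff
  proof (intro conjI ballI allI)
    fix i k n assume "i \<in> I" "k \<in> I"
    then have "d (i, k, n) \<in> H'" by (auto simp: H'_def)
    from x[OF this] show "fst (Pexp x) i \<noteq> snd (Pexp x) k * q powi n" by (simp add: d_def)
  qed (use Pexp_prod Pexp_carrier in auto)
  then show thesis using that x by (auto simp: H'_def)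
qed

text \<open>Here the numerators of all shifted weights are nonzero as well, so weights can be
  cancelled from equations. Only countably many \<open>t\<close> are excluded.\<close>

definition tpts :: "params \<Rightarrow> complex set" where
  "tpts p = {t \<in> good p. \<forall>k\<in>I. \<forall>n::int. fst p k * t * q powi n \<noteq> 1}"

lemma tpts_good: "tpts p \<subseteq> good p" by (auto simp: tpts_def)

lemma tpts_q: "t \<in> tpts p \<Longrightarrow> q * t \<in> tpts p"
proof -
  assume t: "t \<in> tpts p"
  have "fst p k * (q * t) * q powi n \<noteq> 1" if "k \<in> I" for k n
  proof -
    have e: "fst p k * (q * t) * q powi n = fst p k * t * q powi (1 + n)"
      using q0 by (simp add: power_int_add mult_ac)
    show ?thesis unfolding e using t that by (simp add: tpts_def)
  qed
  then show ?thesis using t good_q[of t p 1] by (simp add: tpts_def)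
qed

lemma infinite_tpts: "infinite (tpts p)"
proof
  assume fin: "finite (tpts p)"
  let ?A = "insert 0 (\<Union>k\<in>I. \<Union>n. {1 / (fst p k * q powi n), 1 / (snd p k * q powi n)})"
  have "t = 1 / (c * q powi n)" if "c * t * q powi n = 1" for c t n
    using that by (cases "c * q powi n = 0") (auto simp: field_simps)
  then have "- tpts p \<subseteq> ?A" by (fastforce simp: tpts_def good_def)
  moreover have "countable ?A" by auto
  ultimately have "countable (- tpts p)" using countable_subset by blast
  then have "countable (- tpts p \<union> tpts p)" using fin countable_finite by blast
  then show False using uncountable_UNIV_complex by simp
qed

lemma W_tpts_nz:
  assumes "t \<in> tpts p"
  shows "W (sh x y p) t \<noteq> 0"
proof -
  have b: "qpoch_inf q (snd (sh x y p) k * t) \<noteq> 0" if "k \<in> I" for k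
    using good_nz[of t "sh x y p" k] that assms tpts_good good_sh[of x y p] by blast
  have a: "qpoch_inf q (fst (sh x y p) k * t) \<noteq> 0" if k: "k \<in> I" for k
  proof
    assume "qpoch_inf q (fst (sh x y p) k * t) = 0"
    then obtain n where "fst (sh x y p) k * t * q ^ n = 1" using qpoch_inf_eq_0_iff[OF q_less] by blast
    then have "fst p k * t * q powi (x k + int n) = 1" using k q0 by (simp add: power_int_add mult_ac)
    then show False using assms k by (auto simp: tpts_def)
  qed
  show ?thesis unfolding W_def using a b by auto
qed

section \<open>Polynomial quotients of weights and admissible primitives\<close>

definition ratio_poly :: "params \<Rightarrow> (nat \<Rightarrow> int) \<Rightarrow> (nat \<Rightarrow> int) \<Rightarrow> (nat \<Rightarrow> int) \<Rightarrow> (nat \<Rightarrow> int) \<Rightarrow> complex poly" where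
  "ratio_poly p x' y' x y = (\<Prod>k\<in>I. (\<Prod>j\<in>{x' k..<x k}. [:1, - (fst p k * q powi j):]) *
           (\<Prod>j\<in>{y k..<y' k}. [:1, - (snd p k * q powi j):]))"

lemma poly_pr: "poly (ratio_poly p x' y' x y) t = (\<Prod>k\<in>I. (\<Prod>j\<in>{x' k..<x k}. 1 - fst p k * q powi j * t) *
           (\<Prod>j\<in>{y k..<y' k}. 1 - snd p k * q powi j * t))"
  by (simp add: ratio_poly_def poly_prod mult_ac)

lemma W_pr:
  assumes "\<And>k. k \<in> I \<Longrightarrow> x' k \<le> x k" "\<And>k. k \<in> I \<Longrightarrow> y k \<le> y' k" "t \<in> good p"
  shows "W (sh x' y' p) t = W (sh x y p) t * poly (ratio_poly p x' y' x y) t"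
  using W_ratio[OF assms] by (simp add: poly_pr mult.commute)

lemma degree_prod_le_sum:
  "finite A \<Longrightarrow> (\<And>i. i \<in> A \<Longrightarrow> int (degree (f i)) \<le> d i) \<Longrightarrow> int (degree (\<Prod>i\<in>A. f i)) \<le> sum d A"
proof (induction A rule: finite_induct)
  case (insert i A)
  have "int (degree (\<Prod>i\<in>insert i A. f i)) \<le> int (degree (f i) + degree (\<Prod>i\<in>A. f i))"
    using degree_mult_le[of "f i" "\<Prod>i\<in>A. f i"] insert.hyps by simp
  also have "\<dots> \<le> d i + sum d A" using insert by (auto intro: add_mono)
  finally show ?case using insert.hyps by simp
qed simp

lemma degree_pr:
  assumes "\<And>k. k \<in> I \<Longrightarrow> x' k \<le> x k" "\<And>k. k \<in> I \<Longrightarrow> y k \<le> y' k"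
  shows "int (degree (ratio_poly p x' y' x y)) \<le> wt x - wt x' + (wt y' - wt y)"
proof -
  have lin: "int (degree (\<Prod>j\<in>{m..<n}. [:1, - (c * q powi j):])) \<le> n - m" if "m \<le> n" for c m n
  proof -
    have "int (degree (\<Prod>j\<in>{m..<n}. [:1, - (c * q powi j):])) \<le> sum (\<lambda>_. 1) {m..<n}"
      by (rule degree_prod_le_sum) auto
    then show ?thesis using that by simp
  qed
  have "int (degree (ratio_poly p x' y' x y)) \<le> sum (\<lambda>k. (x k - x' k) + (y' k - y k)) I"
    unfolding ratio_poly_def
  proof (rule degree_prod_le_sum)
    fix k assume k: "k \<in> I"
    let ?A = "\<Prod>j\<in>{x' k..<x k}. [:1, - (fst p k * q powi j):]"
    let ?B = "\<Prod>j\<in>{y k..<y' k}. [:1, - (snd p k * q powi j):]"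
    have "int (degree (?A * ?B)) \<le> int (degree ?A) + int (degree ?B)"
      using degree_mult_le[of ?A ?B] by linarith
    then show "int (degree (?A * ?B)) \<le> (x k - x' k) + (y' k - y k)"
      using lin[OF assms(1)[OF k], of "fst p k"] lin[OF assms(2)[OF k], of "snd p k"] by linarith
  qed simp
  also have "\<dots> = wt x - wt x' + (wt y' - wt y)"
    by (simp add: sum.distrib sum_subtractf del: sum.cl_ivl_Suc)
  finally show ?thesis .
qed

text \<open>The primitives that count as exact. The bound survives raising a-exponents and lowering
  b-exponents, since each such step costs one linear factor. The constant 2 must be that large for
  \<open>bdry\<close>, whose exponent sums are -3 and -1, and that small for
  \<open>tw_independent\<close>, where the degree must stay below M + 3.\<close>

definition bdry_space :: "params \<Rightarrow> (complex \<Rightarrow> complex) set" where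
  "bdry_space p = {G. \<exists>x y U. int (degree U) \<le> wt x - wt y + 2 \<and> (\<forall>t\<in>tpts p. G t = W (sh x y p) t * poly U t)}"

lemma bdry_raise:
  assumes "int (degree U) \<le> wt x - wt y + 2" "\<And>k. k \<in> I \<Longrightarrow> x k \<le> x' k" "\<And>k. k \<in> I \<Longrightarrow> y' k \<le> y k"
  obtains U' where "int (degree U') \<le> wt x' - wt y' + 2"
    "\<And>t. t \<in> good p \<Longrightarrow> W (sh x y p) t * poly U t = W (sh x' y' p) t * poly U' t"
proof (rule that[of "ratio_poly p x y x' y' * U"])
  have "int (degree (ratio_poly p x y x' y' * U)) \<le> int (degree (ratio_poly p x y x' y')) + int (degree U)"
    using degree_mult_le[of "ratio_poly p x y x' y'" U] by linarith
  moreover have "int (degree (ratio_poly p x y x' y')) \<le> wt x' - wt x + (wt y - wt y')"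
    by (rule degree_pr) (use assms in auto)
  ultimately show "int (degree (ratio_poly p x y x' y' * U)) \<le> wt x' - wt y' + 2"
    using assms(1) by linarith
  show "W (sh x y p) t * poly U t = W (sh x' y' p) t * poly (ratio_poly p x y x' y' * U) t" if "t \<in> good p" for t
    using W_pr[of x x' y' y t p] assms that by simp
qed

lemma bdry_space_lin:
  assumes "F \<in> bdry_space p" "G \<in> bdry_space p"
  shows "(\<lambda>t. c * F t + G t) \<in> bdry_space p"
proof -
  obtain x y U where 1: "int (degree U) \<le> wt x - wt y + 2" "\<forall>t\<in>tpts p. F t = W (sh x y p) t * poly U t"
    using assms(1) by (auto simp: bdry_space_def)
  obtain x' y' V where 2: "int (degree V) \<le> wt x' - wt y' + 2" "\<forall>t\<in>tpts p. G t = W (sh x' y' p) t * poly V t"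
    using assms(2) by (auto simp: bdry_space_def)
  \<comment> \<open>A common shift from which both weights arise by polynomial factors.\<close>
  define x0 y0 where "x0 k = max (x k) (x' k)" and "y0 k = min (y k) (y' k)" for k
  obtain U0 where U0: "int (degree U0) \<le> wt x0 - wt y0 + 2"
     "\<And>t. t \<in> good p \<Longrightarrow> W (sh x y p) t * poly U t = W (sh x0 y0 p) t * poly U0 t"
    by (rule bdry_raise[OF 1(1), where p = p and x' = x0 and y' = y0]) (auto simp: x0_def y0_def)
  obtain V0 where V0: "int (degree V0) \<le> wt x0 - wt y0 + 2"
     "\<And>t. t \<in> good p \<Longrightarrow> W (sh x' y' p) t * poly V t = W (sh x0 y0 p) t * poly V0 t"
    by (rule bdry_raise[OF 2(1), where p = p and x' = x0 and y' = y0]) (auto simp: x0_def y0_def)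
  have "degree (smult c U0 + V0) \<le> max (degree U0) (degree V0)"
    by (meson degree_add_le_max degree_smult_le max.mono order_refl order_trans)
  then have "int (degree (smult c U0 + V0)) \<le> wt x0 - wt y0 + 2" using U0(1) V0(1) by linarith
  moreover have "c * F t + G t = W (sh x0 y0 p) t * poly (smult c U0 + V0) t" if t: "t \<in> tpts p" for t
  proof -
    have g: "t \<in> good p" using t tpts_good by blast
    have "F t = W (sh x0 y0 p) t * poly U0 t" "G t = W (sh x0 y0 p) t * poly V0 t"
      using t 1(2) 2(2) U0(2)[OF g] V0(2)[OF g] by auto
    then show ?thesis by (simp add: algebra_simps)
  qed
  ultimately show ?thesis unfolding bdry_space_def by blast
qed

lemma bdry_space_0: "(\<lambda>_. 0) \<in> bdry_space p"
  unfolding bdry_space_def by (auto intro!: exI[of _ Z] exI[of _ 0])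

definition afac :: "params \<Rightarrow> (nat \<Rightarrow> int) \<Rightarrow> complex poly" where
  "afac p x = (\<Prod>k\<in>I. [:1, - (fst p k * q powi x k):])"

definition bfac :: "params \<Rightarrow> (nat \<Rightarrow> int) \<Rightarrow> complex poly" where
  "bfac p y = (\<Prod>k\<in>I. [:1, - (snd p k * q powi y k):])"

lemma W_q_afac:
  assumes "t \<in> good p"
  shows "W (sh x y p) (q * t) * poly (afac p x) t = W (sh x y p) t * poly (bfac p y) t"
proof -
  have int1: "{m..<m + 1} = {m}" for m :: int by auto
  let ?x = "\<lambda>k. x k + 1" and ?y = "\<lambda>k. y k + 1"
  have "W (sh x y p) (q * t) = W (sh ?x ?y p) t"
    unfolding W_q sh_sh by (intro arg_cong[of _ _ "\<lambda>p. W p t"] sh_cong) auto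
  moreover have "W (sh x ?y p) t = W (sh ?x ?y p) t * poly (afac p x) t"
    using W_pr[of x ?x ?y ?y t p] assms by (simp add: poly_pr afac_def poly_prod int1 mult.commute)
  moreover have "W (sh x ?y p) t = W (sh x y p) t * poly (bfac p y) t"
    using W_pr[of x x y ?y t p] assms by (simp add: poly_pr bfac_def poly_prod int1 mult.commute)
  ultimately show ?thesis by simp
qed

text \<open>The least a-exponents for which, with b-exponents 0, all the weights
  \<open>T^s W\<close> with \<open>s \<in> J\<close> are polynomial multiples of one weight.\<close>

definition amax :: "nat \<Rightarrow> int" where "amax = Z(1 := int M)"

definition tw_poly :: "params \<Rightarrow> (int \<Rightarrow> complex) \<Rightarrow> (nat \<Rightarrow> int) \<Rightarrow> (nat \<Rightarrow> int) \<Rightarrow> complex poly" where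
  "tw_poly p c x y = (\<Sum>s\<in>J. smult (c s) (ratio_poly p (Z(1 := s)) (Z(1 := s)) x y))"

definition exact_at :: "params \<Rightarrow> (int \<Rightarrow> complex) \<Rightarrow> (nat \<Rightarrow> int) \<Rightarrow> (nat \<Rightarrow> int) \<Rightarrow> complex poly \<Rightarrow> bool" where
  "exact_at p c x y U \<longleftrightarrow> (\<forall>t\<in>tpts p. t * (\<Sum>s\<in>J. c s * W (tw s p) t) =
      W (sh x y p) (q * t) * poly U (q * t) - W (sh x y p) t * poly U t)"

text \<open>The weights at \<open>q * t\<close> and at \<open>t\<close> have the quotient
  \<open>bfac / afac\<close>. Once it is cleared and the weight cancelled, both sides are
  polynomials that agree at infinitely many \<open>t\<close>.\<close>

lemma exact_poly:
  assumes p: "p \<in> D" and E: "exact_at p c x y U"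
    and xy: "\<And>k. k \<in> I \<Longrightarrow> amax k \<le> x k" "\<And>k. k \<in> I \<Longrightarrow> y k \<le> 0"
  shows "([:0, 1:] * tw_poly p c x y + U) * afac p x = pcompose U [:0, q:] * bfac p y"
    (is "?L = ?R")
proof -
  have "poly ?L t = poly ?R t" if t: "t \<in> tpts p" for t
  proof -
    have g: "t \<in> good p" using t tpts_good by blast
    have "W (tw s p) t = W (sh x y p) t * poly (ratio_poly p (Z(1 := s)) (Z(1 := s)) x y) t" if "s \<in> J" for s
      unfolding tw_def
    proof (rule W_pr[OF _ _ g])
      show "(Z(1 := s)) k \<le> x k" if "k \<in> I" for k
        using xy(1)[OF that] \<open>s \<in> J\<close> by (auto simp: amax_def split: if_splits)
      show "y k \<le> (Z(1 := s)) k" if "k \<in> I" for k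
        using xy(2)[OF that] \<open>s \<in> J\<close> by auto
    qed
    then have S: "(\<Sum>s\<in>J. c s * W (tw s p) t) = W (sh x y p) t * poly (tw_poly p c x y) t"
      by (simp add: tw_poly_def poly_sum sum_distrib_left mult_ac)
    have "t * (W (sh x y p) t * poly (tw_poly p c x y) t) =
        W (sh x y p) (q * t) * poly U (q * t) - W (sh x y p) t * poly U t"
      using E t unfolding exact_at_def S[symmetric] by blast
    then have "W (sh x y p) t * (t * poly (tw_poly p c x y) t + poly U t) = W (sh x y p) (q * t) * poly U (q * t)"
      by (simp add: algebra_simps)
    then have "W (sh x y p) t * (t * poly (tw_poly p c x y) t + poly U t) * poly (afac p x) t
        = W (sh x y p) t * poly (bfac p y) t * poly U (q * t)"
      using W_q_afac[OF g, of x y] by (simp add: algebra_simps)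
    then have "(t * poly (tw_poly p c x y) t + poly U t) * poly (afac p x) t = poly (bfac p y) t * poly U (q * t)"
      using W_tpts_nz[OF t, of x y] by (simp add: mult.assoc)
    then show ?thesis by (simp add: poly_pcompose algebra_simps)
  qed
  then have "tpts p \<subseteq> {t. poly (?L - ?R) t = 0}" by auto
  then have "infinite {t. poly (?L - ?R) t = 0}" using infinite_tpts finite_subset by blast
  then have "?L - ?R = 0" using poly_roots_finite by blast
  then show ?thesis by simp
qed

lemma bfac_nz: "p \<in> D \<Longrightarrow> k \<in> I \<Longrightarrow> poly (bfac p y) (1 / (fst p k * q powi n)) \<noteq> 0"
proof -
  assume p: "p \<in> D" and k: "k \<in> I"
  have "1 - snd p j * q powi y j * (q powi (- n) / fst p k) \<noteq> 0" if "j \<in> I" for j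
    by (rule ab_ne(2)[OF p k that])
  moreover have "q powi (- n) / fst p k = 1 / (fst p k * q powi n)" using q0 by (simp add: power_int_minus field_simps)
  ultimately show ?thesis using q0 by (auto simp: bfac_def poly_prod mult_ac)
qed

lemma afac_nz: "p \<in> D \<Longrightarrow> k \<in> I \<Longrightarrow> poly (afac p x) (1 / (snd p k * q powi n)) \<noteq> 0"
proof -
  assume p: "p \<in> D" and k: "k \<in> I"
  have "1 - fst p j * q powi x j * (q powi (- n) / snd p k) \<noteq> 0" if "j \<in> I" for j
    by (rule ab_ne(1)[OF p that k])
  moreover have "q powi (- n) / snd p k = 1 / (snd p k * q powi n)" using q0 by (simp add: power_int_minus field_simps)
  ultimately show ?thesis using q0 by (auto simp: afac_def poly_prod mult_ac)
qed

lemma wt_upd: "k \<in> I \<Longrightarrow> wt (x(k := m)) = wt x - x k + m"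
proof -
  assume k: "k \<in> I"
  have "wt (x(k := m)) = (x(k := m)) k + sum (x(k := m)) (I - {k})" using k by (intro sum.remove) auto
  also have "sum (x(k := m)) (I - {k}) = sum x (I - {k})" by (rule sum.cong) auto
  also have "\<dots> = wt x - x k" using k by (subst sum_diff1) auto
  finally show ?thesis by simp
qed

text \<open>
  Poles of a primitive away from the poles of the integrand would propagate along \<open>q\<close>-orbits;
  so they can be removed one at a time.
\<close>

lemma exact_descent:
  assumes p: "p \<in> D" and "exact_at p c x y U" "int (degree U) \<le> wt x - wt y + 2"
    and "\<And>k. k \<in> I \<Longrightarrow> amax k \<le> x k" "\<And>k. k \<in> I \<Longrightarrow> y k \<le> 0"
  obtains U' where "exact_at p c amax Z U'" "int (degree U') \<le> wt amax + 2"
proof -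
  have "\<exists>U'. exact_at p c amax Z U' \<and> int (degree U') \<le> wt amax + 2"
    using assms(2-5)
  proof (induction "nat (wt x - wt amax - wt y)" arbitrary: x y U rule: less_induct)
    case less
    have wx: "wt amax \<le> wt x" using less.prems(3) by (intro sum_mono) auto
    have wy: "wt y \<le> 0" using less.prems(4) by (intro sum_nonpos) auto
    note P = exact_poly[OF p less.prems(1,3,4)]
    consider k where "k \<in> I" "amax k < x k" | k where "k \<in> I" "y k < 0"
      | "\<forall>k\<in>I. x k = amax k \<and> y k = 0"
      using less.prems(3,4) by (metis order.not_eq_order_implies_strict)
    then show ?case
    proof cases
      case (1 k)
      define \<alpha> where "\<alpha> = fst p k * q powi x k"
      have \<alpha>: "\<alpha> \<noteq> 0" using D_nz(1)[OF p 1(1)] q0 by (simp add: \<alpha>_def)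
      have "poly (afac p x) (1 / \<alpha>) = 0"
        using 1(1) \<alpha> by (auto simp: afac_def poly_prod \<alpha>_def intro!: bexI[of _ k])
      then have "poly (pcompose U [:0, q:] * bfac p y) (1 / \<alpha>) = 0"
        using arg_cong[OF P, of "\<lambda>f. poly f (1 / \<alpha>)"] by simp
      \<comment> \<open>This is the zero of \<open>1 - a_k q^(x k - 1) t\<close>, the very factor by
        which lowering \<open>x k\<close> multiplies the weight. It can therefore be moved from
        \<open>U\<close> into the weight.\<close>
      then have "poly U (q / \<alpha>) = 0"
        using bfac_nz[OF p 1(1), of y "x k"] by (simp add: \<alpha>_def poly_pcompose)
      moreover have q\<alpha>: "q / \<alpha> = 1 / (fst p k * q powi (x k - 1))"
        using q0 by (simp add: \<alpha>_def power_int_diff)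
      ultimately obtain V where V: "U = [:1, - (fst p k * q powi (x k - 1)):] * V" "degree V \<le> degree U - 1"
        using linear_dvd_root[of "fst p k * q powi (x k - 1)" U] D_nz(1)[OF p 1(1)] q0 by auto
      let ?x = "x(k := x k - 1)"
      have W: "W (sh x y p) t * poly U t = W (sh ?x y p) t * poly V t" for t
      proof -
        have Wa: "W (sh ?x y p) t = (1 - fst p k * q powi ?x k * t) * W (sh x y p) t"
          by (rule W_a_eq[OF 1(1)]) auto
        show ?thesis unfolding V(1) Wa by (simp add: algebra_simps)
      qed
      have w: "wt ?x = wt x - 1" using wt_upd[OF 1(1)] by simp
      have wx': "wt amax \<le> wt ?x" using less.prems(3) 1 by (intro sum_mono) (auto intro: order_trans)
      \<comment> \<open>\<open>degree U - 1\<close> is truncated at 0, so the bound for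
        \<open>V\<close> also needs its right-hand side to be nonnegative.\<close>
      have "wt amax \<ge> 0" by (intro sum_nonneg) (auto simp: amax_def)
      show ?thesis
      proof (rule less.hyps)
        show "nat (wt ?x - wt amax - wt y) < nat (wt x - wt amax - wt y)" using w wx' wy by linarith
        show "exact_at p c ?x y V" using less.prems(1) unfolding exact_at_def W .
        show "int (degree V) \<le> wt ?x - wt y + 2"
          using V(2) less.prems(2) w wx' wy \<open>wt amax \<ge> 0\<close> by linarith
        show "amax j \<le> ?x j" if "j \<in> I" for j using less.prems(3)[OF that] 1 by auto
      qed (use less.prems(4) in auto)
    next
      case (2 k)
      define \<beta> where "\<beta> = snd p k * q powi y k"
      have \<beta>: "\<beta> \<noteq> 0" using D_nz(2)[OF p 2(1)] q0 by (simp add: \<beta>_def)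
      have "poly (bfac p y) (1 / \<beta>) = 0"
        using 2(1) \<beta> by (auto simp: bfac_def poly_prod \<beta>_def intro!: bexI[of _ k])
      then have "poly (([:0, 1:] * tw_poly p c x y + U) * afac p x) (1 / \<beta>) = 0"
        using arg_cong[OF P, of "\<lambda>f. poly f (1 / \<beta>)"] by simp
      \<comment> \<open>Since \<open>y k < 0 \<le> s\<close>, the quotient polynomial of each power
        \<open>s\<close> contains the factor \<open>1 - \<beta> t\<close>.\<close>
      moreover have "poly (ratio_poly p (Z(1 := s)) (Z(1 := s)) x y) (1 / \<beta>) = 0" if s: "s \<in> J" for s
      proof -
        have "(\<Prod>j\<in>{y k..<(Z(1 := s)) k}. 1 - snd p k * q powi j * (1 / \<beta>)) = 0"
          by (rule prod_zero) (use 2 s \<beta> in \<open>auto simp: \<beta>_def intro!: bexI[of _ "y k"]\<close>)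
        then show ?thesis unfolding poly_pr by (intro prod_zero bexI[of _ k]) (use 2 in auto)
      qed
      then have "poly (tw_poly p c x y) (1 / \<beta>) = 0" by (simp add: tw_poly_def poly_sum)
      ultimately have "poly U (1 / \<beta>) = 0"
        using afac_nz[OF p 2(1), of x "y k"] by (simp add: \<beta>_def)
      then obtain V where V: "U = [:1, - \<beta>:] * V" "degree V \<le> degree U - 1"
        using linear_dvd_root[OF \<beta>] by blast
      let ?y = "y(k := y k + 1)"
      have W: "W (sh x y p) t * poly U t = W (sh x ?y p) t * poly V t" if "t \<in> good p" for t
        unfolding V(1) \<beta>_def W_b[OF 2(1) that] by (simp add: algebra_simps)
      have w: "wt ?y = wt y + 1" using wt_upd[OF 2(1)] by simp
      have wy': "wt ?y \<le> 0" using less.prems(4) 2 by (intro sum_nonpos) auto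
      have "wt amax \<ge> 0" by (intro sum_nonneg) (auto simp: amax_def)
      show ?thesis
      proof (rule less.hyps)
        show "nat (wt x - wt amax - wt ?y) < nat (wt x - wt amax - wt y)" using w wy' wx by linarith
        show "exact_at p c x ?y V" unfolding exact_at_def
        proof
          fix t assume t: "t \<in> tpts p"
          have g: "t \<in> good p" "q * t \<in> good p" using t tpts_q[OF t] tpts_good[of p] by auto
          show "t * (\<Sum>s\<in>J. c s * W (tw s p) t) =
             W (sh x ?y p) (q * t) * poly V (q * t) - W (sh x ?y p) t * poly V t"
            using less.prems(1) t unfolding exact_at_def W[OF g(1), symmetric] W[OF g(2), symmetric] by blast
        qed
        show "int (degree V) \<le> wt x - wt ?y + 2"
          using V(2) less.prems(2) w wx wy' \<open>wt amax \<ge> 0\<close> by linarith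
        show "?y j \<le> 0" if "j \<in> I" for j using less.prems(4)[OF that] 2 by auto
      qed (use less.prems(3) in auto)
    next
      case 3
      then have e: "sh x y p = sh amax Z p" "wt x = wt amax" "wt y = wt Z"
        by (auto intro: sh_cong sum.cong simp del: sum.cl_ivl_Suc)
      then show ?thesis using less.prems(1,2) unfolding exact_at_def by (intro exI[of _ U]) auto
    qed
  qed
  then show thesis using that by blast
qed

text \<open>After the descent the primitive is a weight times \<open>V\<close> with degree at most M
  + 2. The M + 3 linear factors of \<open>afac p amax\<close> have no zero in common with
  \<open>bfac\<close> on \<open>D\<close>, so they divide \<open>V(q t)\<close>; thus
  \<open>V\<close> is zero, and with it the combination itself.\<close>

lemma tw_independent:
  assumes p: "p \<in> D" and G: "G \<in> bdry_space p"
    and E: "\<And>t. t \<in> tpts p \<Longrightarrow> t * (\<Sum>s\<in>J. c s * W (tw s p) t) = G (q * t) - G t"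
    and s: "s \<in> J"
  shows "c s = 0"
proof -
  obtain x y U where U: "int (degree U) \<le> wt x - wt y + 2" "\<forall>t\<in>tpts p. G t = W (sh x y p) t * poly U t"
    using G by (auto simp: bdry_space_def)
  define x0 y0 where "x0 k = max (x k) (amax k)" and "y0 k = min (y k) 0" for k
  obtain U0 where U0: "int (degree U0) \<le> wt x0 - wt y0 + 2"
     "\<And>t. t \<in> good p \<Longrightarrow> W (sh x y p) t * poly U t = W (sh x0 y0 p) t * poly U0 t"
    by (rule bdry_raise[OF U(1), where p = p and x' = x0 and y' = y0]) (auto simp: x0_def y0_def)
  have "G t = W (sh x0 y0 p) t * poly U0 t" if t: "t \<in> tpts p" for t
  proof -
    have "t \<in> good p" using t tpts_good by blast
    then show ?thesis using U(2) U0(2) t by simp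
  qed
  then have "exact_at p c x0 y0 U0" unfolding exact_at_def using E tpts_q by auto
  then obtain V where V: "exact_at p c amax Z V" "int (degree V) \<le> wt amax + 2"
    by (rule exact_descent[OF p _ U0(1)]) (auto simp: x0_def y0_def)
  have P: "([:0, 1:] * tw_poly p c amax Z + V) * afac p amax = pcompose V [:0, q:] * bfac p Z"
    by (rule exact_poly[OF p V(1)]) auto
  have "V = 0"
  proof (rule ccontr)
    assume "V \<noteq> 0"
    then have nz: "pcompose V [:0, q:] \<noteq> 0" using pcompose_eq_0[of V "[:0, q:]"] q0 by auto
    have "afac p amax dvd pcompose V [:0, q:] * bfac p Z" unfolding P[symmetric] by simp
    then have "afac p amax dvd pcompose V [:0, q:]"
      unfolding afac_def by (rule prod_linear_dvd[rotated]) (use D_nz(1)[OF p] bfac_nz[OF p] q0 in auto)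
    then have "degree (afac p amax) \<le> degree (pcompose V [:0, q:])" using nz by (rule dvd_imp_degree_le)
    also have "\<dots> \<le> degree V" using degree_pcompose_le[of V "[:0, q:]"] q0 by simp
    finally have "degree (afac p amax) \<le> degree V" .
    moreover have "degree (afac p amax) = (\<Sum>k\<in>I. degree [:1, - (fst p k * q powi amax k):])"
      unfolding afac_def by (rule degree_prod_sum_eq) auto
    moreover have "\<dots> = (\<Sum>k\<in>I. 1)"
      by (rule sum.cong[OF refl]) (use D_nz(1)[OF p] q0 in auto)
    moreover have "wt amax = int M" unfolding amax_def by (rule wt_single) simp
    ultimately show False using V(2) by simp
  qed
  then have "[:0, 1:] * tw_poly p c amax Z * afac p amax = 0" using P by simp
  moreover have "afac p amax \<noteq> 0" by (simp add: afac_def)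
  ultimately have Q: "tw_poly p c amax Z = 0" by auto
  have "c (int n) = 0" if "n \<le> M" for n
    using that
  proof (induction n rule: less_induct)
    case (less n)
    \<comment> \<open>At this \<open>t\<close> the b-factor of index \<open>n\<close> vanishes.
      Powers \<open>s > n\<close> contain it and powers \<open>s < n\<close> are gone by induction,
      which isolates the coefficient of \<open>T^n\<close>.\<close>
    define t where "t = q powi (- int n) / snd p 1"
    have b: "snd p 1 \<noteq> 0" using D_nz(2)[OF p] by simp
    have bt: "snd p 1 * q powi j * t = q powi (j - int n)" for j
      using b q0 by (simp add: t_def power_int_diff power_int_minus field_simps)
    have "poly (ratio_poly p (Z(1 := s)) (Z(1 := s)) amax Z) t = 0" if "s > int n" for s
    proof -
      have "(\<Prod>j\<in>{Z 1..<(Z(1 := s)) 1}. 1 - snd p 1 * q powi j * t) = 0"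
        by (rule prod_zero) (use that bt[of "int n"] in \<open>auto intro!: bexI[of _ "int n"]\<close>)
      then show ?thesis unfolding poly_pr by (intro prod_zero bexI[of _ 1]) auto
    qed
    then have "poly (tw_poly p c amax Z) t = (\<Sum>s\<in>J. if s = int n then c s * poly (ratio_poly p (Z(1 := s)) (Z(1 := s)) amax Z) t else 0)"
      unfolding tw_poly_def poly_sum using less
      by (intro sum.cong refl) (auto, metis less_imp_of_nat_less linorder_neqE nat_0_le nat_less_iff nat_int of_nat_0_le_iff order_less_le_trans
        not_le of_nat_le_iff zle_int)
    also have "\<dots> = c (int n) * poly (ratio_poly p (Z(1 := int n)) (Z(1 := int n)) amax Z) t"
      using less.prems by (subst sum.delta) auto
    finally have "c (int n) * poly (ratio_poly p (Z(1 := int n)) (Z(1 := int n)) amax Z) t = 0" using Q by simp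
    moreover have "poly (ratio_poly p (Z(1 := int n)) (Z(1 := int n)) amax Z) t \<noteq> 0"
    proof -
      have 1: "1 - fst p k * q powi j * t \<noteq> 0" if "k \<in> I" for j k
        unfolding t_def by (rule ab_ne(1)[OF p that I1])
      have 2: "1 - snd p 1 * q powi j * t \<noteq> 0" if "j < int n" for j
        unfolding bt using that powi_q_eq_1_iff[of "j - int n"] by auto
      show ?thesis unfolding poly_pr using 1 2 by auto
    qed
    ultimately show ?case by simp
  qed
  from this[of "nat s"] s show ?thesis by auto
qed

definition qdiff :: "params \<Rightarrow> (complex \<Rightarrow> complex) \<Rightarrow> complex \<Rightarrow> complex" where
  "qdiff p G t = (if t \<in> tpts p then G (q * t) - G t else 0)"

text \<open>The subspace \<open>U\<close> is spanned by the exact functions and the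
  \<open>T^s\<close> with \<open>s\<close> different from \<open>s0\<close>; by
  \<open>tw_independent\<close> it does not contain \<open>T^s0\<close>, so a separating functional
  is dual to it.\<close>

lemma dual_functional:
  assumes p: "p \<in> D" and s0: "s0 \<in> J"
  obtains L where "lin_on UNIV L" "\<And>G. G \<in> bdry_space p \<Longrightarrow> L (qdiff p G) = 0"
    "\<And>s. s \<in> J \<Longrightarrow> L (tW (tpts p) (tw s p)) = (if s = s0 then 1 else 0)"
proof -
  let ?S = "\<lambda>c t. \<Sum>s\<in>J. c s * tW (tpts p) (tw s p) t"
  define U where "U = {\<lambda>t. qdiff p G t + ?S c t | G c.
     G \<in> bdry_space p \<and> c s0 = 0}"
  have UI: "(\<lambda>t. qdiff p G t + ?S c t) \<in> U"
    if "G \<in> bdry_space p" "c s0 = 0" for G c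
    using that unfolding U_def by blast
  have 0: "(\<lambda>_. 0) \<in> U"
    using UI[OF bdry_space_0, of "\<lambda>_. 0"] by (simp add: qdiff_def cong: if_cong)
  have lin: "(\<lambda>t. c * f t + g t) \<in> U" if "f \<in> U" "g \<in> U" for c f g
  proof -
    obtain F d where f: "f = (\<lambda>t. qdiff p F t + ?S d t)"
      "F \<in> bdry_space p" "d s0 = 0" using \<open>f \<in> U\<close> unfolding U_def by blast
    obtain G e where g: "g = (\<lambda>t. qdiff p G t + ?S e t)"
      "G \<in> bdry_space p" "e s0 = 0" using \<open>g \<in> U\<close> unfolding U_def by blast
    have "(\<lambda>t. c * f t + g t) = (\<lambda>t. qdiff p (\<lambda>t. c * F t + G t) t +
        (\<Sum>s\<in>J. (c * d s + e s) * tW (tpts p) (tw s p) t))"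
      unfolding f(1) g(1)
      by (auto simp: qdiff_def sum.distrib sum_distrib_left algebra_simps fun_eq_iff)
    moreover have "\<dots> \<in> U" using f g by (intro UI bdry_space_lin) auto
    ultimately show ?thesis by simp
  qed
  have "tW (tpts p) (tw s0 p) \<notin> U"
  proof
    assume "tW (tpts p) (tw s0 p) \<in> U"
    then obtain G c where G: "tW (tpts p) (tw s0 p) = (\<lambda>t. qdiff p G t + ?S c t)"
      "G \<in> bdry_space p" "c s0 = 0" unfolding U_def by blast
    define d where "d s = (if s = s0 then 1 else 0) - c s" for s
    have "t * (\<Sum>s\<in>J. d s * W (tw s p) t) = G (q * t) - G t" if t: "t \<in> tpts p" for t
    proof -
      have "(\<Sum>s\<in>J. d s * W (tw s p) t) =
         (\<Sum>s\<in>J. if s = s0 then W (tw s p) t else 0) - (\<Sum>s\<in>J. c s * W (tw s p) t)"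
        unfolding sum_subtractf[symmetric] by (rule sum.cong) (auto simp: d_def algebra_simps)
      also have "\<dots> = W (tw s0 p) t - (\<Sum>s\<in>J. c s * W (tw s p) t)"
        using s0 by (subst sum.delta) auto
      finally have "t * (\<Sum>s\<in>J. d s * W (tw s p) t) =
         tW (tpts p) (tw s0 p) t - ?S c t"
        using t by (simp add: tW_def sum_distrib_left right_diff_distrib mult_ac)
      also have "\<dots> = qdiff p G t" using fun_cong[OF G(1), of t] by simp
      finally show ?thesis using t by (simp add: qdiff_def)
    qed
    from tw_independent[OF p G(2) this s0] show False using G(3) by (simp add: d_def)
  qed
  from separating_functional[OF 0 lin this]
  obtain L where L: "lin_on UNIV L" "\<And>u. u \<in> U \<Longrightarrow> L u = 0" "L (tW (tpts p) (tw s0 p)) = 1"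
    by blast
  have "L (qdiff p G) = 0" if "G \<in> bdry_space p" for G
    using L(2)[OF UI[OF that, of "\<lambda>_. 0"]] by simp
  moreover have "L (tW (tpts p) (tw s p)) = (if s = s0 then 1 else 0)" if s: "s \<in> J" for s
  proof (cases "s = s0")
    case False
    have "(\<Sum>r\<in>J. (if r = s then 1 else 0) * tW (tpts p) (tw r p) t) = tW (tpts p) (tw s p) t" for t
    proof -
      have "(\<Sum>r\<in>J. (if r = s then 1 else 0) * tW (tpts p) (tw r p) t) =
         (\<Sum>r\<in>J. if r = s then tW (tpts p) (tw r p) t else 0)" by (rule sum.cong) auto
      then show ?thesis using s by (subst (asm) sum.delta) auto
    qed
    then show ?thesis
      using L(2)[OF UI[OF bdry_space_0, of "\<lambda>r. if r = s then 1 else 0"]] False by (simp add: qdiff_def cong: if_cong)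
  qed (use L(3) in simp)
  ultimately show thesis using that L(1) by blast
qed

end

section \<open>The rank\<close>

context q_rp
begin

section \<open>Gluing functionals along shift orbits\<close>

definition orb :: "params \<Rightarrow> params \<Rightarrow> bool" where
  "orb p p' \<longleftrightarrow> (\<exists>x y. wt x = wt y \<and> p' = sh x y p)"

lemma orb_sh: "wt x = wt y \<Longrightarrow> orb p (sh x y p)"
  unfolding orb_def by blast

lemma wt_uminus: "wt (\<lambda>k. - x k) = - wt x"
  by (rule sum_negf)

lemma sh_uminus: "sh (\<lambda>k. - x k) (\<lambda>k. - y k) (sh x y p) = p"
  unfolding sh_sh by simp

lemma orb_refl: "orb p p"
  using orb_sh[of Z Z p] by simp

lemma orb_sym: "orb p p' \<Longrightarrow> orb p' p"
proof -
  assume "orb p p'"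
  then obtain x y where "wt x = wt y" "p' = sh x y p" unfolding orb_def by blast
  then show ?thesis
    using orb_sh[of "\<lambda>k. - x k" "\<lambda>k. - y k" p'] by (simp only: sh_uminus wt_uminus)
qed

lemma orb_trans: "orb p p' \<Longrightarrow> orb p' p'' \<Longrightarrow> orb p p''"
proof -
  assume "orb p p'" "orb p' p''"
  then obtain x y x' y' where *: "wt x = wt y" "p' = sh x y p" "wt x' = wt y'" "p'' = sh x' y' p'"
    unfolding orb_def by blast
  then have "wt (\<lambda>k. x' k + x k) = wt (\<lambda>k. y' k + y k)" by (simp only: sum.distrib)
  then show ?thesis using * orb_sh by (simp add: sh_sh)
qed

text \<open>The chosen predicate is the same at all points of an orbit, so the choice depends on the
  orbit alone. Hence the values of \<open>glue\<close> along an orbit all come from one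
  functional.\<close>

definition rep :: "params set \<Rightarrow> params \<Rightarrow> params" where
  "rep A p = (SOME r. r \<in> A \<and> orb r p)"

definition glue :: "params set \<Rightarrow> (params \<Rightarrow> (complex \<Rightarrow> complex) \<Rightarrow> complex) \<Rightarrow> params \<Rightarrow> complex" where
  "glue A L p = (if \<exists>r\<in>A. orb r p then L (rep A p) (tW (tpts (rep A p)) p) else 0)"

lemma orb_cong: "wt x = wt y \<Longrightarrow> orb r (sh x y p) \<longleftrightarrow> orb r p"
  using orb_sh orb_sym orb_trans by blast

lemma rep_cong: "wt x = wt y \<Longrightarrow> rep A (sh x y p) = rep A p"
  unfolding rep_def by (simp only: orb_cong)

lemma rep_prop: "\<exists>r\<in>A. orb r p \<Longrightarrow> rep A p \<in> A \<and> orb (rep A p) p"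
  unfolding rep_def by (rule someI_ex) blast

lemma bdry_spaceI:
  assumes "int (degree U) \<le> wt x - wt y + 2"
    "\<And>t. t \<in> tpts p \<Longrightarrow> G t = W (sh x y p) t * poly U t"
  shows "G \<in> bdry_space p"
  using assms unfolding bdry_space_def by blast

lemma glue_solution:
  assumes A: "A \<subseteq> D" and L: "\<And>r. r \<in> A \<Longrightarrow> lin_on UNIV (L r)"
    and exact: "\<And>r G. r \<in> A \<Longrightarrow> G \<in> bdry_space r \<Longrightarrow> L r (qdiff r G) = 0"
  shows "qRP_solution q M (glue A L)"
  unfolding qRP_solution_iff
proof
  fix p assume p: "p \<in> D"
  show "E_hat q M (glue A L) p = 0 \<and> three_term (glue A L) p \<and> q * glue A L (sh1 p) - glue A L p = 0"
  proof (cases "\<exists>r\<in>A. orb r p")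
    case True
    define r where "r = rep A p"
    have r: "r \<in> A" "orb r p" using rep_prop[OF True] by (auto simp: r_def)
    then obtain x0 y0 where xy: "wt x0 = wt y0" "p = sh x0 y0 r" unfolding orb_def by blast
    have S: "tpts r \<subseteq> good p" using tpts_good[of r] good_sh[of x0 y0 r] xy by auto
    have V: "tW (tpts r) (sh x y p) \<in> UNIV" for x y by simp
    have Y: "glue A L (sh x y p) = L r (tW (tpts r) (sh x y p))" if "wt x = wt y" for x y
      unfolding glue_def orb_cong[OF that] rep_cong[OF that] r_def using True by simp
    have E: "E_hat q M (glue A L) p = 0"
    proof -
      define c where "c = q * snd p 1 ^ (M+1) * xfac p M"
      have "(\<lambda>t. - c * bdry p t) \<in> bdry_space r"
      proof (rule bdry_spaceI[of "[:- c:]"])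
        \<comment> \<open>The count is tight: -3 + 1 + 2 = 0 just admits a constant
          polynomial.\<close>
        have "wt bexp = (\<Sum>k\<in>insert 1 K. bexp k)" by (simp only: I_split)
        also have "\<dots> = bexp 1 + (\<Sum>k\<in>K. bexp k)" by (rule sum.insert) auto
        also have "(\<Sum>k\<in>K. bexp k) = (\<Sum>k\<in>K. -1)" by (rule sum.cong) (auto simp: bexp_def)
        finally have "wt bexp = -3" by (simp add: bexp_def)
        moreover have "wt (Z(1 := -1)) = -1" by (rule wt_single) simp
        ultimately show "int (degree [:- c:]) \<le> wt (\<lambda>k. bexp k + x0 k) - wt (\<lambda>k. (Z(1 := -1)) k + y0 k) + 2"
          using xy(1) unfolding sum.distrib by simp
        show "- c * bdry p t = W (sh (\<lambda>k. bexp k + x0 k) (\<lambda>k. (Z(1 := -1)) k + y0 k) r) t * poly [:- c:] t" for t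
          unfolding bdry_def xy(2) sh_sh by simp
      qed
      from exact[OF r(1) this] have "L r (qdiff r (\<lambda>t. - c * bdry p t)) = 0" .
      moreover have "qdiff r (\<lambda>t. - c * bdry p t) = (\<lambda>t. if t \<in> tpts r then c * (bdry p t - bdry p (q * t)) else 0)"
        by (auto simp: qdiff_def algebra_simps)
      moreover have "E_hat q M (glue A L) p =
          L r (\<lambda>t. if t \<in> tpts r then c * (bdry p t - bdry p (q * t)) else 0)"
        unfolding c_def by (rule E_hat_functional(1)[OF p S L[OF r(1)] V Y])
      ultimately show ?thesis by simp
    qed
    have T: "q * glue A L (sh1 p) - glue A L p = 0"
    proof -
      have "(\<lambda>t. t * W p t) \<in> bdry_space r"
      proof (rule bdry_spaceI[of "[:0, 1:]"])
        show "int (degree ([:0, 1:] :: complex poly)) \<le> wt x0 - wt y0 + 2" using xy(1) by simp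
        show "t * W p t = W (sh x0 y0 r) t * poly [:0, 1:] t" for t by (simp add: xy(2))
      qed
      from exact[OF r(1) this] have "L r (qdiff r (\<lambda>t. t * W p t)) = 0" .
      then show ?thesis
        using total_functional(1)[OF p S L[OF r(1)] V Y] by (simp add: qdiff_def[abs_def])
    qed
    show ?thesis using E T three_term_functional[OF p S L[OF r(1)] V Y] by simp
  next
    case False
    \<comment> \<open>On an orbit that does not meet \<open>A\<close> the zero functional on the
      empty set of points fits the same lemmas.\<close>
    define L0 :: "(complex \<Rightarrow> complex) \<Rightarrow> complex" where "L0 = (\<lambda>_. 0)"
    have lin: "lin_on UNIV L0" by (simp add: lin_on_def L0_def)
    have Y: "glue A L (sh x y p) = L0 (tW {} (sh x y p))" if "wt x = wt y" for x y
      unfolding glue_def orb_cong[OF that] L0_def using False by simp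
    note functional = p empty_subsetI lin UNIV_I Y
    show ?thesis
      using E_hat_functional(1)[OF functional] total_functional(1)[OF functional]
        three_term_functional[OF functional] by (simp add: L0_def)
  qed
qed

section \<open>Rational functions up to generic equality\<close>

lemma D_point: obtains p where "p \<in> D"
  using generic_point[of "{}"] by blast

text \<open>This is the irreducibility of the underlying variety; \<open>generic_point\<close>
  avoids both zero sets at once.\<close>

lemma poly_nz_mult:
  assumes "f \<in> polys" "g \<in> polys" "\<exists>p\<in>D. f p \<noteq> 0" "\<exists>p\<in>D. g p \<noteq> 0"
  shows "\<exists>p\<in>D. f p * g p \<noteq> 0"
proof -
  obtain p where "p \<in> D" "\<And>h. h \<in> {f, g} \<Longrightarrow> h p \<noteq> 0"
    by (rule generic_point[of "{f, g}"]) (use assms in auto)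
  then show ?thesis by auto
qed

text \<open>The closure of \<open>ratfuns\<close> under generic equality. Because of
  \<open>x / 0 = 0\<close>, a pointwise sum of two fractions differs from the fraction over the
  common denominator at zeros of denominators; this set absorbs the difference and is closed under
  sums and products.\<close>

definition genrat :: "(params \<Rightarrow> complex) set" where
  "genrat = {f. \<exists>g\<in>polys. \<exists>h\<in>polys. (\<exists>p\<in>D. h p \<noteq> 0) \<and> (\<forall>p\<in>D. h p \<noteq> 0 \<longrightarrow> f p = g p / h p)}"

lemma genratI:
  assumes "g \<in> polys" "h \<in> polys" "\<exists>p\<in>D. h p \<noteq> 0" "\<And>p. p \<in> D \<Longrightarrow> h p \<noteq> 0 \<Longrightarrow> f p = g p / h p"
  shows "f \<in> genrat"
  using assms unfolding genrat_def by blast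

lemma genratE:
  assumes "f \<in> genrat"
  obtains g h where "g \<in> polys" "h \<in> polys" "\<exists>p\<in>D. h p \<noteq> 0" "\<And>p. p \<in> D \<Longrightarrow> h p \<noteq> 0 \<Longrightarrow> f p = g p / h p"
  using assms unfolding genrat_def by blast

lemma
  assumes "f \<in> genrat" "f' \<in> genrat"
  shows genrat_add: "(\<lambda>p. f p + f' p) \<in> genrat" and genrat_mult: "(\<lambda>p. f p * f' p) \<in> genrat"
proof -
  obtain g h where 1: "g \<in> polys" "h \<in> polys" "\<exists>p\<in>D. h p \<noteq> 0" "\<And>p. p \<in> D \<Longrightarrow> h p \<noteq> 0 \<Longrightarrow> f p = g p / h p"
    using genratE[OF assms(1)] by blast
  obtain g' h' where 2: "g' \<in> polys" "h' \<in> polys" "\<exists>p\<in>D. h' p \<noteq> 0" "\<And>p. p \<in> D \<Longrightarrow> h' p \<noteq> 0 \<Longrightarrow> f' p = g' p / h' p"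
    using genratE[OF assms(2)] by blast
  show "(\<lambda>p. f p + f' p) \<in> genrat"
    by (rule genratI[of "\<lambda>p. g p * h' p + g' p * h p" "\<lambda>p. h p * h' p"])
       (use 1 2 poly_nz_mult in \<open>auto intro!: polyfuns.add polyfuns.mult simp: field_simps\<close>)
  show "(\<lambda>p. f p * f' p) \<in> genrat"
    by (rule genratI[of "\<lambda>p. g p * g' p" "\<lambda>p. h p * h' p"])
       (use 1 2 poly_nz_mult in \<open>auto intro!: polyfuns.mult\<close>)
qed

lemma genrat_reg: "f \<in> reg \<Longrightarrow> f \<in> genrat"
proof (elim regE)
  fix g h
  assume "g \<in> polys" "h \<in> polys" "\<And>p. p \<in> D \<Longrightarrow> h p \<noteq> 0" "\<And>p. p \<in> D \<Longrightarrow> f p = g p / h p"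
  moreover obtain p where "p \<in> D" by (rule D_point)
  ultimately show ?thesis by (intro genratI[of g h]) blast+
qed

lemma genrat_sum: "(\<And>i. i \<in> A \<Longrightarrow> f i \<in> genrat) \<Longrightarrow> (\<lambda>p. \<Sum>i\<in>A. f i p) \<in> genrat"
  by (induction A rule: infinite_finite_induct) (auto intro: genrat_reg reg_const genrat_add)

lemma ratfuns_genrat: "f \<in> ratfuns D X \<Longrightarrow> f \<in> genrat"
  unfolding ratfuns_def by (auto intro: genratI)

lemma genrat_ratfun:
  assumes "f \<in> genrat"
  obtains r where "r \<in> ratfuns D X" "generically_zero D X (\<lambda>p. f p - r p)"
proof -
  obtain g h where gh: "g \<in> polys" "h \<in> polys" "\<exists>p\<in>D. h p \<noteq> 0" "\<And>p. p \<in> D \<Longrightarrow> h p \<noteq> 0 \<Longrightarrow> f p = g p / h p"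
    using genratE[OF assms] by blast
  show thesis
  proof (rule that[of "\<lambda>p. g p / h p"])
    show "(\<lambda>p. g p / h p) \<in> ratfuns D X" using gh unfolding ratfuns_def by blast
    show "generically_zero D X (\<lambda>p. f p - g p / h p)" unfolding generically_zero_def
      by (intro bexI[of _ h] conjI ballI impI) (use gh in simp_all)
  qed
qed

lemma generically_zero_lincomb:
  assumes "finite A" "\<And>i. i \<in> A \<Longrightarrow> generically_zero D X (f i)"
  shows "generically_zero D X (\<lambda>p. \<Sum>i\<in>A. f i p * w i p)"
  using assms
proof (induction A rule: finite_induct)
  case empty
  obtain p where "p \<in> D" by (rule D_point)
  then have "\<exists>p\<in>D. (1 :: complex) \<noteq> 0" by (intro bexI[of _ p]) simp_all
  then show ?case unfolding generically_zero_def
    by (intro bexI[of _ "\<lambda>_. 1"] conjI) (simp_all add: polyfuns.const)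
next
  case (insert i A)
  have "generically_zero D X (f i)" "generically_zero D X (\<lambda>p. \<Sum>i\<in>A. f i p * w i p)"
    by (auto intro: insert)
  then obtain h h' where h: "h \<in> polys" "\<exists>p\<in>D. h p \<noteq> 0" "\<forall>p\<in>D. h p \<noteq> 0 \<longrightarrow> f i p = 0"
    and h': "h' \<in> polys" "\<exists>p\<in>D. h' p \<noteq> 0" "\<forall>p\<in>D. h' p \<noteq> 0 \<longrightarrow> (\<Sum>i\<in>A. f i p * w i p) = 0"
    unfolding generically_zero_def by blast
  show ?case unfolding generically_zero_def
  proof (intro bexI[of _ "\<lambda>p. h p * h' p"] conjI)
    show "\<exists>p\<in>D. h p * h' p \<noteq> 0" using poly_nz_mult h h' by blast
    show "(\<lambda>p. h p * h' p) \<in> polys" using h h' by (intro polyfuns.mult)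
    show "\<forall>p\<in>D. h p * h' p \<noteq> 0 \<longrightarrow> (\<Sum>i\<in>insert i A. f i p * w i p) = 0"
    proof (intro ballI impI)
      fix p assume p: "p \<in> D" "h p * h' p \<noteq> 0"
      then have "f i p = 0" "(\<Sum>i\<in>A. f i p * w i p) = 0" using h(3) h'(3) by auto
      then show "(\<Sum>i\<in>insert i A. f i p * w i p) = 0" using insert.hyps by simp
    qed
  qed
qed

lemma generically_zero_cong:
  "(\<And>p. p \<in> D \<Longrightarrow> f p = g p) \<Longrightarrow> generically_zero D X f \<Longrightarrow> generically_zero D X g"
proof -
  assume eq: "\<And>p. p \<in> D \<Longrightarrow> f p = g p" and "generically_zero D X f"
  then obtain h where "h \<in> polys" "\<exists>p\<in>D. h p \<noteq> 0" "\<forall>p\<in>D. h p \<noteq> 0 \<longrightarrow> f p = 0"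
    unfolding generically_zero_def by blast
  then show ?thesis unfolding generically_zero_def by (intro bexI[of _ h] conjI) (simp_all flip: eq)
qed

section \<open>The basis formed by the powers of \<open>T\<close>\<close>

definition Tpow :: "int \<Rightarrow> params operator" where
  "Tpow s = Ta q 1 s \<circ> Tb q 1 s"

lemma Tpow_tw: "Tpow s Y p = Y (tw s p)"
  unfolding Tpow_def tw_def by (rule Tab_sh; simp)

lemma Tpow_inj: "inj_on Tpow A"
proof
  fix s s' assume "Tpow s = Tpow s'"
  then have "Tpow s (\<lambda>p. fst p 1) (\<lambda>_. 1, \<lambda>_. 1) = Tpow s' (\<lambda>p. fst p 1) (\<lambda>_. 1, \<lambda>_. 1)" by simp
  then show "s = s'" by (simp add: Tpow_tw fst_tw powi_q_eq_iff)
qed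

definition Tbasis :: "params operator set" where "Tbasis = Tpow ` J"

lemma card_Tbasis: "finite Tbasis" "card Tbasis = M + 1"
  by (simp_all add: Tbasis_def card_image[OF Tpow_inj])

lemma lin_comb_Tbasis: "lin_comb c Tbasis Y p = (\<Sum>s\<in>J. c (Tpow s) p * Y (tw s p))"
  unfolding lin_comb_def Tbasis_def by (simp add: sum.reindex[OF Tpow_inj] Tpow_tw)

lemma one_ratfun: "(\<lambda>_. 1) \<in> ratfuns D X"
proof -
  obtain p where "p \<in> D" by (rule D_point)
  then show ?thesis unfolding ratfuns_def
    by (auto intro!: exI[of _ "\<lambda>_. 1"] polyfuns.const)
qed

lemma Tbasis_span: "Tbasis \<subseteq> op_span D X (rp_shift_powers q M)"
proof
  fix A assume "A \<in> Tbasis"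
  then obtain s where "A = Tpow s" by (auto simp: Tbasis_def)
  then have "A \<in> rp_shift_powers q M"
    unfolding rp_shift_powers_def Tpow_def using I1 by blast
  moreover have "A = lin_comb (\<lambda>_ _. 1) {A}" by (simp add: lin_comb_def)
  ultimately show "A \<in> op_span D X (rp_shift_powers q M)"
    unfolding op_span_def using one_ratfun by blast
qed

lemma Tbasis_spans:
  assumes "A \<in> op_span D X (rp_shift_powers q M)"
  shows "\<exists>c. (\<forall>C\<in>Tbasis. c C \<in> ratfuns D X) \<and> op_equiv D X Sol A (lin_comb c Tbasis)"
proof -
  obtain c S where A: "A = lin_comb c S" and S: "finite S" "S \<subseteq> rp_shift_powers q M"
     and c: "\<And>C. C \<in> S \<Longrightarrow> c C \<in> ratfuns D X"
    using assms unfolding op_span_def by blast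
  have "\<forall>C\<in>S. \<exists>d. (\<forall>s. d s \<in> reg) \<and> (\<forall>Y\<in>Sol. \<forall>p\<in>D. C Y p = comb d Y p)"
  proof
    fix C assume "C \<in> S"
    then obtain \<mu> where "red \<mu>" "\<And>Y p. C Y p = Y (\<mu> p)" using shift_powers_red S(2) by blast
    then show "\<exists>d. (\<forall>s. d s \<in> reg) \<and> (\<forall>Y\<in>Sol. \<forall>p\<in>D. C Y p = comb d Y p)"
      unfolding red_def by simp
  qed
  from bchoice[OF this] obtain d where d: "\<And>C s. C \<in> S \<Longrightarrow> d C s \<in> reg"
     "\<And>C Y p. C \<in> S \<Longrightarrow> Y \<in> Sol \<Longrightarrow> p \<in> D \<Longrightarrow> C Y p = comb (d C) Y p"
    by blast
  define f where "f s p = (\<Sum>C\<in>S. c C p * d C s p)" for s p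
  have "f s \<in> genrat" for s
    unfolding f_def by (intro genrat_sum genrat_mult ratfuns_genrat genrat_reg c d)
  \<comment> \<open>The exact coefficients are fractions only generically, so each is replaced by a
    genuine fraction; the error is generically zero, as the equivalence of operators
    permits.\<close>
  then have "\<forall>s. \<exists>r. r \<in> ratfuns D X \<and> generically_zero D X (\<lambda>p. f s p - r p)"
    using genrat_ratfun by metis
  from choice[OF this] obtain r where r: "\<And>s. r s \<in> ratfuns D X" "\<And>s. generically_zero D X (\<lambda>p. f s p - r s p)"
    by blast
  define c' where "c' C = r (the_inv_into J Tpow C)" for C
  have c': "c' (Tpow s) = r s" if "s \<in> J" for s
    unfolding c'_def using the_inv_into_f_f[OF Tpow_inj that] by simp
  have "generically_zero D X (\<lambda>p. A Y p - lin_comb c' Tbasis Y p)" if Y: "Y \<in> Sol" for Y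
  proof (rule generically_zero_cong)
    show "generically_zero D X (\<lambda>p. \<Sum>s\<in>J. (f s p - r s p) * Y (tw s p))"
      by (rule generically_zero_lincomb) (use r in auto)
    fix p assume p: "p \<in> D"
    have "A Y p = (\<Sum>C\<in>S. \<Sum>s\<in>J. c C p * d C s p * Y (tw s p))"
      unfolding A lin_comb_def
      by (rule sum.cong[OF refl]) (simp add: d(2)[OF _ Y p] sum_distrib_left mult.assoc)
    also have "\<dots> = (\<Sum>s\<in>J. f s p * Y (tw s p))"
      unfolding f_def sum_distrib_right by (rule sum.swap)
    finally show "(\<Sum>s\<in>J. (f s p - r s p) * Y (tw s p)) = A Y p - lin_comb c' Tbasis Y p"
      by (simp add: lin_comb_Tbasis c' left_diff_distrib sum_subtractf)
  qed
  moreover have "\<forall>C\<in>Tbasis. c' C \<in> ratfuns D X" using r by (simp add: c'_def)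
  ultimately show ?thesis unfolding op_equiv_def by blast
qed

lemma sh_restrict: "sh (restrict x I) (restrict y I) p = sh x y p"
  by (rule sh_cong) auto

lemma wt_restrict: "wt (restrict x I) = wt x"
  by (rule sum.cong) auto

text \<open>
  A combination \<open>c\<close> with \<open>c\<^sub>s \<noteq> 0\<close> is refuted by a solution that is glued from functionals on
  each shift orbit, dual to \<open>T\<^sup>s\<close> at a point of the orbit where \<open>c\<^sub>s\<close> does not vanish.  A
  polynomial can vanish at all these points only if its zeros and their shifts cover a nonempty
  Zariski open set, which is impossible for countably many hypersurfaces.
\<close>

lemma Tbasis_independent:
  assumes c: "\<And>C. C \<in> Tbasis \<Longrightarrow> c C \<in> ratfuns D X"
    and equiv: "op_equiv D X Sol (lin_comb c Tbasis) (\<lambda>_ _. 0)" and C: "C \<in> Tbasis"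
  shows "generically_zero D X (c C)"
proof (rule ccontr)
  assume nz: "\<not> generically_zero D X (c C)"
  obtain s0 where s0: "s0 \<in> J" "C = Tpow s0" using C by (auto simp: Tbasis_def)
  obtain f g where fg: "c C = (\<lambda>p. f p / g p)" "f \<in> polys" "g \<in> polys" "\<exists>p\<in>D. g p \<noteq> 0"
    using c[OF C] unfolding ratfuns_def by blast
  have fnz: "\<exists>p\<in>D. f p \<noteq> 0"
  proof (rule ccontr)
    assume "\<not> (\<exists>p\<in>D. f p \<noteq> 0)"
    then have "generically_zero D X (c C)" unfolding generically_zero_def fg(1) using fg by auto
    with nz show False by blast
  qed
  \<comment> \<open>Zeros of \<open>g\<close> are excluded too: division by zero would give the
    value 0 to \<open>c C\<close> there.\<close>
  define A where "A = {p \<in> D. f p \<noteq> 0 \<and> g p \<noteq> 0}"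
  have "\<forall>r\<in>A. \<exists>L. lin_on UNIV L \<and> (\<forall>G\<in>bdry_space r. L (qdiff r G) = 0) \<and>
     (\<forall>s\<in>J. L (tW (tpts r) (tw s r)) = (if s = s0 then 1 else 0))"
  proof
    fix r assume "r \<in> A"
    then have "r \<in> D" by (simp add: A_def)
    from dual_functional[OF this s0(1)] show "\<exists>L. lin_on UNIV L \<and> (\<forall>G\<in>bdry_space r. L (qdiff r G) = 0) \<and>
     (\<forall>s\<in>J. L (tW (tpts r) (tw s r)) = (if s = s0 then 1 else 0))" by metis
  qed
  from bchoice[OF this] obtain L where L: "\<And>r. r \<in> A \<Longrightarrow> lin_on UNIV (L r)"
      "\<And>r G. r \<in> A \<Longrightarrow> G \<in> bdry_space r \<Longrightarrow> L r (qdiff r G) = 0"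
      "\<And>r s. r \<in> A \<Longrightarrow> s \<in> J \<Longrightarrow> L r (tW (tpts r) (tw s r)) = (if s = s0 then 1 else 0)"
    by blast
  define Y where "Y = glue A L"
  have "A \<subseteq> D" unfolding A_def by blast
  then have "Y \<in> Sol" unfolding Y_def mem_Collect_eq by (rule glue_solution[OF _ L(1,2)])
  then have "generically_zero D X (lin_comb c Tbasis Y)" using equiv unfolding op_equiv_def by simp
  then obtain h where h: "h \<in> polys" "\<exists>p\<in>D. h p \<noteq> 0" "\<And>p. p \<in> D \<Longrightarrow> h p \<noteq> 0 \<Longrightarrow> lin_comb c Tbasis Y p = 0"
    unfolding generically_zero_def by blast
  \<comment> \<open>The exponent vectors are taken extensional on \<open>I\<close> because the set
    of all functions from \<open>nat\<close> to \<open>int\<close> would be uncountable.\<close>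
  define exps where "exps = {(x, y). (x, y) \<in> (I \<rightarrow>\<^sub>E (UNIV :: int set)) \<times> (I \<rightarrow>\<^sub>E UNIV) \<and> wt x = wt y}"
  define H where "H = {f, g} \<union> (\<lambda>(x, y) p. h (sh x y p)) ` exps"
  have "countable ((I \<rightarrow>\<^sub>E (UNIV :: int set)) \<times> (I \<rightarrow>\<^sub>E (UNIV :: int set)))"
    by (intro countable_SIGMA countable_PiE) auto
  then have "countable exps" by (rule countable_subset[rotated]) (auto simp: exps_def)
  then have "countable H" by (simp add: H_def)
  moreover have "H \<subseteq> polys" using fg h(1) poly_sh by (auto simp: H_def)
  moreover have "\<exists>p\<in>D. k p \<noteq> 0" if k: "k \<in> H" for k
  proof -
    from k consider "k = f" | "k = g" | x y where "wt x = wt y" "k = (\<lambda>p. h (sh x y p))"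
      by (auto simp: H_def exps_def)
    then show ?thesis
    proof cases
      case 3
      obtain p where p: "p \<in> D" "h p \<noteq> 0" using h(2) by blast
      have "sh x y (sh (\<lambda>k. - x k) (\<lambda>k. - y k) p) = p" unfolding sh_sh by simp
      moreover have "sh (\<lambda>k. - x k) (\<lambda>k. - y k) p \<in> D"
        using p(1) 3(1) by (intro sh_D) (simp_all only: wt_uminus)
      ultimately show ?thesis using p(2) 3(2) by (intro bexI[of _ "sh (\<lambda>k. - x k) (\<lambda>k. - y k) p"]) auto
    qed (use fnz fg in auto)
  qed
  ultimately obtain p where p: "p \<in> D" "\<And>k. k \<in> H \<Longrightarrow> k p \<noteq> 0" using generic_point by blast
  have hsh: "h (sh x y p) \<noteq> 0" if "wt x = wt y" for x y
  proof -
    have "(restrict x I, restrict y I) \<in> exps"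
      using that unfolding exps_def by (simp add: wt_restrict del: sum.cl_ivl_Suc)
    then have "(\<lambda>p. h (sh (restrict x I) (restrict y I) p)) \<in> H" unfolding H_def by force
    from p(2)[OF this] show ?thesis by (simp only: sh_restrict not_False_eq_True)
  qed
  have "p \<in> A" using p by (auto simp: A_def H_def)
  then have ex: "\<exists>r\<in>A. orb r p" using orb_refl by blast
  \<comment> \<open>The base point chosen for the orbit of \<open>p\<close> is in general not
    \<open>p\<close>; this is why \<open>h\<close> was made nonzero at all shifts of
    \<open>p\<close>.\<close>
  define r where "r = rep A p"
  have r: "r \<in> A" "orb r p" using rep_prop[OF ex] by (auto simp: r_def)
  obtain x y where xy: "wt x = wt y" "r = sh x y p" using orb_sym[OF r(2)] unfolding orb_def by blast
  have "Y (tw s r) = L r (tW (tpts r) (tw s r))" for s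
  proof -
    have w: "wt (\<lambda>k. (Z(1 := s)) k + x k) = wt (\<lambda>k. (Z(1 := s)) k + y k)"
      using xy(1) by (simp only: sum.distrib)
    have e: "tw s r = sh (\<lambda>k. (Z(1 := s)) k + x k) (\<lambda>k. (Z(1 := s)) k + y k) p"
      unfolding xy(2) tw_def sh_sh ..
    have "rep A (tw s r) = r" unfolding e rep_cong[OF w] by (simp add: r_def)
    moreover have "\<exists>r'\<in>A. orb r' (tw s r)" unfolding e orb_cong[OF w] by (rule ex)
    ultimately show ?thesis unfolding Y_def glue_def by simp
  qed
  \<comment> \<open>At its own base point the functional is dual to \<open>T^s0\<close>, so only the
    coefficient of that power survives.\<close>
  then have "lin_comb c Tbasis Y r = (\<Sum>s\<in>J. if s = s0 then c (Tpow s) r else 0)"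
    unfolding lin_comb_Tbasis by (intro sum.cong) (auto simp: L(3)[OF r(1)])
  also have "\<dots> = c C r" using s0 by (subst sum.delta) auto
  also have "\<dots> \<noteq> 0" using r(1) by (auto simp: fg(1) A_def)
  finally have "lin_comb c Tbasis Y r \<noteq> 0" .
  moreover have "r \<in> D" using r(1) by (simp add: A_def)
  moreover have "h r \<noteq> 0" unfolding xy(2) by (rule hsh[OF xy(1)])
  ultimately show False using h(3) by blast
qed

lemma rank_qRP: "has_rank D X (rp_shift_powers q M) Sol (M + 1)"
  unfolding has_rank_def
  using card_Tbasis Tbasis_span Tbasis_independent Tbasis_spans
  by (intro exI[of _ Tbasis]) auto

end

theorem theorem3p19:
  fixes q :: complex and M :: nat
  assumes "0 < norm q" and "norm q < 1" and "M \<ge> 1"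
  shows "(\<forall>i\<in>{1..M+3}. \<forall>j\<in>{1..M+3}. qRP_solution q M (phi q M i j)) \<and>
    has_rank (rp_domain q M) (rp_coords M) (rp_shift_powers q M) {y. qRP_solution q M y} (M + 1)"
proof -
  interpret q_rp q M using assms by unfold_locales
  show ?thesis using phi_solution rank_qRP by blast
qed

end
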